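(* Fix a prime power $q\ge2$ and set $\gamma=4q$. There is a randomized algorithm which, given positive integers $m$ and $k\le m$, runs in time $\mathrm{poly}(m)$ and outputs, with probability at least $0.99$, a $(q,\alpha,d,N,m',n')$-locally dense code $(A,\mathbf{s})$ with $m',n'\le\mathrm{poly}(m)$, $d=\gamma k=4qk$, $\alpha=1-\frac{1}{2q}$, and $N=\frac{(qm)^{2d}}{100}\ge100q^{10}(qm)^d$, provided $m$ is sufficiently large compared to $q$.
   Context: For $A\in\mathbb{F}_q^{m\times n}$, $\mathcal{C}(A)=\{A\mathbf{x}:\mathbf{x}\in\mathbb{F}_q^n\}$; $\|\mathbf{v}\|_0$ is Hamming weight; $\lambda(\mathcal{C})$ is the minimum Hamming weight of a nonzero codeword; $\mathcal{B}_{q,m}(r)=\{\mathbf{x}\in\mathbb{F}_q^m:\|\mathbf{x}\|_0\le r\}$. For $\alpha\in(0,1)$ and positive integers $d,N,m,n$, a $(q,\alpha,d,N,m,n)$-locally dense code is a pair $(A,\mathbf{s})$ with $A\in\mathbb{F}_q^{m\times n}$, $\mathbf{s}\in\mathbb{F}_q^m$, such that $\lambda(\mathcal{C}(A))>d$ and $|(\mathcal{C}(A)-\mathbf{s})\cap\mathcal{B}_{q,m}(\alpha d)|\ge N$. *)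

theory Defs
  imports
    "HOL-Probability.Probability_Mass_Function"
    "HOL-Computational_Algebra.Polynomial"
    "HOL-Library.Extended_Nat"
    "Jordan_Normal_Form.Matrix"
begin

section \<open>Linear codes and locally dense codes\<close>

definition hamming_weight :: "'a::zero Matrix.vec \<Rightarrow> nat" where
  "hamming_weight v = card {i. i < dim_vec v \<and> vec_index v i \<noteq> 0}"

definition code_of :: "'a::semiring_0 mat \<Rightarrow> 'a Matrix.vec set" where
  "code_of A = {A *\<^sub>v x | x. x \<in> carrier_vec (dim_col A)}"

text \<open>The minimum over the empty set is \<open>\<infinity>\<close>: this is the value for the code \<open>{0}\<close>.\<close>
definition min_distance :: "'a::zero Matrix.vec set \<Rightarrow> enat" where
  "min_distance C = (INF c \<in> {c \<in> C. c \<noteq> 0\<^sub>v (dim_vec c)}. enat (hamming_weight c))"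

definition hamming_ball :: "nat \<Rightarrow> real \<Rightarrow> 'a::zero Matrix.vec set" where
  "hamming_ball m r = {x \<in> carrier_vec m. real (hamming_weight x) \<le> r}"

text \<open>The alphabet size is that of the field type \<open>'a\<close>. The density parameter \<open>N\<close> is a real
  number, so that it can be instantiated with quotients such as \<open>x / 100\<close>; for integral
  \<open>N\<close> this is the usual notion, and for other \<open>N\<close> it is the usual notion at
  \<open>\<lceil>N\<rceil>\<close>.\<close>
definition locally_dense_code ::
  "real \<Rightarrow> nat \<Rightarrow> real \<Rightarrow> nat \<Rightarrow> nat \<Rightarrow> 'a::{field,finite} mat \<Rightarrow> 'a Matrix.vec \<Rightarrow> bool" where
  "locally_dense_code \<alpha> d N m n A s \<longleftrightarrow>
     0 < \<alpha> \<and> \<alpha> < 1 \<and> 0 < d \<and> 0 < N \<and> 0 < m \<and> 0 < n \<and>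
     A \<in> carrier_mat m n \<and> s \<in> carrier_vec m \<and>
     min_distance (code_of A) > enat d \<and>
     real (card ((\<lambda>c. c - s) ` code_of A \<inter> hamming_ball m (\<alpha> * real d))) \<ge> N"


section \<open>Randomized algorithms\<close>

text \<open>Algorithms are programs of an imperative language with arrays of natural numbers (a scalar
  \<open>x\<close> is the cell \<open>x[0]\<close>) and fair coin tosses; running time is the number of
  small steps. Arithmetic is restricted to addition and truncated subtraction: one step then
  increases the bit length of the largest stored number by at most a constant depending on the
  program, so the unit-cost measure is polynomially related to the running time of
  probabilistic Turing machines. With unit-cost multiplication this would fail.\<close>

datatype aexp =
    Const nat
  | Cell string aexp
  | Add aexp aexp
  | Sub aexp aexp

datatype bexp =
    Less aexp aexp
  | BNot bexp
  | BAnd bexp bexp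

datatype com =
    Skip
  | Assign string aexp aexp  \<comment> \<open>\<open>x[i] := a\<close>\<close>
  | Flip string aexp         \<comment> \<open>\<open>x[i]\<close> := uniformly random bit\<close>
  | Seq com com
  | Cond bexp com com
  | While bexp com

type_synonym memory = "string \<Rightarrow> nat \<Rightarrow> nat"

primrec aval :: "aexp \<Rightarrow> memory \<Rightarrow> nat" where
  "aval (Const n) \<sigma> = n"
| "aval (Cell x i) \<sigma> = \<sigma> x (aval i \<sigma>)"
| "aval (Add a b) \<sigma> = aval a \<sigma> + aval b \<sigma>"
| "aval (Sub a b) \<sigma> = aval a \<sigma> - aval b \<sigma>"

primrec bval :: "bexp \<Rightarrow> memory \<Rightarrow> bool" where
  "bval (Less a b) \<sigma> \<longleftrightarrow> aval a \<sigma> < aval b \<sigma>"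
| "bval (BNot b) \<sigma> \<longleftrightarrow> \<not> bval b \<sigma>"
| "bval (BAnd b c) \<sigma> \<longleftrightarrow> bval b \<sigma> \<and> bval c \<sigma>"

definition store :: "string \<Rightarrow> nat \<Rightarrow> nat \<Rightarrow> memory \<Rightarrow> memory" where
  "store x i v \<sigma> = \<sigma>(x := (\<sigma> x)(i := v))"

primrec step :: "com \<Rightarrow> memory \<Rightarrow> (com \<times> memory) pmf" where
  "step Skip \<sigma> = return_pmf (Skip, \<sigma>)"
| "step (Assign x i a) \<sigma> = return_pmf (Skip, store x (aval i \<sigma>) (aval a \<sigma>) \<sigma>)"
| "step (Flip x i) \<sigma> =
     map_pmf (\<lambda>b. (Skip, store x (aval i \<sigma>) (if b then 1 else 0) \<sigma>)) (bernoulli_pmf (1/2))"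
| "step (Seq c1 c2) \<sigma> =
     (if c1 = Skip then return_pmf (c2, \<sigma>)
      else map_pmf (\<lambda>(c1', \<sigma>'). (Seq c1' c2, \<sigma>')) (step c1 \<sigma>))"
| "step (Cond b c1 c2) \<sigma> = return_pmf (if bval b \<sigma> then c1 else c2, \<sigma>)"
| "step (While b c) \<sigma> = return_pmf (if bval b \<sigma> then Seq c (While b c) else Skip, \<sigma>)"

text \<open>Distribution of the configuration after \<open>t\<close> steps. A program has halted once it has
  become \<open>Skip\<close>, which is left unchanged by further steps.\<close>
primrec run :: "nat \<Rightarrow> com \<Rightarrow> memory \<Rightarrow> (com \<times> memory) pmf" where
  "run 0 c \<sigma> = return_pmf (c, \<sigma>)"
| "run (Suc t) c \<sigma> = bind_pmf (step c \<sigma>) (\<lambda>(c', \<sigma>'). run t c' \<sigma>')"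

text \<open>Halting within \<open>t\<close> steps for every outcome of the coin tosses.\<close>
definition halts_within :: "nat \<Rightarrow> com \<Rightarrow> memory \<Rightarrow> bool" where
  "halts_within t c \<sigma> \<longleftrightarrow> (\<forall>(c', \<sigma>') \<in> set_pmf (run t c \<sigma>). c' = Skip)"

definition input_memory :: "nat \<Rightarrow> nat \<Rightarrow> memory" where
  "input_memory m k = store ''k'' 0 k (store ''m'' 0 m (\<lambda>x i. 0))"

text \<open>The memory \<open>\<sigma>\<close> holds the matrix \<open>A\<close> (in row-major order) and the vector
  \<open>s\<close> as output, where \<open>code\<close> is the encoding of field elements as numbers.\<close>
definition outputs ::
  "('a \<Rightarrow> nat) \<Rightarrow> memory \<Rightarrow> 'a mat \<Rightarrow> 'a Matrix.vec \<Rightarrow> bool" where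
  "outputs code \<sigma> A s \<longleftrightarrow>
     dim_row A = \<sigma> ''rows'' 0 \<and> dim_col A = \<sigma> ''cols'' 0 \<and> dim_vec s = \<sigma> ''rows'' 0 \<and>
     (\<forall>i < dim_row A. \<forall>j < dim_col A.
        \<sigma> ''A'' (i * dim_col A + j) = code (A $$ (i, j))) \<and>
     (\<forall>i < dim_vec s. \<sigma> ''s'' i = code (vec_index s i))"

end

theory Submission
  imports Defs "HOL-Algebra.Algebraic_Closure_Type" "HOL-Algebra.Multiplicative_Group"
begin

text \<open>
  Let \<open>H\<close> be the parity check matrix of a BCH code of length \<open>n = q\<^sup>h - 1\<close>, whose minimum distance
  exceeds \<open>d\<close>. Instead of a basis of the kernel of \<open>H\<close>, which would require Gaussian elimination, the
  algorithm outputs the matrix \<open>A\<close> that consists of \<open>d + 1\<close> copies of \<open>H\<close> on top of the identity: the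
  weight of \<open>A x\<close> exceeds \<open>d\<close> because of the copies if \<open>H x \<noteq> 0\<close>, and because \<open>x\<close> is a word of the BCH
  code if \<open>H x = 0\<close>. For a random 0/1 word \<open>e\<close> of weight \<open>w = (4q - 2) k = \<alpha> d\<close>, the target consists of
  \<open>d + 1\<close> copies of \<open>H e\<close> on top of \<open>0\<close>; every word \<open>x\<close> of the same form as \<open>e\<close> with \<open>H x = H e\<close>
  yields a codeword \<open>A x\<close> at distance \<open>w\<close>. By the Frobenius map only the rows of \<open>H\<close> whose exponent is
  not divisible by \<open>q\<close> matter, so there are at most \<open>q\<^bsup>h(d - d/q)\<^esup>\<close> syndromes, and all but a hundredth of the words \<open>e\<close>
  share their syndrome with at least a hundredth of the average number of words. As \<open>d - d/q\<close> is smaller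
  than \<open>w\<close>, this average is large enough once \<open>q\<^sup>h\<close> is a sufficiently large power of \<open>m\<close>. The
  field with \<open>q\<^sup>h\<close> elements comes from a primitive polynomial that is found by exhaustive search.
\<close>

section \<open>Semantics and running time\<close>

text \<open>The obstacle is that the radius is smaller than the distance: about
  \<open>q^(h w)\<close> words would face \<open>q^(h d)\<close> syndromes with
  \<open>w < d\<close>. Discarding the exponents divisible by \<open>q\<close> leaves
  \<open>d - d/q = (4q - 4) k\<close> vectors of length \<open>h\<close> against
  \<open>w = (4q - 2) k\<close> free positions. The surplus of \<open>2k\<close> factors
  \<open>q^h\<close> has to pay for the density \<open>(qm)^(2d) = (qm)^(8qk)\<close> and for a loss
  of at most \<open>8qm\<close> per position, caused by the blocks of dyadic length. This is the
  origin of the condition \<open>(8qm)^(6q) \<le> q^h\<close>. Randomness enters only through the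
  target. The matrix, its minimum distance and the time bound are the same for all coin tosses; only
  the number of close codewords can fail to be large. Since \<open>q^h\<close> is polynomial in
  \<open>m\<close> for fixed \<open>q\<close>, brute force is affordable throughout: all polynomials
  of degree \<open>h\<close> may be tried, all powers of \<open>X\<close> up to the largest exponent
  may be tabulated, and numbers may be multiplied by repeated addition.\<close>

lemma run_Skip [simp]: "run t Skip \<sigma> = return_pmf (Skip, \<sigma>)"
  by (induction t) (simp_all add: bind_return_pmf)

lemma run_add: "run (s + t) c \<sigma> = bind_pmf (run s c \<sigma>) (\<lambda>(c', \<sigma>'). run t c' \<sigma>')"
  by (induction s arbitrary: c \<sigma>) (simp_all add: bind_return_pmf bind_assoc_pmf case_prod_unfold)

lemma run_stable:
  assumes "halts_within s c \<sigma>" "s \<le> t"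
  shows "run t c \<sigma> = run s c \<sigma>"
proof -
  have "run t c \<sigma> = bind_pmf (run s c \<sigma>) (\<lambda>(c', \<sigma>'). run (t - s) c' \<sigma>')"
    using run_add[of s "t - s"] assms(2) by simp
  also have "\<dots> = bind_pmf (run s c \<sigma>) return_pmf"
    by (rule bind_pmf_cong) (use assms(1) in \<open>auto simp: halts_within_def\<close>)
  finally show ?thesis by (simp add: bind_return_pmf')
qed

text \<open>The extra step is the one that discards the \<open>Skip\<close> left by
  \<open>c1\<close>. Branches in which \<open>c1\<close> stops before \<open>s\<close> steps only
  gain slack, which the halting assumption on \<open>c2\<close> absorbs.\<close>

lemma run_Seq:
  assumes "halts_within s c1 \<sigma>" "\<And>c' \<sigma>'. (c', \<sigma>') \<in> set_pmf (run s c1 \<sigma>) \<Longrightarrow> halts_within u c2 \<sigma>'"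
  shows "run (s + 1 + u) (Seq c1 c2) \<sigma> = bind_pmf (run s c1 \<sigma>) (\<lambda>(c', \<sigma>'). run u c2 \<sigma>')"
  using assms
proof (induction s arbitrary: c1 \<sigma>)
  case 0
  then show ?case by (auto simp: halts_within_def bind_return_pmf)
next
  case (Suc s)
  show ?case
  proof (cases "c1 = Skip")
    case True
    then have "halts_within u c2 \<sigma>" using Suc.prems(2)[of Skip \<sigma>] by simp
    then show ?thesis using True run_stable[of u c2 \<sigma> "Suc s + u"] by (simp add: bind_return_pmf)
  next
    case False
    have "run (s + 1 + u) (Seq c' c2) \<sigma>' = bind_pmf (run s c' \<sigma>') (\<lambda>(c', \<sigma>'). run u c2 \<sigma>')"
      if "(c', \<sigma>') \<in> set_pmf (step c1 \<sigma>)" for c' \<sigma>'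
    proof (rule Suc.IH)
      show "halts_within s c' \<sigma>'"
        using Suc.prems(1) that by (fastforce simp: halts_within_def)
      show "halts_within u c2 \<sigma>''" if "(c'', \<sigma>'') \<in> set_pmf (run s c' \<sigma>')" for c'' \<sigma>''
        using \<open>(c', \<sigma>') \<in> _\<close> that
        by (intro Suc.prems(2)[of c'']) (auto intro!: bexI[of _ "(c', \<sigma>')"])
    qed
    note IH = this
    define r where "r = s + 1 + u"
    have "run (Suc s + 1 + u) (Seq c1 c2) \<sigma> = run (Suc r) (Seq c1 c2) \<sigma>"
      by (simp add: r_def)
    also have "\<dots> = bind_pmf (step c1 \<sigma>) (\<lambda>(c', \<sigma>'). run r (Seq c' c2) \<sigma>')"
      using False by (simp add: bind_map_pmf case_prod_unfold)
    also have "\<dots> = bind_pmf (step c1 \<sigma>)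
        (\<lambda>(c', \<sigma>'). bind_pmf (run s c' \<sigma>') (\<lambda>(c', \<sigma>'). run u c2 \<sigma>'))"
    proof (rule bind_pmf_cong[OF refl], clarify)
      fix c' \<sigma>' assume "(c', \<sigma>') \<in> set_pmf (step c1 \<sigma>)"
      then show "run r (Seq c' c2) \<sigma>' = bind_pmf (run s c' \<sigma>') (\<lambda>(c', \<sigma>'). run u c2 \<sigma>')"
        unfolding r_def by (rule IH)
    qed
    finally show ?thesis by (simp add: bind_assoc_pmf case_prod_unfold)
  qed
qed

lemma halts_withinI: "run t c \<sigma> = map_pmf (Pair Skip) D \<Longrightarrow> halts_within t c \<sigma>"
  by (auto simp: halts_within_def)

text \<open>The shape \<open>map_pmf (Pair Skip) D\<close> records in one equation that all branches
  have halted and that the memory is distributed as \<open>D\<close>; such equations can be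
  chained.\<close>

lemma run_Seq_map:
  assumes "run s c1 \<sigma> = map_pmf (Pair Skip) D"
    and "\<And>\<sigma>'. \<sigma>' \<in> set_pmf D \<Longrightarrow> run u c2 \<sigma>' = map_pmf (Pair Skip) (E \<sigma>')"
    and "s + u + 1 \<le> t"
  shows "run t (Seq c1 c2) \<sigma> = map_pmf (Pair Skip) (bind_pmf D E)"
proof -
  have "run (s + 1 + u) (Seq c1 c2) \<sigma> = bind_pmf (run s c1 \<sigma>) (\<lambda>(c', \<sigma>'). run u c2 \<sigma>')"
    by (rule run_Seq) (use assms(1,2) halts_withinI in \<open>force+\<close>)
  also have "\<dots> = map_pmf (Pair Skip) (bind_pmf D E)"
    by (auto simp: assms(1) bind_map_pmf map_bind_pmf assms(2) intro!: bind_pmf_cong)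
  finally have *: "run (s + 1 + u) (Seq c1 c2) \<sigma> = map_pmf (Pair Skip) (bind_pmf D E)" .
  show ?thesis
    using run_stable[OF halts_withinI[OF *], of t] assms(3) * by simp
qed

lemma run_mono:
  assumes "run s c \<sigma> = map_pmf (Pair Skip) D" "s \<le> t"
  shows "run t c \<sigma> = map_pmf (Pair Skip) D"
  using run_stable[OF halts_withinI[OF assms(1)] assms(2)] assms(1) by simp

section \<open>Total correctness with step counts for coin-free runs\<close>

primrec writes :: "com \<Rightarrow> string set" where
  "writes Skip = {}"
| "writes (Assign x i a) = {x}"
| "writes (Flip x i) = {x}"
| "writes (Seq c1 c2) = writes c1 \<union> writes c2"
| "writes (Cond b c1 c2) = writes c1 \<union> writes c2"
| "writes (While b c) = writes c"

text \<open>The final distribution is a point mass, so this covers runs without randomness. The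
  frame condition is built in, so that invariants need not mention variables that the program does
  not write.\<close>

definition wp :: "com \<Rightarrow> memory \<Rightarrow> nat \<Rightarrow> (memory \<Rightarrow> bool) \<Rightarrow> bool" where
  "wp c \<sigma> t Q \<longleftrightarrow>
     (\<exists>\<sigma>'. run t c \<sigma> = return_pmf (Skip, \<sigma>') \<and> Q \<sigma>' \<and> (\<forall>x. x \<notin> writes c \<longrightarrow> \<sigma>' x = \<sigma> x))"

lemma wp_conseq:
  assumes "wp c \<sigma> s P" "\<And>\<tau>. P \<tau> \<Longrightarrow> (\<And>x. x \<notin> writes c \<Longrightarrow> \<tau> x = \<sigma> x) \<Longrightarrow> Q \<tau>" "s \<le> t"
  shows "wp c \<sigma> t Q"
proof -
  obtain \<sigma>' where \<sigma>': "run s c \<sigma> = return_pmf (Skip, \<sigma>')" "P \<sigma>'" "\<forall>x. x \<notin> writes c \<longrightarrow> \<sigma>' x = \<sigma> x"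
    using assms(1) by (auto simp: wp_def)
  then have "run t c \<sigma> = return_pmf (Skip, \<sigma>')"
    using run_mono[of s c \<sigma> "return_pmf \<sigma>'" t] assms(3) by simp
  then show ?thesis using \<sigma>' assms(2) by (auto simp: wp_def)
qed

lemma wp_mono: "wp c \<sigma> s Q \<Longrightarrow> s \<le> t \<Longrightarrow> wp c \<sigma> t Q"
  by (rule wp_conseq)

lemma wp_Skip: "Q \<sigma> \<Longrightarrow> wp Skip \<sigma> t Q"
  by (auto simp: wp_def)

lemma wp_Assign:
  assumes "Q (store x (aval i \<sigma>) (aval a \<sigma>) \<sigma>)" "1 \<le> t"
  shows "wp (Assign x i a) \<sigma> t Q"
proof -
  have "wp (Assign x i a) \<sigma> 1 Q"
    using assms(1) by (auto simp: wp_def bind_return_pmf store_def)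
  then show ?thesis by (rule wp_conseq) (use assms(2) in auto)
qed

lemma wp_Seq:
  assumes "wp c1 \<sigma> s (\<lambda>\<sigma>'. wp c2 \<sigma>' u Q)" "s + u + 1 \<le> t"
  shows "wp (Seq c1 c2) \<sigma> t Q"
proof -
  obtain \<sigma>1 where 1: "run s c1 \<sigma> = return_pmf (Skip, \<sigma>1)" "wp c2 \<sigma>1 u Q"
    "\<forall>x. x \<notin> writes c1 \<longrightarrow> \<sigma>1 x = \<sigma> x"
    using assms(1) by (auto simp: wp_def)
  then obtain \<sigma>2 where 2: "run u c2 \<sigma>1 = return_pmf (Skip, \<sigma>2)" "Q \<sigma>2"
    "\<forall>x. x \<notin> writes c2 \<longrightarrow> \<sigma>2 x = \<sigma>1 x"
    by (auto simp: wp_def)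
  have "run t (Seq c1 c2) \<sigma> = map_pmf (Pair Skip) (bind_pmf (return_pmf \<sigma>1) (\<lambda>_. return_pmf \<sigma>2))"
    by (rule run_Seq_map) (use 1 2 assms(2) in auto)
  then show ?thesis using 1 2 by (auto simp: wp_def bind_return_pmf)
qed

lemma wp_step:
  assumes "step c \<sigma> = return_pmf (c', \<sigma>)" "wp c' \<sigma> s Q" "writes c' \<subseteq> writes c" "s + 1 \<le> t"
  shows "wp c \<sigma> t Q"
proof -
  have "wp c \<sigma> (Suc s) Q"
    using assms(1-3) by (auto simp: wp_def bind_return_pmf)
  then show ?thesis by (rule wp_conseq) (use assms(4) in auto)
qed

lemma wp_Cond:
  assumes "bval b \<sigma> \<Longrightarrow> wp c1 \<sigma> s Q" "\<not> bval b \<sigma> \<Longrightarrow> wp c2 \<sigma> s Q" "s + 1 \<le> t"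
  shows "wp (Cond b c1 c2) \<sigma> t Q"
  by (rule wp_step[where c' = "if bval b \<sigma> then c1 else c2" and s = s]) (use assms in auto)

text \<open>The measure \<open>f\<close> bounds the number of remaining rounds. Each round costs
  \<open>s\<close> steps for the body and two for the test and for discarding \<open>Skip\<close>;
  the last \<open>1\<close> is the failing test.\<close>

lemma wp_While:
  assumes "I \<sigma>"
    and "\<And>\<tau>. I \<tau> \<Longrightarrow> bval b \<tau> \<Longrightarrow> (\<And>x. x \<notin> writes c \<Longrightarrow> \<tau> x = \<sigma> x) \<Longrightarrow>
      wp c \<tau> s (\<lambda>\<tau>'. I \<tau>' \<and> f \<tau>' < f \<tau>)"
    and "\<And>\<tau>. I \<tau> \<Longrightarrow> \<not> bval b \<tau> \<Longrightarrow> (\<And>x. x \<notin> writes c \<Longrightarrow> \<tau> x = \<sigma> x) \<Longrightarrow> Q \<tau>"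
    and "f \<sigma> * (s + 2) + 1 \<le> t"
  shows "wp (While b c) \<sigma> t Q"
proof -
  have "wp (While b c) \<tau> (f \<tau> * (s + 2) + 1) Q"
    if "I \<tau>" "\<And>x. x \<notin> writes c \<Longrightarrow> \<tau> x = \<sigma> x" for \<tau>
    using that
  proof (induction "f \<tau>" arbitrary: \<tau> rule: less_induct)
    case less
    show ?case
    proof (cases "bval b \<tau>")
      case True
      let ?u = "(f \<tau> - 1) * (s + 2) + 1"
      show ?thesis
      proof (rule wp_step[where c' = "Seq c (While b c)" and s = "s + ?u + 1"])
        show "wp (Seq c (While b c)) \<tau> (s + ?u + 1) Q"
        proof (rule wp_Seq[where s = s and u = ?u,
              OF wp_conseq[OF assms(2)[OF less.prems(1) True less.prems(2)] _ order.refl]])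
          fix \<tau>' assume \<tau>': "I \<tau>' \<and> f \<tau>' < f \<tau>" "\<And>x. x \<notin> writes c \<Longrightarrow> \<tau>' x = \<tau> x"
          have "wp (While b c) \<tau>' (f \<tau>' * (s + 2) + 1) Q"
          proof (rule less.hyps)
            show "\<tau>' x = \<sigma> x" if "x \<notin> writes c" for x
              using that \<tau>'(2) less.prems(2) by simp
          qed (use \<tau>'(1) in auto)
          moreover have "f \<tau>' * (s + 2) + 1 \<le> ?u"
            using \<tau>'(1) by (intro add_right_mono mult_le_mono1) auto
          ultimately show "wp (While b c) \<tau>' ?u Q"
            by (rule wp_mono)
        qed simp_all
        \<comment> \<open>The body strictly lowers the natural number \<open>f \<tau>\<close>, so
          the budget contains at least one more round.\<close>
        have "f \<tau> > 0"
          using assms(2)[OF less.prems(1) True less.prems(2)] unfolding wp_def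
          by auto
        then show "s + ?u + 1 + 1 \<le> f \<tau> * (s + 2) + 1"
          by (cases "f \<tau>") auto
      qed (use True in simp_all)
    next
      case False
      show ?thesis
      proof (rule wp_step[where c' = Skip and s = 0])
        show "wp Skip \<tau> 0 Q"
          by (rule wp_Skip) (rule assms(3)[OF less.prems(1) False less.prems(2)])
      qed (use False in simp_all)
    qed
  qed
  from this[OF assms(1)] show ?thesis
    by (rule wp_mono) (use assms(4) in auto)
qed

text \<open>Variants whose time bound is computed by resolution.\<close>

lemma wp_Assign': "Q (store x (aval i \<sigma>) (aval a \<sigma>) \<sigma>) \<Longrightarrow> wp (Assign x i a) \<sigma> 1 Q"
  by (rule wp_Assign) auto

lemma wp_Seq': "wp c1 \<sigma> s (\<lambda>\<sigma>'. wp c2 \<sigma>' u Q) \<Longrightarrow> wp (Seq c1 c2) \<sigma> (s + u + 1) Q"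
  by (rule wp_Seq) auto

lemma wp_Cond':
  assumes "bval b \<sigma> \<Longrightarrow> wp c1 \<sigma> s Q" "\<not> bval b \<sigma> \<Longrightarrow> wp c2 \<sigma> u Q"
  shows "wp (Cond b c1 c2) \<sigma> (s + u + 1) Q"
proof (rule wp_Cond)
  show "bval b \<sigma> \<Longrightarrow> wp c1 \<sigma> (s + u) Q" by (rule wp_mono[OF assms(1)]) auto
  show "\<not> bval b \<sigma> \<Longrightarrow> wp c2 \<sigma> (s + u) Q" by (rule wp_mono[OF assms(2)]) auto
qed simp

lemma wp_Skip': "Q \<sigma> \<Longrightarrow> wp Skip \<sigma> 0 Q"
  by (rule wp_Skip)

abbreviation V :: "string \<Rightarrow> aexp" where
  "V x \<equiv> Cell x (Const 0)"

abbreviation Set_var :: "string \<Rightarrow> aexp \<Rightarrow> com" where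
  "Set_var x a \<equiv> Assign x (Const 0) a"

primrec times_const :: "nat \<Rightarrow> aexp \<Rightarrow> aexp" where
  "times_const 0 a = Const 0"
| "times_const (Suc n) a = Add a (times_const n a)"

lemma aval_times_const [simp]: "aval (times_const n a) \<sigma> = n * aval a \<sigma>"
  by (induction n) simp_all

lemma store_apply [simp]: "store x i v \<sigma> y = (if y = x then (\<sigma> x)(i := v) else \<sigma> y)"
  by (simp add: store_def)

definition For :: "string \<Rightarrow> string \<Rightarrow> com \<Rightarrow> com" where
  "For x y c = Seq (Set_var x (Const 0))
     (While (Less (V x) (V y)) (Seq c (Set_var x (Add (V x) (Const 1)))))"

lemma writes_For [simp]: "writes (For x y c) = insert x (writes c)"
  by (simp add: For_def)

text \<open>The bound may be read in the initial memory because the body writes neither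
  \<open>x\<close> nor \<open>y\<close>. Of the \<open>4\<close> extra steps per round, two belong
  to the increment of the counter and two to the loop.\<close>

lemma wp_For:
  assumes "x \<noteq> y" "x \<notin> writes c" "y \<notin> writes c"
    and "I 0 (store x 0 0 \<sigma>)"
    and "\<And>i \<tau>. i < \<sigma> y 0 \<Longrightarrow> I i \<tau> \<Longrightarrow> \<tau> x 0 = i \<Longrightarrow>
      (\<And>z. z \<notin> insert x (writes c) \<Longrightarrow> \<tau> z = \<sigma> z) \<Longrightarrow>
      wp c \<tau> s (\<lambda>\<tau>'. I (Suc i) (store x 0 (Suc i) \<tau>'))"
    and "\<And>\<tau>. I (\<sigma> y 0) \<tau> \<Longrightarrow> (\<And>z. z \<notin> insert x (writes c) \<Longrightarrow> \<tau> z = \<sigma> z) \<Longrightarrow> Q \<tau>"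
    and "\<sigma> y 0 * (s + 4) + 3 \<le> t"
  shows "wp (For x y c) \<sigma> t Q"
proof -
  let ?n = "\<sigma> y 0"
  let ?b = "Less (V x) (V y)" and ?c = "Seq c (Set_var x (Add (V x) (Const 1)))"
  let ?I = "\<lambda>\<tau>. \<tau> x 0 \<le> ?n \<and> I (\<tau> x 0) \<tau>"
  have "wp (While ?b ?c) (store x 0 0 \<sigma>) (?n * (s + 4) + 1) Q"
  proof (rule wp_While[where I = ?I and f = "\<lambda>\<tau>. ?n - \<tau> x 0" and s = "s + 2"])
    fix \<tau> assume \<tau>: "?I \<tau>" "bval ?b \<tau>"
      "\<And>z. z \<notin> writes ?c \<Longrightarrow> \<tau> z = store x 0 0 \<sigma> z"
    then have y: "\<tau> y 0 = ?n" using assms(1,3) by simp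
    have "wp c \<tau> s (\<lambda>\<tau>'. I (Suc (\<tau> x 0)) (store x 0 (Suc (\<tau> x 0)) \<tau>'))"
      by (rule assms(5)) (use \<tau> y in auto)
    then show "wp ?c \<tau> (s + 2) (\<lambda>\<tau>'. ?I \<tau>' \<and> ?n - \<tau>' x 0 < ?n - \<tau> x 0)"
      by (intro wp_Seq[where s = s and u = 1], elim wp_conseq, intro wp_Assign)
        (use \<tau> y assms(2) in auto)
  next
    fix \<tau> assume \<tau>: "?I \<tau>" "\<not> bval ?b \<tau>"
      "\<And>z. z \<notin> writes ?c \<Longrightarrow> \<tau> z = store x 0 0 \<sigma> z"
    then have "\<tau> x 0 = ?n" using assms(1,3) by simp
    then show "Q \<tau>" using \<tau> by (intro assms(6)) auto
  qed (use assms(4) in \<open>auto simp: algebra_simps\<close>)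
  then show ?thesis
    unfolding For_def
    by (intro wp_Seq[where s = 1 and u = "?n * (s + 4) + 1"] wp_Assign) (use assms(7) in auto)
qed

section \<open>Coin tosses as uniform bit lists\<close>

definition coin_step :: "bool \<Rightarrow> memory \<Rightarrow> memory" where
  "coin_step b \<sigma> = store ''i'' 0 (\<sigma> ''i'' 0 + 1) (store ''R'' (\<sigma> ''i'' 0) (if b then 1 else 0) \<sigma>)"

lemma coin_step_simps [simp]:
  "coin_step b \<sigma> ''i'' 0 = Suc (\<sigma> ''i'' 0)"
  "coin_step b \<sigma> ''R'' = (\<sigma> ''R'')(\<sigma> ''i'' 0 := (if b then 1 else 0))"
  "x \<noteq> ''i'' \<Longrightarrow> x \<noteq> ''R'' \<Longrightarrow> coin_step b \<sigma> x = \<sigma> x"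
  by (auto simp: coin_step_def)

primrec write_bits :: "bool list \<Rightarrow> memory \<Rightarrow> memory" where
  "write_bits [] \<sigma> = \<sigma>"
| "write_bits (b # bs) \<sigma> = write_bits bs (coin_step b \<sigma>)"

definition flips :: com where
  "flips = For ''i'' ''F'' (Flip ''R'' (V ''i''))"

lemma write_bits_other: "x \<noteq> ''i'' \<Longrightarrow> x \<noteq> ''R'' \<Longrightarrow> write_bits bs \<sigma> x = \<sigma> x"
  by (induction bs arbitrary: \<sigma>) auto

lemma write_bits_below: "j < \<sigma> ''i'' 0 \<Longrightarrow> write_bits bs \<sigma> ''R'' j = \<sigma> ''R'' j"
  by (induction bs arbitrary: \<sigma>) auto

lemma write_bits_R:
  "j < length bs \<Longrightarrow> write_bits bs \<sigma> ''R'' (\<sigma> ''i'' 0 + j) = (if bs ! j then 1 else 0)"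
proof (induction bs arbitrary: \<sigma> j)
  case (Cons b bs)
  show ?case
  proof (cases j)
    case 0
    then show ?thesis using write_bits_below[of "\<sigma> ''i'' 0" "coin_step b \<sigma>" bs] by simp
  next
    case (Suc l)
    then show ?thesis using Cons.IH[of l "coin_step b \<sigma>"] Cons.prems by simp
  qed
qed simp

text \<open>Tossing one bit and resuming the loop is the recursion of \<open>replicate_pmf\<close>,
  so the final memory is the image of a list of independent fair bits. This is the only fragment of
  the program that tosses coins.\<close>

lemma run_flips:
  assumes "5 * \<sigma> ''F'' 0 + 3 \<le> t"
  shows "run t flips \<sigma> = map_pmf (Pair Skip) (map_pmf (\<lambda>bs. write_bits bs (store ''i'' 0 0 \<sigma>))
    (replicate_pmf (\<sigma> ''F'' 0) (bernoulli_pmf (1/2))))"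
proof -
  let ?B = "bernoulli_pmf (1/2)"
  let ?incr = "Set_var ''i'' (Add (V ''i'') (Const 1))"
  let ?body = "Seq (Flip ''R'' (V ''i'')) ?incr"
  let ?loop = "While (Less (V ''i'') (V ''F'')) ?body"
  have flip: "run 1 (Flip ''R'' (V ''i'')) \<tau> = map_pmf (Pair Skip)
      (map_pmf (\<lambda>b. store ''R'' (\<tau> ''i'' 0) (if b then 1 else 0) \<tau>) ?B)" for \<tau>
    by (simp add: map_pmf_def bind_assoc_pmf bind_return_pmf)
  have incr: "run 1 ?incr \<tau> = map_pmf (Pair Skip) (return_pmf (store ''i'' 0 (\<tau> ''i'' 0 + 1) \<tau>))" for \<tau>
    by (simp add: bind_return_pmf)
  have body: "run 3 ?body \<tau> = map_pmf (Pair Skip) (map_pmf (\<lambda>b. coin_step b \<tau>) ?B)" for \<tau>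
  proof -
    have "run 3 ?body \<tau> = map_pmf (Pair Skip)
      (bind_pmf (map_pmf (\<lambda>b. store ''R'' (\<tau> ''i'' 0) (if b then 1 else 0) \<tau>) ?B)
        (\<lambda>\<tau>. return_pmf (store ''i'' 0 (\<tau> ''i'' 0 + 1) \<tau>)))"
      by (rule run_Seq_map[OF flip incr]) simp
    also have "bind_pmf (map_pmf (\<lambda>b. store ''R'' (\<tau> ''i'' 0) (if b then 1 else 0) \<tau>) ?B)
        (\<lambda>\<tau>. return_pmf (store ''i'' 0 (\<tau> ''i'' 0 + 1) \<tau>)) = map_pmf (\<lambda>b. coin_step b \<tau>) ?B"
      by (simp add: map_pmf_def bind_assoc_pmf bind_return_pmf coin_step_def)
    finally show ?thesis .
  qed
  have loop: "run (5 * r + 1) ?loop \<tau> = map_pmf (Pair Skip)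
      (map_pmf (\<lambda>bs. write_bits bs \<tau>) (replicate_pmf r ?B))" if "\<tau> ''F'' 0 = \<tau> ''i'' 0 + r" for r \<tau>
    using that
  proof (induction r arbitrary: \<tau>)
    case 0
    then show ?case by (simp add: bind_return_pmf)
  next
    case (Suc r)
    have "run (Suc x) ?loop \<tau> = run x (Seq ?body ?loop) \<tau>" for x
      using Suc.prems by (simp add: bind_return_pmf)
    from this[of "5 * Suc r"] have "run (5 * Suc r + 1) ?loop \<tau> = run (5 * Suc r) (Seq ?body ?loop) \<tau>"
      by (simp only: Suc_eq_plus1)
    also have "\<dots> = map_pmf (Pair Skip) (bind_pmf (map_pmf (\<lambda>b. coin_step b \<tau>) ?B)
        (\<lambda>\<tau>. map_pmf (\<lambda>bs. write_bits bs \<tau>) (replicate_pmf r ?B)))"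
    proof (rule run_Seq_map[OF body])
      fix \<tau>' assume "\<tau>' \<in> set_pmf (map_pmf (\<lambda>b. coin_step b \<tau>) ?B)"
      then have "\<tau>' ''F'' 0 = \<tau>' ''i'' 0 + r" using Suc.prems by auto
      then show "run (5 * r + 1) ?loop \<tau>' = map_pmf (Pair Skip) (map_pmf (\<lambda>bs. write_bits bs \<tau>') (replicate_pmf r ?B))"
        by (rule Suc.IH)
    qed simp
    also have "bind_pmf (map_pmf (\<lambda>b. coin_step b \<tau>) ?B) (\<lambda>\<tau>. map_pmf (\<lambda>bs. write_bits bs \<tau>) (replicate_pmf r ?B)) =
        map_pmf (\<lambda>bs. write_bits bs \<tau>) (replicate_pmf (Suc r) ?B)"
      by (simp add: bind_map_pmf map_bind_pmf) (simp add: map_pmf_def)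
    finally show ?case .
  qed
  have "run t flips \<sigma> = map_pmf (Pair Skip) (bind_pmf (return_pmf (store ''i'' 0 0 \<sigma>))
      (\<lambda>\<tau>. map_pmf (\<lambda>bs. write_bits bs \<tau>) (replicate_pmf (\<sigma> ''F'' 0) ?B)))"
    unfolding flips_def For_def
  proof (rule run_Seq_map[where s = 1 and u = "5 * \<sigma> ''F'' 0 + 1"])
    show "run 1 (Set_var ''i'' (Const 0)) \<sigma> = map_pmf (Pair Skip) (return_pmf (store ''i'' 0 0 \<sigma>))"
      by (simp add: bind_return_pmf)
    fix \<sigma>' assume "\<sigma>' \<in> set_pmf (return_pmf (store ''i'' 0 0 \<sigma>))"
    then show "run (5 * \<sigma> ''F'' 0 + 1) ?loop \<sigma>' =
        map_pmf (Pair Skip) (map_pmf (\<lambda>bs. write_bits bs \<sigma>') (replicate_pmf (\<sigma> ''F'' 0) ?B))"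
      by (intro loop) simp
  qed (use assms in simp)
  then show ?thesis by (simp add: bind_return_pmf)
qed

lemma pmf_replicate_coin:
  "pmf (replicate_pmf n (bernoulli_pmf (1/2))) bs = (if length bs = n then 1 / 2 ^ n else 0)"
proof (induction n arbitrary: bs)
  case 0
  then show ?case by (cases bs) (auto simp: indicator_def)
next
  case (Suc n)
  have *: "replicate_pmf (Suc n) (bernoulli_pmf (1/2)) = map_pmf (\<lambda>(x, xs). x # xs)
      (pair_pmf (bernoulli_pmf (1/2)) (replicate_pmf n (bernoulli_pmf (1/2))))"
    by (simp add: pair_pmf_def map_bind_pmf)
  show ?case
  proof (cases bs)
    case Nil
    then show ?thesis by (simp add: * pmf_eq_0_set_pmf del: replicate_pmf.simps) auto
  next
    case (Cons b bs')
    have "inj (\<lambda>(x, xs). x # xs)" by (auto simp: inj_def)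
    then have "pmf (replicate_pmf (Suc n) (bernoulli_pmf (1/2))) (b # bs') =
        pmf (pair_pmf (bernoulli_pmf (1/2)) (replicate_pmf n (bernoulli_pmf (1/2)))) (b, bs')"
      unfolding * using pmf_map_inj'[of "\<lambda>(x, xs). x # xs" _ "(b, bs')"] by simp
    then show ?thesis using Cons by (cases b) (auto simp: pmf_pair Suc field_simps simp del: replicate_pmf.simps split: if_splits)
  qed
qed

text \<open>Turns the success probability into a ratio of cardinalities, all lists of length
  \<open>n\<close> being equally likely.\<close>

lemma prob_replicate_coin:
  assumes "B \<subseteq> {bs. length bs = n}"
  shows "measure_pmf.prob (replicate_pmf n (bernoulli_pmf (1/2))) B = card B / 2 ^ n"
proof -
  have fin: "finite {bs :: bool list. length bs = n}"
    using finite_lists_length_eq[of "UNIV :: bool set" n] by simp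
  have "measure_pmf.prob (replicate_pmf n (bernoulli_pmf (1/2))) B =
      (\<Sum>bs\<in>B. pmf (replicate_pmf n (bernoulli_pmf (1/2))) bs)"
    by (rule measure_measure_pmf_finite) (use finite_subset[OF assms fin] in simp)
  also have "\<dots> = (\<Sum>bs\<in>B. 1 / 2 ^ n)"
    by (rule sum.cong) (use assms in \<open>auto simp: pmf_replicate_coin\<close>)
  finally show ?thesis by simp
qed

section \<open>Finite fields\<close>

text \<open>Multiplication by a nonzero \<open>x\<close> permutes the nonzero elements; comparing
  the products of all of them gives \<open>x^(q-1) = 1\<close>.\<close>

lemma power_card_field:
  fixes x :: "'a::{field,finite}"
  shows "x ^ CARD('a) = x"
proof (cases "x = 0")
  case False
  have "(\<Prod>y\<in>UNIV-{0}. x * y) = (\<Prod>y\<in>UNIV-{0}. y)"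
    by (rule prod.reindex_bij_witness[of _ "\<lambda>y. y / x" "\<lambda>y. x * y"]) (use False in auto)
  moreover have "(\<Prod>y\<in>UNIV-{0}. x * y) = x ^ (CARD('a) - 1) * (\<Prod>y\<in>UNIV-{0}. y)"
    by (simp add: prod.distrib)
  ultimately have "x ^ (CARD('a) - 1) = 1"
    by simp
  then show ?thesis
    by (metis finite_UNIV_card_ge_0 finite_code Suc_diff_1 power_Suc mult.right_neutral)
qed (simp add: finite_UNIV_card_ge_0)

lemma to_ac_power_card:
  fixes x :: "'a::{field,finite}"
  shows "to_ac x ^ CARD('a) = to_ac x"
  by (metis to_ac_power power_card_field)

text \<open>Translation by \<open>1\<close> permutes the field, so adding \<open>q\<close> copies of
  \<open>1\<close> leaves the sum of all elements unchanged.\<close>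

lemma of_nat_card_eq_0: "of_nat CARD('a) = (0 :: 'a::{field,finite} alg_closure)"
proof -
  have "(\<Sum>x\<in>UNIV. x + (1::'a)) = (\<Sum>x\<in>UNIV. x)"
    by (rule sum.reindex_bij_witness[of _ "\<lambda>y. y - 1" "\<lambda>y. y + 1"]) auto
  then have "of_nat CARD('a) = (0 :: 'a)"
    by (simp add: sum.distrib)
  then show ?thesis
    by (metis to_ac_of_nat to_ac_0)
qed

lemma card_field_gt_1: "1 < CARD('a::{field,finite})"
proof -
  have "card {0, 1::'a} \<le> CARD('a)"
    by (rule card_mono) auto
  then show ?thesis by simp
qed

text \<open>As polynomials in \<open>y\<close>, both sides are monic of degree \<open>q\<close> and
  vanish on the ground field. Their difference has degree below \<open>q\<close> but
  \<open>q\<close> roots, so it is zero.\<close>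

lemma prod_minus_to_ac:
  fixes y :: "'a::{field,finite} alg_closure"
  shows "(\<Prod>a\<in>UNIV. y - to_ac (a::'a)) = y ^ CARD('a) - y"
proof -
  let ?q = "CARD('a)"
  define p where "p = (\<Prod>a\<in>(UNIV::'a set). [:- to_ac a, 1:])"
  define r where "r = (Polynomial.monom 1 ?q - Polynomial.monom 1 1 :: 'a alg_closure poly)"
  have q1: "1 < ?q" by (rule card_field_gt_1)
  have "Polynomial.degree p = ?q"
    unfolding p_def by (subst degree_prod_eq_sum_degree) auto
  moreover have "Polynomial.lead_coeff p = 1"
    unfolding p_def by (simp add: lead_coeff_prod)
  ultimately have p: "Polynomial.degree p = ?q" "poly.coeff p ?q = 1" by auto
  have r: "poly.coeff r i = (if i = ?q then 1 else 0)" if "i \<ge> ?q" for i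
    using that q1 by (auto simp: r_def)
  have "p - r = 0"
  proof (rule ccontr)
    assume nz: "p - r \<noteq> 0"
    have "poly.coeff (p - r) i = 0" if "i \<ge> ?q" for i
      using that p r[OF that] by (cases "i = ?q") (auto simp: coeff_eq_0)
    then have "Polynomial.degree (p - r) < ?q"
      using nz by (metis leading_coeff_0_iff not_le)
    moreover have "to_ac ` UNIV \<subseteq> {x. poly (p - r) x = 0}"
      by (auto simp: p_def r_def poly_prod poly_monom to_ac_power_card)
    then have "card (to_ac ` (UNIV::'a set)) \<le> card {x. poly (p - r) x = 0}"
      by (intro card_mono poly_roots_finite nz)
    then have "?q \<le> card {x. poly (p - r) x = 0}"
      by (simp add: card_image inj_to_ac)
    ultimately show False
      using card_poly_roots_bound[OF nz] by simp
  qed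
  then have "poly p y = poly r y" by simp
  then show ?thesis
    by (simp add: p_def r_def poly_prod poly_monom)
qed

text \<open>For fixed \<open>y\<close>, the polynomial \<open>(X + y)\<^sup>q - X\<^sup>q - y\<^sup>q\<close> has degree less than \<open>q\<close> and vanishes at
  the \<open>q\<close> elements of the ground field; so there is no need to know that \<open>q\<close> is a power of the
  characteristic.\<close>
lemma add_power_card:
  fixes x y :: "'a::{field,finite} alg_closure"
  shows "(x + y) ^ CARD('a) = x ^ CARD('a) + y ^ CARD('a)"
proof -
  let ?q = "CARD('a)"
  have q1: "1 < ?q" by (rule card_field_gt_1)
  define p where "p = [:y, 1:] ^ ?q - Polynomial.monom 1 ?q - [:y ^ ?q:]"
  \<comment> \<open>The polynomial \<open>Y^q - Y\<close> is invariant under translation by ground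
    field elements, since these permute its linear factors. This gives the \<open>q\<close> roots of
    \<open>p\<close>.\<close>
  have shift: "(to_ac a + y) ^ ?q - (to_ac a + y) = y ^ ?q - y" for a :: 'a
  proof -
    have "(to_ac a + y) ^ ?q - (to_ac a + y) = (\<Prod>b\<in>UNIV. to_ac a + y - to_ac (b::'a))"
      by (simp add: prod_minus_to_ac)
    also have "\<dots> = (\<Prod>b\<in>UNIV. y - to_ac (b::'a))"
      by (rule prod.reindex_bij_witness[of _ "\<lambda>b. b + a" "\<lambda>b. b - a"]) (auto simp: algebra_simps)
    finally show ?thesis by (simp add: prod_minus_to_ac)
  qed
  have "p = 0"
  proof (rule ccontr)
    assume nz: "p \<noteq> 0"
    have "Polynomial.degree ([:y, 1:] ^ ?q) = ?q"
      by (simp add: degree_power_eq)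
    moreover have "Polynomial.lead_coeff ([:y, 1:] ^ ?q) = 1"
      by (subst lead_coeff_power) simp
    ultimately have lin: "Polynomial.degree ([:y, 1:] ^ ?q) = ?q" "poly.coeff ([:y, 1:] ^ ?q) ?q = 1"
      by simp_all
    have "poly.coeff p i = 0" if "i \<ge> ?q" for i
      using that lin q1 by (cases "i = ?q") (auto simp: p_def coeff_eq_0 coeff_pCons split: nat.splits)
    then have "Polynomial.degree p < ?q"
      using nz by (metis leading_coeff_0_iff not_le)
    moreover have "poly p (to_ac a) = 0" for a :: 'a
      using shift[of a] by (simp add: p_def poly_monom to_ac_power_card algebra_simps)
    then have "to_ac ` UNIV \<subseteq> {x. poly p x = 0}" by auto
    then have "card (to_ac ` (UNIV::'a set)) \<le> card {x. poly p x = 0}"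
      by (intro card_mono poly_roots_finite nz)
    then have "?q \<le> card {x. poly p x = 0}"
      by (simp add: card_image inj_to_ac)
    ultimately show False
      using card_poly_roots_bound[OF nz] by simp
  qed
  then have "poly p x = 0" by simp
  then show ?thesis
    by (simp add: p_def poly_monom algebra_simps)
qed

lemma sum_power_card:
  fixes f :: "'b \<Rightarrow> 'a::{field,finite} alg_closure"
  shows "(\<Sum>i\<in>A. f i) ^ CARD('a) = (\<Sum>i\<in>A. f i ^ CARD('a))"
  by (induction A rule: infinite_finite_induct)
    (simp_all add: add_power_card power_0_left finite_UNIV_card_ge_0)

lemma add_power_card_power:
  fixes x y :: "'a::{field,finite} alg_closure"
  shows "(x + y) ^ (CARD('a) ^ h) = x ^ (CARD('a) ^ h) + y ^ (CARD('a) ^ h)"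
proof (induction h)
  case (Suc h)
  have "(x + y) ^ (CARD('a) ^ Suc h) = ((x + y) ^ (CARD('a) ^ h)) ^ CARD('a)"
    by (simp add: power_mult[symmetric] mult.commute)
  then show ?case
    by (simp add: Suc add_power_card power_mult[symmetric] mult.commute)
qed simp

text \<open>The polynomial \<open>X^Q - X\<close> splits over the closure, and its derivative is
  \<open>-1\<close> because \<open>Q\<close> is zero in the field. A repeated root would also be a
  root of the derivative.\<close>

lemma card_fixed_field:
  assumes "h \<ge> 1"
  shows "card {x :: 'a::{field,finite} alg_closure. x ^ (CARD('a) ^ h) = x} = CARD('a) ^ h"
proof -
  define Q where "Q = CARD('a) ^ h"
  have Q: "1 < Q" using assms card_field_gt_1[where 'a='a] by (simp add: Q_def one_less_power del: One_nat_def)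
  define p where "p = (Polynomial.monom 1 Q - Polynomial.monom 1 1 :: 'a alg_closure poly)"
  have "poly.coeff p Q = 1" using Q by (simp add: p_def)
  moreover have "poly.coeff p i = 0" if "i > Q" for i using that Q by (simp add: p_def)
  ultimately have deg: "Polynomial.degree p = Q"
    by (metis le_degree degree_le antisym zero_neq_one)
  then have nz: "p \<noteq> 0" using Q by auto
  have Q0: "of_nat Q = (0 :: 'a alg_closure)"
    using assms by (simp add: Q_def of_nat_card_eq_0 power_0_left)
  have dp: "pderiv p = - 1"
    using Q0 by (simp add: p_def pderiv_diff pderiv_monom one_pCons monom_0)
  obtain A where A: "size A = Polynomial.degree p" "p = Polynomial.smult (Polynomial.lead_coeff p) (\<Prod>x\<in>#A. [:-x, 1:])"
    using alg_closed_imp_factorization[OF nz] by auto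
  have "count A x \<le> 1" for x
  proof (rule ccontr)
    assume "\<not> count A x \<le> 1"
    then have "{#x, x#} \<subseteq># A"
      by (auto simp: subseteq_mset_def)
    then obtain B where B: "A = {#x, x#} + B"
      by (metis mset_subset_eq_exists_conv)
    define r where "r = Polynomial.smult (Polynomial.lead_coeff p) (\<Prod>x\<in>#B. [:-x, 1:])"
    have "prod_mset (image_mset g A) = g x * (g x * prod_mset (image_mset g B))"
      for g :: "'a alg_closure \<Rightarrow> 'a alg_closure poly"
      by (simp add: B)
    then have "p = [:-x, 1:] * ([:-x, 1:] * r)"
      using A(2) by (simp only: r_def mult_smult_right)
    then have "poly (pderiv p) x = 0"
      by (simp add: pderiv_mult del: mult_pCons_left mult_pCons_right)
    then show False by (simp add: dp)
  qed
  then have "size A = card (set_mset A)"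
    unfolding size_multiset_overloaded_eq
    by (subst card_eq_sum, intro sum.cong refl)
       (metis count_greater_zero_iff le_antisym One_nat_def Suc_leI)
  moreover have "set_mset A = {x. x ^ Q = x}"
  proof -
    have "poly p x = 0 \<longleftrightarrow> x \<in># A" for x
      using nz by (subst A(2)) (auto simp: poly_prod_mset prod_mset_zero_iff)
    then show ?thesis by (auto simp: p_def poly_monom)
  qed
  ultimately show ?thesis
    using A(1) deg by (simp add: Q_def)
qed

text \<open>The roots of \<open>X^Q - X\<close> are closed under the field operations, additively by
  the Frobenius map. They form a finite field with \<open>Q\<close> elements, whose multiplicative
  group is cyclic; \<open>\<zeta>\<close> is a generator.\<close>

lemma primitive_element_exists:
  assumes h: "h \<ge> 1"
  obtains \<zeta> :: "'a::{field,finite} alg_closure"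
  where "\<zeta> \<noteq> 0" "\<zeta> ^ (CARD('a) ^ h) = \<zeta>"
    "\<And>i. 1 \<le> i \<Longrightarrow> i < CARD('a) ^ h - 1 \<Longrightarrow> \<zeta> ^ i \<noteq> 1"
proof -
  define Q where "Q = CARD('a) ^ h"
  have Q: "1 < Q" using assms card_field_gt_1[where 'a='a] by (simp add: Q_def one_less_power del: One_nat_def)
  define S where "S = {x :: 'a alg_closure. x ^ Q = x}"
  have card_S: "card S = Q" unfolding S_def Q_def by (rule card_fixed_field[OF h])
  have fin: "finite S" using card_S Q card.infinite by fastforce
  have add: "x + y \<in> S" if "x \<in> S" "y \<in> S" for x y
    using that by (simp add: S_def Q_def add_power_card_power)
  have mult: "x * y \<in> S" if "x \<in> S" "y \<in> S" for x y
    using that by (simp add: S_def power_mult_distrib)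
  have inv: "inverse x \<in> S" if "x \<in> S" for x
    using that by (simp add: S_def power_inverse)
  have zero: "0 \<in> S" and one: "1 \<in> S" using Q by (auto simp: S_def)
  have neg: "- x \<in> S" if "x \<in> S" for x
  proof -
    have "(- x) ^ Q + x ^ Q = 0"
      using add_power_card_power[of "-x" x h] Q by (simp add: Q_def[symmetric] power_0_left)
    then show ?thesis using that by (simp add: S_def eq_neg_iff_add_eq_0)
  qed
  define R :: "'a alg_closure ring" where "R = \<lparr>carrier = S, monoid.mult = (*), one = 1, ring.zero = 0, add = (+)\<rparr>"
  have "Ring.field R"
  proof (intro cring.cring_fieldI cringI abelian_groupI comm_monoidI)
    show "Units R = carrier R - {\<zero>\<^bsub>R\<^esub>}"
      using inv by (auto simp: R_def Units_def intro!: bexI[of _ "inverse _"])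
    fix x assume "x \<in> carrier R"
    then show "\<exists>y\<in>carrier R. y \<oplus>\<^bsub>R\<^esub> x = \<zero>\<^bsub>R\<^esub>"
      using neg by (intro bexI[of _ "- x"]) (auto simp: R_def)
  qed (auto simp: R_def add mult zero one distrib_right)
  then obtain a where a: "a \<in> carrier (mult_of R)"
    "carrier (mult_of R) = {a [^]\<^bsub>R\<^esub> i | i::nat. i \<in> UNIV}"
    using field.finite_field_mult_group_has_gen[of R] fin by (auto simp: R_def)
  have pow: "a [^]\<^bsub>R\<^esub> i = a ^ i" for i :: nat
    by (induction i) (simp_all add: R_def mult.commute)
  have carrier_R: "carrier (mult_of R) = S - {0}"
    by (simp add: R_def)
  have aS: "a \<in> S" "a \<noteq> 0" using a(1) by (auto simp: R_def)
  have gen: "S - {0} = range (\<lambda>i::nat. a ^ i)"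
    using a(2) unfolding carrier_R pow by auto
  show ?thesis
  proof (rule that[of a])
    show "a \<noteq> 0" "a ^ (CARD('a) ^ h) = a" using aS by (auto simp: S_def Q_def)
    fix i assume i: "1 \<le> i" "i < CARD('a) ^ h - 1"
    show "a ^ i \<noteq> 1"
    proof
      assume ai: "a ^ i = 1"
      \<comment> \<open>If \<open>a^i = 1\<close>, the powers with exponent below \<open>i\<close>
        exhaust the group, which has \<open>Q - 1 > i\<close> elements.\<close>
      have "a ^ j = a ^ (j mod i)" for j
        by (metis ai div_mult_mod_eq mult.commute mult_1 power_add power_mult power_one)
      then have "S - {0} \<subseteq> (\<lambda>j. a ^ j) ` {..<i}"
        unfolding gen using i(1) by (auto simp: image_iff intro!: bexI[of _ "_ mod i"])
      then have "card (S - {0}) \<le> card {..<i}"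
        by (rule surj_card_le[rotated]) simp
      then show False
        using zero fin card_S i(2) by (simp add: Q_def)
    qed
  qed
qed

section \<open>BCH codes\<close>

definition vecs :: "nat \<Rightarrow> (nat \<Rightarrow> 'a::zero) set" where
  "vecs h = {v. \<forall>c\<ge>h. v c = 0}"

lemma card_vecs: "card (vecs h :: (nat \<Rightarrow> 'a::{zero,finite}) set) = CARD('a) ^ h"
proof -
  have "bij_betw (\<lambda>v. restrict v {..<h}) (vecs h) ({..<h} \<rightarrow>\<^sub>E (UNIV :: 'a set))"
    by (rule bij_betw_byWitness[where f' = "\<lambda>v c. if c < h then v c else 0"])
      (auto simp: vecs_def fun_eq_iff restrict_def PiE_def extensional_def)
  then have "card (vecs h :: (nat \<Rightarrow> 'a) set) = card ({..<h} \<rightarrow>\<^sub>E (UNIV :: 'a set))"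
    by (rule bij_betw_same_card)
  then show ?thesis by (simp add: card_PiE)
qed

lemma finite_vecs [simp]: "finite (vecs h :: (nat \<Rightarrow> 'a::{zero,finite}) set)"
proof -
  have "card (vecs h :: (nat \<Rightarrow> 'a) set) > 0"
    by (simp add: card_vecs finite_UNIV_card_ge_0)
  then show ?thesis by (rule card_ge_0_finite)
qed

text \<open>The action of the companion matrix: coefficients move up by one, and the overflow
  \<open>v (h - 1)\<close> is fed back along \<open>a\<close>, because \<open>X^h\<close> is
  congruent to the polynomial with coefficients \<open>a\<close>.\<close>

definition times_X :: "nat \<Rightarrow> (nat \<Rightarrow> 'a::field) \<Rightarrow> (nat \<Rightarrow> 'a) \<Rightarrow> nat \<Rightarrow> 'a" where
  "times_X h a v = (\<lambda>c. if c < h then (if c = 0 then 0 else v (c - 1)) + v (h - 1) * a c else 0)"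

text \<open>The coefficients of \<open>X\<^sup>i\<close> modulo \<open>X\<^sup>h - a\<^bsub>h-1\<^esub> X\<^bsup>h-1\<^esup> - \<dots> - a\<^sub>0\<close>.\<close>
primrec X_power :: "nat \<Rightarrow> (nat \<Rightarrow> 'a::field) \<Rightarrow> nat \<Rightarrow> nat \<Rightarrow> 'a" where
  "X_power h a 0 = (\<lambda>c. if c = 0 then 1 else 0)"
| "X_power h a (Suc i) = times_X h a (X_power h a i)"

text \<open>Substitutes \<open>\<zeta>\<close> for \<open>X\<close>. When \<open>\<zeta>\<close> is
  a root of the modulus, computations with residues are thereby transported to the algebraic
  closure.\<close>

definition ev :: "nat \<Rightarrow> 'a alg_closure \<Rightarrow> (nat \<Rightarrow> 'a::field) \<Rightarrow> 'a alg_closure" where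
  "ev h \<zeta> v = (\<Sum>c<h. to_ac (v c) * \<zeta> ^ c)"

text \<open>Since \<open>a 0 \<noteq> 0\<close> makes \<open>X\<close> invertible, all powers of \<open>X\<close> below \<open>q\<^sup>h - 1\<close> are then distinct, so that
  every nonzero residue is a power of \<open>X\<close> and the residue ring is a field.\<close>
definition primitive_coeffs :: "nat \<Rightarrow> (nat \<Rightarrow> 'a::{field,finite}) \<Rightarrow> bool" where
  "primitive_coeffs h a \<longleftrightarrow> a 0 \<noteq> 0 \<and>
     (\<forall>i. 1 \<le> i \<and> i < CARD('a) ^ h - 1 \<longrightarrow> X_power h a i \<noteq> X_power h a 0)"

lemma times_X_in_vecs: "times_X h a v \<in> vecs h"
  by (auto simp: times_X_def vecs_def)

lemma X_power_in_vecs: "h \<ge> 1 \<Longrightarrow> X_power h a i \<in> vecs h"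
  by (cases i) (auto simp: times_X_in_vecs, auto simp: vecs_def)

lemma X_power_cong:
  assumes "\<And>c. c < h \<Longrightarrow> a c = b c"
  shows "X_power h a i = X_power h b i"
  by (induction i) (auto simp: times_X_def assms fun_eq_iff)

lemma primitive_coeffs_cong:
  assumes "h \<ge> 1" "\<And>c. c < h \<Longrightarrow> a c = b c"
  shows "primitive_coeffs h a \<longleftrightarrow> primitive_coeffs h b"
  using assms by (simp add: primitive_coeffs_def X_power_cong[OF assms(2)])

text \<open>The constant coefficient of the product is \<open>v (h - 1) * a 0\<close>, so
  \<open>a 0 \<noteq> 0\<close> recovers the top coefficient of the factor, and with it all the
  others.\<close>

lemma times_X_inj:
  assumes "h \<ge> 1" "a 0 \<noteq> 0" "u \<in> vecs h" "v \<in> vecs h" "times_X h a u = times_X h a v"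
  shows "u = v"
proof
  fix c
  have eq: "times_X h a u c = times_X h a v c" for c using assms(5) by simp
  have top: "u (h - 1) = v (h - 1)"
    using eq[of 0] assms(1,2) by (simp add: times_X_def)
  consider "c \<ge> h" | "c = h - 1" | "Suc c < h" by linarith
  then show "u c = v c"
  proof cases
    case 3
    then show ?thesis using eq[of "Suc c"] top by (simp add: times_X_def)
  qed (use assms top in \<open>auto simp: vecs_def\<close>)
qed

text \<open>Cancels \<open>X^i\<close>, one factor \<open>X\<close> at a time.\<close>

lemma X_power_diff:
  assumes "h \<ge> 1" "a 0 \<noteq> 0" "X_power h a (i + k) = X_power h a i"
  shows "X_power h a k = X_power h a 0"
  using assms(3)
proof (induction i)
  case (Suc i)
  then have "times_X h a (X_power h a (i + k)) = times_X h a (X_power h a i)" by simp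
  then show ?case
    using times_X_inj[where a = a, OF assms(1,2)] X_power_in_vecs[OF assms(1)] Suc.IH by blast
qed simp

lemma ev_times_X:
  assumes h: "h \<ge> 1" and root: "\<zeta> ^ h = ev h \<zeta> a"
  shows "ev h \<zeta> (times_X h a v) = \<zeta> * ev h \<zeta> v"
proof -
  obtain g where g: "h = Suc g" using h by (cases h) auto
  have "to_ac (times_X h a v c) * \<zeta> ^ c = (if c = 0 then 0 else to_ac (v (c - 1))) * \<zeta> ^ c +
      to_ac (v g) * (to_ac (a c) * \<zeta> ^ c)" if "c < h" for c
    using that by (simp add: times_X_def g algebra_simps)
  then have "ev h \<zeta> (times_X h a v) =
      (\<Sum>c<h. (if c = 0 then 0 else to_ac (v (c - 1))) * \<zeta> ^ c) + to_ac (v g) * ev h \<zeta> a"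
    by (simp add: ev_def sum_distrib_left flip: sum.distrib)
  also have "(\<Sum>c<h. (if c = 0 then 0 else to_ac (v (c - 1))) * \<zeta> ^ c) =
      (\<Sum>c<g. to_ac (v c) * \<zeta> ^ Suc c)"
    unfolding g by (subst sum.lessThan_Suc_shift) simp
  also have "\<dots> = \<zeta> * (\<Sum>c<g. to_ac (v c) * \<zeta> ^ c)"
    by (simp add: sum_distrib_left mult_ac)
  also have "to_ac (v g) * ev h \<zeta> a = \<zeta> * (to_ac (v g) * \<zeta> ^ g)"
    using root by (simp add: g)
  finally show ?thesis by (simp add: ev_def g algebra_simps)
qed

lemma ev_X_power:
  assumes "h \<ge> 1" "\<zeta> ^ h = ev h \<zeta> a"
  shows "ev h \<zeta> (X_power h a i) = \<zeta> ^ i"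
proof (induction i)
  case 0
  have "(\<Sum>c<h. to_ac (X_power h a 0 c) * \<zeta> ^ c) = (\<Sum>c\<in>{0}. to_ac (X_power h a 0 c) * \<zeta> ^ c)"
    by (rule sum.mono_neutral_right) (use assms(1) in auto)
  then show ?case by (simp add: ev_def)
next
  case (Suc i)
  then show ?case by (simp add: ev_times_X[OF assms])
qed

section \<open>Primitive elements and primitive polynomials\<close>

lemma inj_on_powers:
  fixes \<zeta> :: "'b::field"
  assumes "\<zeta> \<noteq> 0" "\<And>i. 1 \<le> i \<Longrightarrow> i < n \<Longrightarrow> \<zeta> ^ i \<noteq> 1"
  shows "inj_on (\<lambda>i. \<zeta> ^ i) {..<n}"
proof (rule linorder_inj_onI)
  fix i j assume ij: "i < j" "i \<in> {..<n}" "j \<in> {..<n}"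
  then have "\<zeta> ^ j = \<zeta> ^ i * \<zeta> ^ (j - i)" by (simp flip: power_add)
  moreover have "\<zeta> ^ (j - i) \<noteq> 1" using ij by (intro assms(2)) auto
  ultimately show "\<zeta> ^ i \<noteq> \<zeta> ^ j" using assms(1) by auto
qed auto

text \<open>A relation that expresses \<open>\<zeta>^k\<close> by lower powers confines all powers
  of \<open>\<zeta>\<close> to at most \<open>q^k\<close> combinations. Zero and the powers below
  \<open>q^h - 1\<close> are \<open>q^h\<close> distinct values among them.\<close>

lemma degree_ge:
  fixes \<zeta> :: "'a::{field,finite} alg_closure"
  assumes nz: "\<zeta> \<noteq> 0" and ord: "\<And>i. 1 \<le> i \<Longrightarrow> i < CARD('a) ^ h - 1 \<Longrightarrow> \<zeta> ^ i \<noteq> 1"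
    and rel: "\<zeta> ^ k = ev k \<zeta> v"
  shows "h \<le> k"
proof (cases "k = 0")
  case False
  let ?n = "CARD('a) ^ h - 1"
  have "insert 0 ((\<lambda>i. \<zeta> ^ i) ` {..<?n}) \<subseteq> ev k \<zeta> ` vecs k"
  proof -
    have "0 \<in> ev k \<zeta> ` vecs k"
      by (rule image_eqI[of _ _ "\<lambda>_. 0"]) (auto simp: ev_def vecs_def)
    moreover have "\<zeta> ^ i \<in> ev k \<zeta> ` vecs k" for i
      using False rel by (intro image_eqI[of _ _ "X_power k v i"])
        (auto simp: ev_X_power X_power_in_vecs)
    ultimately show ?thesis by auto
  qed
  then have "card (insert 0 ((\<lambda>i. \<zeta> ^ i) ` {..<?n})) \<le> card (vecs k :: (nat \<Rightarrow> 'a) set)"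
    by (rule surj_card_le[OF finite_vecs])
  moreover have "card (insert 0 ((\<lambda>i. \<zeta> ^ i) ` {..<?n})) = CARD('a) ^ h"
    using nz inj_on_powers[OF nz ord] by (subst card_insert_disjoint) (auto simp: card_image)
  ultimately have "CARD('a) ^ h \<le> CARD('a) ^ k" by (simp add: card_vecs)
  then show ?thesis
    using card_field_gt_1[where 'a = 'a] by (simp add: power_increasing_iff del: One_nat_def)
qed (use rel in \<open>simp add: ev_def\<close>)

lemma to_ac_power_card_power:
  fixes x :: "'a::{field,finite}"
  shows "to_ac x ^ (CARD('a) ^ h) = to_ac x"
  by (induction h) (simp_all add: power_mult to_ac_power_card)

lemma ev_in_fixed_field:
  fixes \<zeta> :: "'a::{field,finite} alg_closure"
  assumes "\<zeta> ^ (CARD('a) ^ h) = \<zeta>"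
  shows "ev k \<zeta> v ^ (CARD('a) ^ h) = ev k \<zeta> v"
proof -
  have sum: "(\<Sum>c<k. f c) ^ (CARD('a) ^ h) = (\<Sum>c<k. f c ^ (CARD('a) ^ h))"
    for f :: "nat \<Rightarrow> 'a alg_closure"
    by (induction k) (simp_all add: add_power_card_power power_0_left finite_UNIV_card_ge_0)
  have "(\<zeta> ^ c) ^ (CARD('a) ^ h) = \<zeta> ^ c" for c
    by (metis assms power_mult mult.commute)
  then show ?thesis
    by (simp add: ev_def sum power_mult_distrib to_ac_power_card_power)
qed

text \<open>Guarantees that the exhaustive search succeeds. The \<open>q^(h+1)\<close> polynomials
  of degree at most \<open>h\<close> take at most \<open>q^h\<close> values at a primitive element
  \<open>\<zeta>\<close>, so the difference of two of them vanishes there. By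
  \<open>degree_ge\<close> this difference has degree exactly \<open>h\<close>, and it yields the
  modulus.\<close>

lemma primitive_coeffs_exist:
  assumes h: "h \<ge> 1"
  shows "\<exists>a :: nat \<Rightarrow> 'a::{field,finite}. primitive_coeffs h a"
proof -
  obtain \<zeta> :: "'a alg_closure" where z: "\<zeta> \<noteq> 0" "\<zeta> ^ (CARD('a) ^ h) = \<zeta>"
    and ord: "\<And>i. 1 \<le> i \<Longrightarrow> i < CARD('a) ^ h - 1 \<Longrightarrow> \<zeta> ^ i \<noteq> 1"
    using primitive_element_exists[OF h] by blast
  note deg = degree_ge[OF z(1) ord]
  let ?S = "{x :: 'a alg_closure. x ^ (CARD('a) ^ h) = x}"
  have cS: "card ?S = CARD('a) ^ h" by (rule card_fixed_field[OF h])
  then have fS: "finite ?S" by (intro card_ge_0_finite) (simp add: finite_UNIV_card_ge_0)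
  have "\<not> inj_on (ev (Suc h) \<zeta>) (vecs (Suc h) :: (nat \<Rightarrow> 'a) set)"
  proof
    assume "inj_on (ev (Suc h) \<zeta>) (vecs (Suc h) :: (nat \<Rightarrow> 'a) set)"
    then have "card (vecs (Suc h) :: (nat \<Rightarrow> 'a) set) \<le> card ?S"
      by (rule card_inj_on_le) (use fS ev_in_fixed_field[OF z(2)] in auto)
    then show False
      using card_field_gt_1[where 'a = 'a] by (simp add: card_vecs cS finite_UNIV_card_ge_0)
  qed
  then obtain v v' :: "nat \<Rightarrow> 'a" where v: "v \<in> vecs (Suc h)" "v' \<in> vecs (Suc h)" "v \<noteq> v'"
    "ev (Suc h) \<zeta> v = ev (Suc h) \<zeta> v'"
    by (auto simp: inj_on_def)
  define u where "u = (\<lambda>c. v c - v' c)"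
  have u0: "u c = 0" if "c > h" for c using v that by (simp add: vecs_def u_def)
  have evu: "(\<Sum>c<Suc h. to_ac (u c) * \<zeta> ^ c) = 0"
    using v(4) by (simp add: u_def ev_def algebra_simps sum_subtractf)
  define k where "k = Max {c. u c \<noteq> 0}"
  have fin: "finite {c. u c \<noteq> 0}"
    by (rule finite_subset[of _ "{..h}"]) (use u0 in \<open>auto simp: not_less[symmetric]\<close>)
  have ne: "{c. u c \<noteq> 0} \<noteq> {}" using v(3) by (auto simp: u_def fun_eq_iff)
  have uk: "u k \<noteq> 0" using Max_in[OF fin ne] by (simp add: k_def)
  have above: "u c = 0" if "c > k" for c
    using Max_ge[OF fin, of c] that by (force simp: k_def)
  have kh: "k \<le> h" using uk u0 by (meson not_less)
  \<comment> \<open>The relation \<open>u(\<zeta>) = 0\<close> solved for its leading power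
    \<open>\<zeta>^k\<close>.\<close>
  define b where "b c = - u c / u k" for c
  have "(\<Sum>c<Suc h. to_ac (u c) * \<zeta> ^ c) = (\<Sum>c<Suc k. to_ac (u c) * \<zeta> ^ c)"
    by (rule sum.mono_neutral_right) (use kh above in auto)
  then have "(\<Sum>c<k. to_ac (u c) * \<zeta> ^ c) + to_ac (u k) * \<zeta> ^ k = 0"
    using evu by simp
  then have "to_ac (u k) * \<zeta> ^ k = - (\<Sum>c<k. to_ac (u c) * \<zeta> ^ c)"
    by (simp add: eq_neg_iff_add_eq_0 add.commute)
  then have "\<zeta> ^ k = - (\<Sum>c<k. to_ac (u c) * \<zeta> ^ c) / to_ac (u k)"
    using uk by (simp add: field_simps)
  also have "\<dots> = ev k \<zeta> b"
    by (simp add: ev_def b_def sum_divide_distrib flip: sum_negf)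
  finally have rel: "\<zeta> ^ k = ev k \<zeta> b" .
  then have "k = h" using deg kh by (simp add: le_antisym)
  then have root: "\<zeta> ^ h = ev h \<zeta> b" using rel by simp
  \<comment> \<open>With \<open>b 0 = 0\<close> the relation could be divided by
    \<open>\<zeta>\<close>, which would leave a relation for \<open>\<zeta>^(h-1)\<close>.\<close>
  have "b 0 \<noteq> 0"
  proof
    assume b0: "b 0 = 0"
    obtain g where g: "h = Suc g" using h by (cases h) auto
    have "\<zeta> * \<zeta> ^ g = \<zeta> * ev g \<zeta> (\<lambda>c. b (Suc c))"
      using root b0 by (simp add: g ev_def sum.lessThan_Suc_shift sum_distrib_left mult_ac del: sum.lessThan_Suc)
    then have "h \<le> g" using z(1) deg by simp
    then show False using g by simp
  qed
  moreover have "X_power h b i \<noteq> X_power h b 0" if "1 \<le> i" "i < CARD('a) ^ h - 1" for i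
    using ev_X_power[OF h root, of i] ev_X_power[OF h root, of 0] ord[OF that] by auto
  ultimately show ?thesis by (auto simp: primitive_coeffs_def)
qed

text \<open>Any root \<open>\<zeta>\<close> of the modulus will do. By primitivity the powers of
  \<open>X\<close> exhaust the nonzero residues, and each of them evaluates to a nonzero power of
  \<open>\<zeta>\<close>. Hence evaluation has trivial kernel, and distinct powers of
  \<open>X\<close> give distinct powers of \<open>\<zeta>\<close>.\<close>

lemma primitive_coeffs_root:
  fixes a :: "nat \<Rightarrow> 'a::{field,finite}"
  assumes h: "h \<ge> 1" and prim: "primitive_coeffs h a"
  obtains \<zeta> where "\<And>i. ev h \<zeta> (X_power h a i) = \<zeta> ^ i"
    "\<And>v. v \<in> vecs h \<Longrightarrow> ev h \<zeta> v = 0 \<Longrightarrow> v = (\<lambda>_. 0)"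
    "\<zeta> \<noteq> 0" "inj_on (\<lambda>i. \<zeta> ^ i) {..<CARD('a) ^ h - 1}"
proof -
  let ?n = "CARD('a) ^ h - 1"
  have a0: "a 0 \<noteq> 0" using prim by (simp add: primitive_coeffs_def)
  obtain \<zeta> where "(\<Sum>k\<le>h. (if k = h then 1 else - to_ac (a k)) * \<zeta> ^ k) = 0"
    using alg_closed[of h "\<lambda>k. if k = h then 1 else - to_ac (a k)"] h by auto
  then have "(\<Sum>k<h. - to_ac (a k) * \<zeta> ^ k) + \<zeta> ^ h = 0"
    by (simp add: lessThan_Suc_atMost[symmetric])
  then have root: "\<zeta> ^ h = ev h \<zeta> a"
    by (simp add: ev_def sum_negf)
  note pow = ev_X_power[OF h root]
  have nz: "\<zeta> \<noteq> 0"
  proof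
    assume "\<zeta> = 0"
    then have "to_ac (a 0) = 0"
      using root h by (cases h) (auto simp: ev_def sum.lessThan_Suc_shift simp del: sum.lessThan_Suc)
    then show False using a0 by simp
  qed
  have inj: "inj_on (X_power h a) {..<?n}"
  proof (rule linorder_inj_onI)
    fix i j assume ij: "i < j" "i \<in> {..<?n}" "j \<in> {..<?n}"
    show "X_power h a i \<noteq> X_power h a j"
    proof
      assume "X_power h a i = X_power h a j"
      then have "X_power h a (i + (j - i)) = X_power h a i" using ij by simp
      then have "X_power h a (j - i) = X_power h a 0" by (rule X_power_diff[of h a i, OF h a0])
      moreover have "1 \<le> j - i" "j - i < ?n" using ij by auto
      ultimately show False using prim unfolding primitive_coeffs_def by blast
    qed
  qed auto
  \<comment> \<open>The \<open>q^h - 1\<close> powers are distinct and nonzero, and there are just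
    as many nonzero vectors.\<close>
  have "X_power h a ` {..<?n} = vecs h - {\<lambda>_. 0}"
  proof (rule card_subset_eq)
    show "X_power h a ` {..<?n} \<subseteq> vecs h - {\<lambda>_. 0}"
    proof (intro image_subsetI DiffI X_power_in_vecs h)
      fix i
      have "ev h \<zeta> (\<lambda>_. 0) = 0" by (simp add: ev_def)
      then show "X_power h a i \<notin> {\<lambda>_. 0}" using pow[of i] nz by auto
    qed
    have "(\<lambda>_. 0) \<in> (vecs h :: (nat \<Rightarrow> 'a) set)" by (simp add: vecs_def)
    then show "card (X_power h a ` {..<?n}) = card (vecs h - {\<lambda>_. 0 :: 'a})"
      using card_image[OF inj] by (simp add: card_vecs)
  qed simp
  then have all: "\<exists>i<?n. v = X_power h a i" if "v \<in> vecs h" "v \<noteq> (\<lambda>_. 0)" for v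
    using that by (auto simp: set_eq_iff image_iff Bex_def)
  show ?thesis
  proof (rule that[OF pow _ nz])
    show zero: "v = (\<lambda>_. 0)" if v: "v \<in> vecs h" "ev h \<zeta> v = 0" for v
    proof (rule ccontr)
      assume "v \<noteq> (\<lambda>_. 0)"
      then obtain i where "v = X_power h a i" using all[OF v(1)] by auto
      then show False using v(2) pow nz by simp
    qed
    show "inj_on (\<lambda>i. \<zeta> ^ i) {..<?n}"
    proof (rule inj_onI)
      fix i j assume ij: "i \<in> {..<?n}" "j \<in> {..<?n}" and "\<zeta> ^ i = \<zeta> ^ j"
      then have "ev h \<zeta> (\<lambda>c. X_power h a i c - X_power h a j c) = 0"
        using pow[of i] pow[of j] by (simp add: ev_def algebra_simps sum_subtractf)
      then have "(\<lambda>c. X_power h a i c - X_power h a j c) = (\<lambda>_. 0)"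
        using X_power_in_vecs[OF h, of a i] X_power_in_vecs[OF h, of a j]
        by (intro zero) (auto simp: vecs_def)
      then have "X_power h a i = X_power h a j" by (simp add: fun_eq_iff)
      then show "i = j" using inj ij by (simp add: inj_on_def)
    qed
  qed
qed

section \<open>Syndromes and the BCH bound\<close>

text \<open>The part of \<open>H e\<close> that belongs to the exponent \<open>j\<close>: column
  \<open>i\<close> of this part of \<open>H\<close> holds the coordinates of \<open>X^(i j)\<close>,
  which stands for \<open>(\<zeta>^i)^j\<close>.\<close>

definition syndrome :: "nat \<Rightarrow> (nat \<Rightarrow> 'a::field) \<Rightarrow> nat \<Rightarrow> (nat \<Rightarrow> 'a) \<Rightarrow> nat \<Rightarrow> nat \<Rightarrow> 'a" where
  "syndrome h a n e j = (\<lambda>c. \<Sum>i<n. X_power h a (i * j) c * e i)"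

lemma syndrome_in_vecs: "h \<ge> 1 \<Longrightarrow> syndrome h a n e j \<in> vecs h"
  using X_power_in_vecs[of h a] by (auto simp: syndrome_def vecs_def)

lemma ev_syndrome:
  assumes "\<And>i. ev h \<zeta> (X_power h a i) = \<zeta> ^ i"
  shows "ev h \<zeta> (syndrome h a n e j) = (\<Sum>i<n. to_ac (e i) * (\<zeta> ^ i) ^ j)"
proof -
  have "ev h \<zeta> (syndrome h a n e j) = (\<Sum>i<n. to_ac (e i) * ev h \<zeta> (X_power h a (i * j)))"
    by (simp add: ev_def syndrome_def to_ac_sum sum_distrib_left sum_distrib_right sum.swap[of _ "{..<h}"] mult_ac)
  then show ?thesis by (simp add: assms power_mult)
qed

text \<open>The entries of \<open>e\<close> are fixed by the Frobenius map, so the power sum for the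
  exponent \<open>q i\<close> is the \<open>q\<close>-th power of the one for \<open>i\<close>.
  Strong induction descends to exponents not divisible by \<open>q\<close>.\<close>

lemma syndrome_eq_0_by_Frobenius:
  fixes a :: "nat \<Rightarrow> 'a::{field,finite}"
  assumes h: "h \<ge> 1" and prim: "primitive_coeffs h a"
    and zero: "\<And>j. j \<in> {1..d} \<Longrightarrow> \<not> CARD('a) dvd j \<Longrightarrow> syndrome h a n e j = (\<lambda>_. 0)"
    and j: "j \<in> {1..d}"
  shows "syndrome h a n e j = (\<lambda>_. 0)"
proof -
  obtain \<zeta> where pow: "\<And>i. ev h \<zeta> (X_power h a i) = \<zeta> ^ i"
    and van: "\<And>v. v \<in> vecs h \<Longrightarrow> ev h \<zeta> v = 0 \<Longrightarrow> v = (\<lambda>_. 0)"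
    using primitive_coeffs_root[OF h prim] by metis
  show ?thesis using j
  proof (induction j rule: less_induct)
    case (less j)
    show ?case
    proof (cases "CARD('a) dvd j")
      case True
      then obtain i where i: "j = CARD('a) * i" by auto
      have q: "1 < CARD('a)" by (rule card_field_gt_1)
      have "1 \<le> i" using less.prems by (cases i) (auto simp: i)
      moreover have "i < j" using q \<open>1 \<le> i\<close> by (simp add: i)
      ultimately have "syndrome h a n e i = (\<lambda>_. 0)" using less by simp
      then have "(\<Sum>l<n. to_ac (e l) * (\<zeta> ^ l) ^ i) = 0"
        using ev_syndrome[OF pow, of n e i] by (simp add: ev_def)
      then have "0 = (\<Sum>l<n. to_ac (e l) * (\<zeta> ^ l) ^ i) ^ CARD('a)"
        using q by (simp add: power_0_left)
      also have "\<dots> = (\<Sum>l<n. to_ac (e l) * (\<zeta> ^ l) ^ j)"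
        unfolding sum_power_card power_mult_distrib to_ac_power_card i
        by (simp add: mult_ac flip: power_mult)
      also have "\<dots> = ev h \<zeta> (syndrome h a n e j)" by (simp add: ev_syndrome[OF pow])
      finally show ?thesis using van[OF syndrome_in_vecs[OF h]] by simp
    qed (use zero less in auto)
  qed
qed

text \<open>The BCH bound: testing the vanishing power sums against the polynomial
  \<open>X \<Prod>\<^bsub>i \<noteq> k\<^esub> (X - \<zeta>\<^sup>i)\<close>, the product being over the support of \<open>e\<close>, isolates \<open>e k\<close>.\<close>
lemma bch_bound:
  fixes a :: "nat \<Rightarrow> 'a::{field,finite}"
  assumes h: "h \<ge> 1" and prim: "primitive_coeffs h a" and n: "n \<le> CARD('a) ^ h - 1"
    and zero: "\<And>j. j \<in> {1..d} \<Longrightarrow> syndrome h a n e j = (\<lambda>_. 0)"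
    and weight: "card {i. i < n \<and> e i \<noteq> 0} \<le> d"
  shows "\<forall>i<n. e i = 0"
proof (rule ccontr)
  assume "\<not> (\<forall>i<n. e i = 0)"
  then obtain k where k: "k < n" "e k \<noteq> 0" by auto
  obtain \<zeta> where pow: "\<And>i. ev h \<zeta> (X_power h a i) = \<zeta> ^ i"
    and nz: "\<zeta> \<noteq> 0" and inj: "inj_on (\<lambda>i. \<zeta> ^ i) {..<CARD('a) ^ h - 1}"
    using primitive_coeffs_root[OF h prim] by metis
  define I where "I = {i. i < n \<and> e i \<noteq> 0}"
  have kI: "k \<in> I" "finite I" using k by (auto simp: I_def)
  \<comment> \<open>The factor \<open>X\<close> removes the constant coefficient, as the power sum
    with exponent \<open>0\<close> is not known to vanish. Together with the other
    \<open>card I - 1\<close> factors the degree is at most \<open>d\<close>.\<close>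
  define p where "p = [:0, 1:] * (\<Prod>i\<in>I - {k}. [:- (\<zeta> ^ i), 1:])"
  have "Polynomial.degree (\<Prod>i\<in>I - {k}. [:- (\<zeta> ^ i), 1:]) = card (I - {k})"
    by (subst degree_prod_eq_sum_degree) auto
  moreover have "card (I - {k}) < d"
    using weight kI card_gt_0_iff[of I] by (auto simp: I_def[symmetric])
  ultimately have deg: "Polynomial.degree p \<le> d"
    unfolding p_def by (intro order.trans[OF degree_mult_le]) simp
  have p0: "poly.coeff p 0 = 0" by (simp add: p_def)
  have p_eval: "poly p x = (\<Sum>j=1..d. poly.coeff p j * x ^ j)" for x
  proof -
    have "poly p x = (\<Sum>j\<le>d. poly.coeff p j * x ^ j)"
      unfolding poly_altdef
      by (rule sum.mono_neutral_left) (use deg in \<open>auto simp: coeff_eq_0\<close>)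
    also have "\<dots> = (\<Sum>j=1..d. poly.coeff p j * x ^ j)"
      by (rule sum.mono_neutral_right) (use p0 in \<open>auto simp: not_le\<close>)
    finally show ?thesis .
  qed
  have ps: "(\<Sum>i<n. to_ac (e i) * (\<zeta> ^ i) ^ j) = 0" if "j \<in> {1..d}" for j
    using ev_syndrome[OF pow, of n e j] zero[OF that] by (simp add: ev_def)
  have "(\<Sum>i<n. to_ac (e i) * poly p (\<zeta> ^ i)) =
      (\<Sum>j=1..d. poly.coeff p j * (\<Sum>i<n. to_ac (e i) * (\<zeta> ^ i) ^ j))"
    by (simp add: p_eval sum_distrib_left sum.swap[of _ "{..<n}"] mult_ac)
  then have "(\<Sum>i<n. to_ac (e i) * poly p (\<zeta> ^ i)) = 0" by (simp add: ps)
  moreover have "to_ac (e i) * poly p (\<zeta> ^ i) = 0" if "i \<in> {..<n} - {k}" for i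
    using that kI by (cases "i \<in> I") (auto simp: I_def p_def poly_prod)
  then have "(\<Sum>i\<in>{..<n}. to_ac (e i) * poly p (\<zeta> ^ i)) = (\<Sum>i\<in>{k}. to_ac (e i) * poly p (\<zeta> ^ i))"
    using k by (intro sum.mono_neutral_right) auto
  ultimately have "poly p (\<zeta> ^ k) = 0" using k by simp
  then obtain i where "i \<in> I - {k}" "\<zeta> ^ k = \<zeta> ^ i"
    using nz kI by (auto simp: p_def poly_prod)
  then show False using inj k n by (auto simp: I_def inj_on_def)
qed

section \<open>The program\<close>

definition Eq :: "aexp \<Rightarrow> aexp \<Rightarrow> bexp" where
  "Eq a b = BAnd (BNot (Less a b)) (BNot (Less b a))"

lemma bval_Eq [simp]: "bval (Eq a b) \<sigma> \<longleftrightarrow> aval a \<sigma> = aval b \<sigma>"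
  by (auto simp: Eq_def)

text \<open>Unrolled into \<open>n\<close> assignments of constants: as \<open>q\<close> is fixed,
  the operation tables of the field are hard-wired into the program at a cost independent of
  \<open>m\<close>.\<close>

primrec table :: "string \<Rightarrow> (nat \<Rightarrow> nat) \<Rightarrow> nat \<Rightarrow> com" where
  "table x f 0 = Skip"
| "table x f (Suc n) = Seq (table x f n) (Assign x (Const n) (Const (f n)))"

lemma writes_table: "writes (table x f n) \<subseteq> {x}"
  by (induction n) auto

lemma wp_table: "wp (table x f n) \<sigma> (2 * n) (\<lambda>\<tau>. \<forall>i<n. \<tau> x i = f i)"
proof (induction n)
  case 0
  then show ?case by (simp add: wp_Skip)
next
  case (Suc n)
  show ?case
    unfolding table.simps
  proof (rule wp_mono, rule wp_Seq'[OF wp_conseq[OF Suc _ order.refl]], rule wp_Assign')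
    fix \<tau> assume "\<forall>i<n. \<tau> x i = f i"
    then show "\<forall>i<Suc n. store x (aval (Const n) \<tau>) (aval (Const (f n)) \<tau>) \<tau> x i = f i"
      by (auto simp: less_Suc_eq)
  qed simp
qed

definition mult :: "string \<Rightarrow> string \<Rightarrow> string \<Rightarrow> com" where
  "mult z x y = Seq (Set_var z (Const 0)) (For ''i'' y (Set_var z (Add (V z) (V x))))"

lemma writes_mult [simp]: "writes (mult z x y) = {z, ''i''}"
  by (auto simp: mult_def)

lemma wp_mult:
  assumes "z \<noteq> x" "z \<noteq> y" "z \<noteq> ''i''" "x \<noteq> ''i''" "y \<noteq> ''i''"
  shows "wp (mult z x y) \<sigma> (5 * \<sigma> y 0 + 5) (\<lambda>\<tau>. \<tau> z 0 = \<sigma> x 0 * \<sigma> y 0)"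
  unfolding mult_def
proof (rule wp_mono, rule wp_Seq'[where u = "5 * \<sigma> y 0 + 3"], rule wp_Assign')
  show "wp (For ''i'' y (Set_var z (Add (V z) (V x)))) (store z (aval (Const 0) \<sigma>) (aval (Const 0) \<sigma>) \<sigma>)
    (5 * \<sigma> y 0 + 3) (\<lambda>\<tau>. \<tau> z 0 = \<sigma> x 0 * \<sigma> y 0)"
    by (rule wp_For[where I = "\<lambda>i \<tau>. \<tau> z 0 = \<sigma> x 0 * i" and s = 1, OF _ _ _ _ wp_Assign])
      (use assms in auto)
qed simp

locale field_code =
  fixes code :: "'a::{field,finite} \<Rightarrow> nat" and q :: nat
  assumes card_q: "CARD('a) = q" and bij: "bij_betw code UNIV {..<q}"
begin

definition dec :: "nat \<Rightarrow> 'a" where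
  "dec = inv_into UNIV code"

lemma code_less [simp]: "code x < q"
  using bij by (auto simp: bij_betw_def)

lemma code_eq_iff [simp]: "code x = code y \<longleftrightarrow> x = y"
  using bij by (auto simp: bij_betw_def inj_on_def)

lemma dec_code [simp]: "dec (code x) = x"
  using bij by (simp add: dec_def bij_betw_def)

lemma code_dec [simp]: "x < q \<Longrightarrow> code (dec x) = x"
  using bij unfolding dec_def bij_betw_def by (metis f_inv_into_f lessThan_iff)

lemma q_gt_1: "1 < q"
  using card_field_gt_1[where 'a = 'a] card_q by simp

definition tables :: com where
  "tables = Seq (table ''add'' (\<lambda>i. code (dec (i div q) + dec (i mod q))) (q * q))
     (table ''mul'' (\<lambda>i. code (dec (i div q) * dec (i mod q))) (q * q))"

text \<open>A pair of codes is addressed as a two-digit number in base \<open>q\<close>.\<close>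

definition tables_ok :: "memory \<Rightarrow> bool" where
  "tables_ok \<sigma> \<longleftrightarrow> (\<forall>x y. \<sigma> ''add'' (q * code x + code y) = code (x + y) \<and>
     \<sigma> ''mul'' (q * code x + code y) = code (x * y))"

lemma tables_ok_cong: "\<tau> ''add'' = \<sigma> ''add'' \<Longrightarrow> \<tau> ''mul'' = \<sigma> ''mul'' \<Longrightarrow> tables_ok \<tau> = tables_ok \<sigma>"
  by (simp add: tables_ok_def)

lemma writes_tables: "writes tables \<subseteq> {''add'', ''mul''}"
  using writes_table by (fastforce simp: tables_def)

lemma wp_tables: "wp tables \<sigma> (4 * (q * q) + 1) tables_ok"
  unfolding tables_def
proof (rule wp_mono, rule wp_Seq'[OF wp_conseq[OF wp_table _ order.refl]],
    rule wp_conseq[OF wp_table _ order.refl])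
  fix \<tau> \<tau>'
  assume *: "\<forall>i<q * q. \<tau> ''add'' i = code (dec (i div q) + dec (i mod q))"
    "\<forall>i<q * q. \<tau>' ''mul'' i = code (dec (i div q) * dec (i mod q))"
    "\<And>x. x \<notin> writes (table ''mul'' (\<lambda>i. code (dec (i div q) * dec (i mod q))) (q * q)) \<Longrightarrow> \<tau>' x = \<tau> x"
  have "''add'' \<notin> writes (table ''mul'' (\<lambda>i. code (dec (i div q) * dec (i mod q))) (q * q))"
    using writes_table[of "''mul''"] by fastforce
  then have add: "\<tau>' ''add'' = \<tau> ''add''" by (rule *(3))
  have "q * code x + code y < q * q" for x y
  proof -
    have "q * code x + code y < q * Suc (code x)" by simp
    also have "\<dots> \<le> q * q" by (rule mult_le_mono2) (simp add: Suc_leI)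
    finally show ?thesis .
  qed
  then show "tables_ok \<tau>'" using * add q_gt_1 by (simp add: tables_ok_def)
qed simp

definition add_e :: "aexp \<Rightarrow> aexp \<Rightarrow> aexp" where
  "add_e x y = Cell ''add'' (Add (times_const q x) y)"

definition mul_e :: "aexp \<Rightarrow> aexp \<Rightarrow> aexp" where
  "mul_e x y = Cell ''mul'' (Add (times_const q x) y)"

lemma aval_add_e:
  "tables_ok \<sigma> \<Longrightarrow> aval x \<sigma> = code a \<Longrightarrow> aval y \<sigma> = code b \<Longrightarrow> aval (add_e x y) \<sigma> = code (a + b)"
  by (simp add: add_e_def tables_ok_def)

lemma aval_mul_e:
  "tables_ok \<sigma> \<Longrightarrow> aval x \<sigma> = code a \<Longrightarrow> aval y \<sigma> = code b \<Longrightarrow> aval (mul_e x y) \<sigma> = code (a * b)"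
  by (simp add: mul_e_def tables_ok_def)

section \<open>Powers of X and the primitivity test\<close>

text \<open>With \<open>b\<close> the address of row \<open>i\<close>, entry \<open>c\<close> of row
  \<open>i + 1\<close> is computed by the rule of \<open>times_X\<close>. For \<open>c = 0\<close>
  the shifted coefficient is the code of zero, which need not be the number \<open>0\<close>. The
  flag \<open>g\<close> is raised when the new row differs from row \<open>0\<close>.\<close>

definition rows_entry :: com where
  "rows_entry = Seq
     (Cond (Less (V ''c'') (Const 1)) (Set_var ''z'' (Const (code 0)))
       (Set_var ''z'' (Cell ''P'' (Sub (Add (V ''b'') (V ''c'')) (Const 1)))))
     (Seq (Assign ''P'' (Add (Add (V ''b'') (V ''h'')) (V ''c''))
        (add_e (V ''z'') (mul_e (Cell ''P'' (Sub (Add (V ''b'') (V ''h'')) (Const 1))) (Cell ''a'' (V ''c'')))))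
     (Cond (Eq (Cell ''P'' (Add (Add (V ''b'') (V ''h'')) (V ''c''))) (Cell ''P'' (V ''c'')))
        Skip (Set_var ''g'' (Const 1))))"

text \<open>An unraised \<open>g\<close> means \<open>X^(i+1) = 1\<close>. The guard compares
  \<open>i + 1\<close> with \<open>cols\<close>, which is \<open>q^h - 1\<close>: from there on such
  a coincidence must not count as a failure.\<close>

definition rows_step :: com where
  "rows_step = Seq (Set_var ''g'' (Const 0)) (Seq (For ''c'' ''h'' rows_entry)
     (Seq (Set_var ''b'' (Add (V ''b'') (V ''h'')))
     (Cond (BAnd (Less (Add (V ''i'') (Const 1)) (V ''cols'')) (Eq (V ''g'') (Const 0)))
        (Set_var ''ok'' (Const 0)) Skip)))"

text \<open>Row \<open>i\<close> of \<open>P\<close> (of length \<open>h\<close>) receives \<open>X\<^sup>i\<close> modulo the polynomial stored in \<open>a\<close>, for all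
  \<open>i \<le> E\<close>, not only below the order of \<open>X\<close>: the exponents \<open>i * j\<close> of the parity check
  matrix then need no reduction. The flag \<open>ok\<close> is the result of the primitivity test.\<close>
definition rows :: com where
  "rows = Seq (Cond (Eq (Cell ''a'' (Const 0)) (Const (code 0))) (Set_var ''ok'' (Const 0)) (Set_var ''ok'' (Const 1)))
     (Seq (For ''c'' ''h'' (Assign ''P'' (V ''c'') (Const (code 0))))
     (Seq (Assign ''P'' (Const 0) (Const (code 1)))
     (Seq (Set_var ''b'' (Const 0)) (For ''i'' ''E'' rows_step))))"

lemma writes_rows_entry [simp]: "writes rows_entry = {''z'', ''P'', ''g''}"
  by (auto simp: rows_entry_def)

lemma writes_rows_step [simp]: "writes rows_step = {''z'', ''P'', ''g'', ''c'', ''b'', ''ok''}"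
  by (auto simp: rows_step_def)

lemma writes_rows [simp]: "writes rows = {''z'', ''P'', ''g'', ''c'', ''b'', ''ok'', ''i''}"
  by (auto simp: rows_def)

text \<open>Counts cells and not rows, so that it also describes a row under construction.\<close>

definition P_upto :: "nat \<Rightarrow> (nat \<Rightarrow> 'a) \<Rightarrow> nat \<Rightarrow> memory \<Rightarrow> bool" where
  "P_upto h a l \<sigma> \<longleftrightarrow> (\<forall>j<l. \<sigma> ''P'' j = code (X_power h a (j div h) (j mod h)))"

lemma P_upto_store [simp]: "x \<noteq> ''P'' \<Longrightarrow> P_upto h a l (store x i v \<sigma>) = P_upto h a l \<sigma>"
  by (simp add: P_upto_def)

lemma tables_ok_store [simp]:
  "x \<noteq> ''add'' \<Longrightarrow> x \<noteq> ''mul'' \<Longrightarrow> tables_ok (store x i v \<sigma>) = tables_ok \<sigma>"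
  by (simp add: tables_ok_def)

lemma P_uptoD: "P_upto h a l \<sigma> \<Longrightarrow> i * h + c < l \<Longrightarrow> c < h \<Longrightarrow> \<sigma> ''P'' (i * h + c) = code (X_power h a i c)"
  by (simp add: P_upto_def)

lemma wp_rows_entry:
  assumes h: "\<sigma> ''h'' 0 = h" and c: "\<sigma> ''c'' 0 = c" "c < h" and b: "\<sigma> ''b'' 0 = i * h"
    and a: "\<sigma> ''a'' c = code (a c)" and tab: "tables_ok \<sigma>"
    and P: "P_upto h a (Suc i * h + c) \<sigma>"
  shows "wp rows_entry \<sigma> 10 (\<lambda>\<tau>. P_upto h a (Suc i * h + Suc c) \<tau> \<and>
    \<tau> ''g'' 0 = (if X_power h a (Suc i) c = X_power h a 0 c then \<sigma> ''g'' 0 else 1))"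
proof -
  let ?l = "Suc i * h + c"
  have "c = 0 \<or> \<sigma> ''P'' (i * h + c - 1) = code (X_power h a i (c - 1))"
    using P_uptoD[OF P, of i "c - 1"] c by (cases c) auto
  moreover have "\<sigma> ''P'' (i * h + h - 1) = code (X_power h a i (h - 1))"
    using P_uptoD[OF P, of i "h - 1"] c by (cases h) auto
  moreover have "\<sigma> ''P'' c = code (X_power h a 0 c)"
    using P_uptoD[OF P, of 0 c] c by simp
  moreover have "X_power h a (Suc i) c = (if c = 0 then 0 else X_power h a i (c - 1)) + X_power h a i (h - 1) * a c"
    using c by (simp add: times_X_def)
  moreover have "(k * h + c) div h = k \<and> (k * h + c) mod h = c" for k using c by auto
  from this[of "Suc i"] have div: "?l div h = Suc i" "?l mod h = c" "i * h + h + c = ?l" by simp_all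
  ultimately have key: "wp (Seq (Assign ''P'' (Add (Add (V ''b'') (V ''h'')) (V ''c''))
        (add_e (V ''z'') (mul_e (Cell ''P'' (Sub (Add (V ''b'') (V ''h'')) (Const 1))) (Cell ''a'' (V ''c'')))))
     (Cond (Eq (Cell ''P'' (Add (Add (V ''b'') (V ''h'')) (V ''c''))) (Cell ''P'' (V ''c'')))
        Skip (Set_var ''g'' (Const 1)))) \<tau> 4 (\<lambda>\<tau>. P_upto h a (Suc i * h + Suc c) \<tau> \<and>
    \<tau> ''g'' 0 = (if X_power h a (Suc i) c = X_power h a 0 c then \<sigma> ''g'' 0 else 1))"
    if z: "\<tau> ''z'' 0 = code (if c = 0 then 0 else X_power h a i (c - 1))"
      and eq: "\<And>x. x \<noteq> ''z'' \<Longrightarrow> \<tau> x = \<sigma> x" for \<tau>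
  proof -
    let ?e = "add_e (V ''z'') (mul_e (Cell ''P'' (Sub (Add (V ''b'') (V ''h'')) (Const 1))) (Cell ''a'' (V ''c'')))"
    have "tables_ok \<tau>" using tab eq by (simp add: tables_ok_def)
    then have "aval ?e \<tau> = code ((if c = 0 then 0 else X_power h a i (c - 1)) + X_power h a i (h - 1) * a c)"
      by (intro aval_add_e aval_mul_e) (use z eq h b c a \<open>\<sigma> ''P'' (i * h + h - 1) = _\<close> in simp_all)
    then have e: "aval ?e \<tau> = code (X_power h a (Suc i) c)"
      using \<open>X_power h a (Suc i) c = _\<close> by simp
    have idx: "aval (Add (Add (V ''b'') (V ''h'')) (V ''c'')) \<tau> = ?l"
      using eq b h c by simp
    have P': "P_upto h a (Suc i * h + Suc c) (store ''P'' ?l (code (X_power h a (Suc i) c)) \<tau>)"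
      using P eq div unfolding P_upto_def by (auto simp: less_Suc_eq simp del: X_power.simps)
    have cl: "c \<noteq> ?l" using c by simp
    show ?thesis
    proof (rule wp_mono, rule wp_Seq', rule wp_Assign', unfold e idx, rule wp_Cond')
      let ?\<tau> = "store ''P'' ?l (code (X_power h a (Suc i) c)) \<tau>"
      have b': "bval (Eq (Cell ''P'' (Add (Add (V ''b'') (V ''h'')) (V ''c''))) (Cell ''P'' (V ''c''))) ?\<tau>
          \<longleftrightarrow> X_power h a (Suc i) c = X_power h a 0 c"
        using eq b h c cl \<open>\<sigma> ''P'' c = _\<close> by (simp del: X_power.simps add: add.assoc[symmetric] div(3))
      {
        assume "bval (Eq (Cell ''P'' (Add (Add (V ''b'') (V ''h'')) (V ''c''))) (Cell ''P'' (V ''c''))) ?\<tau>"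
        then show "wp Skip ?\<tau> 0 (\<lambda>\<tau>. P_upto h a (Suc i * h + Suc c) \<tau> \<and>
          \<tau> ''g'' 0 = (if X_power h a (Suc i) c = X_power h a 0 c then \<sigma> ''g'' 0 else 1))"
          using P' eq unfolding b' by (intro wp_Skip) (simp del: X_power.simps)
      next
        assume "\<not> bval (Eq (Cell ''P'' (Add (Add (V ''b'') (V ''h'')) (V ''c''))) (Cell ''P'' (V ''c''))) ?\<tau>"
        then show "wp (Set_var ''g'' (Const 1)) ?\<tau> 1 (\<lambda>\<tau>. P_upto h a (Suc i * h + Suc c) \<tau> \<and>
          \<tau> ''g'' 0 = (if X_power h a (Suc i) c = X_power h a 0 c then \<sigma> ''g'' 0 else 1))"
          using P' unfolding b' by (intro wp_Assign) (auto simp: P_upto_def simp del: X_power.simps)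
      }
    qed simp
  qed
  show ?thesis
    unfolding rows_entry_def
    by (rule wp_mono, rule wp_Seq', rule wp_Cond'; (rule wp_Assign', rule key)?)
      (use \<open>c = 0 \<or> _\<close> b c in auto)
qed

lemma wp_rows_step:
  assumes h: "\<sigma> ''h'' 0 = h" "h \<ge> 1" and i: "\<sigma> ''i'' 0 = i" and n: "\<sigma> ''cols'' 0 = n"
    and b: "\<sigma> ''b'' 0 = i * h"
    and a: "\<And>c. c < h \<Longrightarrow> \<sigma> ''a'' c = code (a c)" and tab: "tables_ok \<sigma>"
    and P: "P_upto h a (Suc i * h) \<sigma>"
  shows "wp rows_step \<sigma> (14 * h + 20) (\<lambda>\<tau>. P_upto h a (Suc (Suc i) * h) \<tau> \<and> \<tau> ''b'' 0 = Suc i * h \<and>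
    \<tau> ''ok'' 0 = (if Suc i < n \<and> X_power h a (Suc i) = X_power h a 0 then 0 else \<sigma> ''ok'' 0))"
proof -
  define Q where "Q = (\<lambda>\<tau>. P_upto h a (Suc (Suc i) * h) \<tau> \<and> \<tau> ''b'' 0 = Suc i * h \<and>
    \<tau> ''ok'' 0 = (if Suc i < n \<and> X_power h a (Suc i) = X_power h a 0 then 0 else \<sigma> ''ok'' 0))"
  have eqX: "X_power h a (Suc i) = X_power h a 0 \<longleftrightarrow> (\<forall>c<h. X_power h a (Suc i) c = X_power h a 0 c)"
  proof -
    have "X_power h a (Suc i) c = X_power h a 0 c" if "c \<ge> h" for c
      using X_power_in_vecs[OF h(2), of a "Suc i"] X_power_in_vecs[OF h(2), of a 0] that
      by (simp add: vecs_def)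
    then show ?thesis unfolding fun_eq_iff by (meson not_le)
  qed
  have fin: "wp (Seq (Set_var ''b'' (Add (V ''b'') (V ''h'')))
      (Cond (BAnd (Less (Add (V ''i'') (Const 1)) (V ''cols'')) (Eq (V ''g'') (Const 0)))
        (Set_var ''ok'' (Const 0)) Skip)) \<tau> 5 Q"
    if "P_upto h a (Suc (Suc i) * h) \<tau>"
      and "\<tau> ''g'' 0 = (if X_power h a (Suc i) = X_power h a 0 then 0 else 1)"
      and "\<And>z. z \<notin> {''c'', ''z'', ''P'', ''g''} \<Longrightarrow> \<tau> z = \<sigma> z" for \<tau>
    by (rule wp_mono, rule wp_Seq', rule wp_Assign', rule wp_Cond'; (rule wp_Assign' wp_Skip')?)
      (use that h i n b in \<open>simp_all add: Q_def split: if_splits del: X_power.simps\<close>)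
  let ?I = "\<lambda>c \<tau>. P_upto h a (Suc i * h + c) \<tau> \<and>
    \<tau> ''g'' 0 = (if \<exists>c'<c. X_power h a (Suc i) c' \<noteq> X_power h a 0 c' then 1 else 0)"
  have loop: "wp (For ''c'' ''h'' rows_entry) (store ''g'' 0 0 \<sigma>) (h * 14 + 3)
    (\<lambda>\<tau>. wp (Seq (Set_var ''b'' (Add (V ''b'') (V ''h'')))
      (Cond (BAnd (Less (Add (V ''i'') (Const 1)) (V ''cols'')) (Eq (V ''g'') (Const 0)))
        (Set_var ''ok'' (Const 0)) Skip)) \<tau> 5 Q)"
  proof (rule wp_For[where I = ?I and s = 10])
    fix c \<tau> assume c: "c < store ''g'' 0 0 \<sigma> ''h'' 0" "?I c \<tau>" "\<tau> ''c'' 0 = c"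
      and eq: "\<And>z. z \<notin> insert ''c'' (writes rows_entry) \<Longrightarrow> \<tau> z = store ''g'' 0 0 \<sigma> z"
    have "wp rows_entry \<tau> 10 (\<lambda>\<tau>'. P_upto h a (Suc i * h + Suc c) \<tau>' \<and>
        \<tau>' ''g'' 0 = (if X_power h a (Suc i) c = X_power h a 0 c then \<tau> ''g'' 0 else 1))"
      by (rule wp_rows_entry) (use c eq h b a tab in \<open>simp_all add: tables_ok_def\<close>)
    then show "wp rows_entry \<tau> 10 (\<lambda>\<tau>'. ?I (Suc c) (store ''c'' 0 (Suc c) \<tau>'))"
      by (rule wp_conseq) (use c in \<open>auto simp: less_Suc_eq simp del: X_power.simps\<close>)
  next
    fix \<tau> assume \<tau>: "?I (store ''g'' 0 0 \<sigma> ''h'' 0) \<tau>"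
      "\<And>z. z \<notin> insert ''c'' (writes rows_entry) \<Longrightarrow> \<tau> z = store ''g'' 0 0 \<sigma> z"
    have "Suc i * h + h = Suc (Suc i) * h" by simp
    then show "wp (Seq (Set_var ''b'' (Add (V ''b'') (V ''h'')))
      (Cond (BAnd (Less (Add (V ''i'') (Const 1)) (V ''cols'')) (Eq (V ''g'') (Const 0)))
        (Set_var ''ok'' (Const 0)) Skip)) \<tau> 5 Q"
      using \<tau> h by (intro fin) (auto simp: eqX simp del: X_power.simps mult_Suc)
  qed (use P h in \<open>auto simp del: X_power.simps\<close>)
  have "wp rows_step \<sigma> (14 * h + 20) Q"
    unfolding rows_step_def
    by (rule wp_mono, rule wp_Seq', rule wp_Assign', rule wp_Seq', unfold aval.simps, rule loop) simp
  then show ?thesis unfolding Q_def .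
qed

text \<open>The bound on \<open>n\<close> by \<open>E\<close> makes the table long enough for the
  test to reach all exponents below \<open>q^h - 1\<close>.\<close>

lemma wp_rows:
  assumes h: "\<sigma> ''h'' 0 = h" "h \<ge> 1" and n: "\<sigma> ''cols'' 0 = n" "n = CARD('a) ^ h - 1" "n \<le> Suc (\<sigma> ''E'' 0)"
    and a: "\<And>c. c < h \<Longrightarrow> \<sigma> ''a'' c = code (a c)" and tab: "tables_ok \<sigma>"
  shows "wp rows \<sigma> (\<sigma> ''E'' 0 * (14 * h + 24) + 5 * h + 20)
    (\<lambda>\<tau>. P_upto h a (Suc (\<sigma> ''E'' 0) * h) \<tau> \<and> \<tau> ''ok'' 0 = (if primitive_coeffs h a then 1 else 0))"
proof -
  let ?E = "\<sigma> ''E'' 0"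
  define ok where "ok i \<longleftrightarrow> a 0 \<noteq> 0 \<and> (\<forall>l. 1 \<le> l \<and> l \<le> i \<and> l < n \<longrightarrow> X_power h a l \<noteq> X_power h a 0)" for i
  define Q where "Q = (\<lambda>\<tau>. P_upto h a (Suc ?E * h) \<tau> \<and> \<tau> ''ok'' 0 = (if primitive_coeffs h a then 1 else 0))"
  have okE: "ok ?E \<longleftrightarrow> primitive_coeffs h a"
    using n(2,3) by (auto simp: ok_def primitive_coeffs_def)
  let ?I = "\<lambda>i \<tau>. P_upto h a (Suc i * h) \<tau> \<and> \<tau> ''b'' 0 = i * h \<and> \<tau> ''ok'' 0 = (if ok i then 1 else 0)"
  have loop: "wp (For ''i'' ''E'' rows_step) \<tau> (?E * (14 * h + 24) + 3) Q"
    if P: "P_upto h a h \<tau>" and b: "\<tau> ''b'' 0 = 0" and ok0: "\<tau> ''ok'' 0 = (if a 0 = 0 then 0 else 1)"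
      and eq: "\<And>z. z \<notin> {''ok'', ''c'', ''P'', ''b''} \<Longrightarrow> \<tau> z = \<sigma> z" for \<tau>
  proof (rule wp_For[where I = ?I and s = "14 * h + 20"])
    fix i \<rho> assume i: "i < \<tau> ''E'' 0" "?I i \<rho>" "\<rho> ''i'' 0 = i"
      and eq': "\<And>z. z \<notin> insert ''i'' (writes rows_step) \<Longrightarrow> \<rho> z = \<tau> z"
    have "wp rows_step \<rho> (14 * h + 20) (\<lambda>\<tau>. P_upto h a (Suc (Suc i) * h) \<tau> \<and> \<tau> ''b'' 0 = Suc i * h \<and>
      \<tau> ''ok'' 0 = (if Suc i < n \<and> X_power h a (Suc i) = X_power h a 0 then 0 else \<rho> ''ok'' 0))"
      by (rule wp_rows_step) (use i eq' eq h n a tab in \<open>auto simp: tables_ok_def\<close>)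
    then show "wp rows_step \<rho> (14 * h + 20) (\<lambda>\<tau>. ?I (Suc i) (store ''i'' 0 (Suc i) \<tau>))"
    proof (rule wp_conseq)
      fix \<tau>
      assume "P_upto h a (Suc (Suc i) * h) \<tau> \<and> \<tau> ''b'' 0 = Suc i * h \<and>
        \<tau> ''ok'' 0 = (if Suc i < n \<and> X_power h a (Suc i) = X_power h a 0 then 0 else \<rho> ''ok'' 0)"
      moreover have "ok (Suc i) \<longleftrightarrow> ok i \<and> \<not> (Suc i < n \<and> X_power h a (Suc i) = X_power h a 0)"
        by (auto simp: ok_def le_Suc_eq simp del: X_power.simps)
      ultimately show "?I (Suc i) (store ''i'' 0 (Suc i) \<tau>)"
        using i(2) by (auto simp del: X_power.simps)
    qed simp
  next
    show "?I 0 (store ''i'' 0 0 \<tau>)"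
      using P b ok0 by (auto simp: ok_def)
  qed (use eq okE in \<open>auto simp: Q_def\<close>)
  have init: "wp (Seq (For ''c'' ''h'' (Assign ''P'' (V ''c'') (Const (code 0))))
     (Seq (Assign ''P'' (Const 0) (Const (code 1)))
     (Seq (Set_var ''b'' (Const 0)) (For ''i'' ''E'' rows_step)))) \<tau> (?E * (14 * h + 24) + 5 * h + 15) Q"
    if ok0: "\<tau> ''ok'' 0 = (if a 0 = 0 then 0 else 1)" and eq: "\<And>z. z \<noteq> ''ok'' \<Longrightarrow> \<tau> z = \<sigma> z" for \<tau>
  proof (rule wp_mono, rule wp_Seq', rule wp_For[where I = "\<lambda>c \<tau>. \<forall>c'<c. \<tau> ''P'' c' = code 0" and s = 1 and t = "5 * h + 3"])
    fix c \<rho> assume "\<forall>c'<c. \<rho> ''P'' c' = code 0" "\<rho> ''c'' 0 = c"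
    then show "wp (Assign ''P'' (V ''c'') (Const (code 0))) \<rho> 1
      (\<lambda>\<tau>'. \<forall>c'<Suc c. store ''c'' 0 (Suc c) \<tau>' ''P'' c' = code 0)"
      by (intro wp_Assign) (auto simp: less_Suc_eq)
  next
    fix \<rho> assume \<rho>: "\<forall>c'<\<tau> ''h'' 0. \<rho> ''P'' c' = code 0"
      "\<And>z. z \<notin> insert ''c'' (writes (Assign ''P'' (V ''c'') (Const (code 0)))) \<Longrightarrow> \<rho> z = \<tau> z"
    show "wp (Seq (Assign ''P'' (Const 0) (Const (code 1)))
     (Seq (Set_var ''b'' (Const 0)) (For ''i'' ''E'' rows_step))) \<rho> (?E * (14 * h + 24) + 7) Q"
    proof (rule wp_mono, rule wp_Seq', rule wp_Assign', rule wp_Seq', rule wp_Assign', rule loop)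
      have "\<tau> ''h'' 0 = h" using eq h by simp
      then show "P_upto h a h (store ''b'' (aval (Const 0) (store ''P'' (aval (Const 0) \<rho>) (aval (Const (code 1)) \<rho>) \<rho>))
        (aval (Const 0) (store ''P'' (aval (Const 0) \<rho>) (aval (Const (code 1)) \<rho>) \<rho>))
        (store ''P'' (aval (Const 0) \<rho>) (aval (Const (code 1)) \<rho>) \<rho>))"
        using \<rho>(1) by (auto simp: P_upto_def)
    qed (use \<rho> eq ok0 in auto)
  qed (use eq h in auto)
  have "wp rows \<sigma> (?E * (14 * h + 24) + 5 * h + 20) Q"
    unfolding rows_def
    by (rule wp_mono, rule wp_Seq', rule wp_Cond'; (rule wp_Assign', rule init)?)
      (use a[of 0] h in auto)
  then show ?thesis unfolding Q_def .
qed

end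

section \<open>Search for a primitive polynomial\<close>

lemma digits_exist:
  fixes q :: nat
  assumes "\<And>c. f c < q"
  shows "\<exists>N<q ^ h. \<forall>c<h. N div q ^ c mod q = f c"
  using assms
proof (induction h arbitrary: f)
  case (Suc h)
  obtain N where N: "N < q ^ h" "\<forall>c<h. N div q ^ c mod q = f (Suc c)"
    using Suc.IH[of "\<lambda>c. f (Suc c)"] Suc.prems by auto
  have f0: "f 0 < q" by (rule Suc.prems)
  show ?case
  proof (intro exI[of _ "N * q + f 0"] conjI allI impI)
    have "N * q + f 0 < Suc N * q" using f0 by simp
    also have "\<dots> \<le> q ^ h * q" using N(1) by (intro mult_le_mono1) simp
    finally show "N * q + f 0 < q ^ Suc h" by (simp add: mult.commute)
    fix c assume "c < Suc h"
    then show "(N * q + f 0) div q ^ c mod q = f c"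
      using N(2) f0 by (cases c) (auto simp: div_mult2_eq)
  qed
qed auto

text \<open>The carry rule of the base-\<open>q\<close> counter: passing from \<open>N\<close> to
  \<open>N + 1\<close>, a carry leaves digit \<open>c\<close> exactly when the lowest
  \<open>c + 1\<close> digits of \<open>N + 1\<close> are zero.\<close>

lemma Suc_mod_power_eq_0:
  fixes q :: nat
  shows "Suc N mod q ^ Suc c = 0 \<longleftrightarrow> Suc N mod q ^ c = 0 \<and> Suc N div q ^ c mod q = 0"
proof (cases "q = 0")
  case False
  have "Suc N mod q ^ Suc c = Suc N mod (q ^ c * q)"
    by (simp add: mult.commute)
  also have "\<dots> = q ^ c * (Suc N div q ^ c mod q) + Suc N mod q ^ c"
    by (rule mod_mult2_eq)
  finally show ?thesis using False by auto
qed (cases c; simp)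

context field_code
begin

definition incr_digit :: com where
  "incr_digit = Seq (Assign ''a'' (V ''c'') (Add (Cell ''a'' (V ''c'')) (V ''y'')))
     (Cond (Less (Cell ''a'' (V ''c'')) (Const q)) (Set_var ''y'' (Const 0))
       (Seq (Assign ''a'' (V ''c'') (Const 0)) (Set_var ''y'' (Const 1))))"

definition incr :: com where
  "incr = Seq (Set_var ''y'' (Const 1)) (Seq (For ''c'' ''h'' incr_digit)
     (Set_var ''N'' (Add (V ''N'') (Const 1))))"

lemma writes_incr_digit [simp]: "writes incr_digit = {''a'', ''y''}"
  by (auto simp: incr_digit_def)

lemma writes_incr [simp]: "writes incr = {''a'', ''y'', ''c'', ''N''}"
  by (auto simp: incr_def)

lemma wp_incr_digit:
  assumes c: "\<sigma> ''c'' 0 = c" and a: "\<sigma> ''a'' c = N div q ^ c mod q"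
    and y: "\<sigma> ''y'' 0 = (if Suc N mod q ^ c = 0 then 1 else 0)"
  shows "wp incr_digit \<sigma> 7 (\<lambda>\<tau>. \<tau> ''a'' = (\<sigma> ''a'')(c := Suc N div q ^ c mod q) \<and>
    \<tau> ''y'' 0 = (if Suc N mod q ^ Suc c = 0 then 1 else 0))"
proof -
  let ?s = "\<sigma> ''a'' c + \<sigma> ''y'' 0"
  have q: "q > 0" using q_gt_1 by simp
  have digit: "Suc N div q ^ c mod q = (if ?s < q then ?s else 0)"
  proof -
    have "Suc N div q ^ c = N div q ^ c + \<sigma> ''y'' 0" using y by (simp add: div_Suc)
    then have *: "Suc N div q ^ c mod q = ?s mod q" using a by (simp add: mod_add_left_eq)
    have "N div q ^ c mod q < q" using q by simp
    then have "?s \<le> q" using a y by (simp add: Suc_leI)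
    then show ?thesis unfolding * by (cases "?s = q") auto
  qed
  have carry: "Suc N mod q ^ Suc c = 0 \<longleftrightarrow> \<not> ?s < q"
  proof -
    have "\<sigma> ''a'' c < q" using a q by simp
    then show ?thesis
      using y unfolding Suc_mod_power_eq_0 digit by (auto split: if_splits)
  qed
  show ?thesis
    unfolding incr_digit_def
    by (rule wp_mono, rule wp_Seq', rule wp_Assign', rule wp_Cond', rule wp_Assign', rule_tac[2] wp_Seq',
        rule_tac[2] wp_Assign', rule_tac[2] wp_Assign')
      (use c digit carry in auto)
qed

lemma wp_incr:
  assumes h: "\<sigma> ''h'' 0 = h" and N: "\<sigma> ''N'' 0 = N"
    and a: "\<And>c. c < h \<Longrightarrow> \<sigma> ''a'' c = N div q ^ c mod q"
  shows "wp incr \<sigma> (11 * h + 7) (\<lambda>\<tau>. \<tau> ''N'' 0 = Suc N \<and> (\<forall>c<h. \<tau> ''a'' c = Suc N div q ^ c mod q))"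
proof -
  let ?I = "\<lambda>c \<tau>. (\<forall>c'<h. \<tau> ''a'' c' = (if c' < c then Suc N else N) div q ^ c' mod q) \<and>
    \<tau> ''y'' 0 = (if Suc N mod q ^ c = 0 then 1 else 0)"
  show ?thesis
    unfolding incr_def
  proof (rule wp_mono, rule wp_Seq', rule wp_Assign', rule wp_Seq',
      rule wp_For[where I = ?I and s = 7 and t = "11 * h + 3"])
    let ?\<sigma> = "store ''y'' (aval (Const 0) \<sigma>) (aval (Const 1) \<sigma>) \<sigma>"
    fix c \<tau> assume c: "c < ?\<sigma> ''h'' 0" "?I c \<tau>" "\<tau> ''c'' 0 = c"
    then have ch: "c < h" using h by simp
    show "wp incr_digit \<tau> 7 (\<lambda>\<tau>'. ?I (Suc c) (store ''c'' 0 (Suc c) \<tau>'))"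
    proof (rule wp_conseq[OF wp_incr_digit[where \<sigma> = \<tau> and c = c and N = N]])
      fix \<tau>' assume "\<tau>' ''a'' = (\<tau> ''a'')(c := Suc N div q ^ c mod q) \<and>
        \<tau>' ''y'' 0 = (if Suc N mod q ^ Suc c = 0 then 1 else 0)"
      then show "?I (Suc c) (store ''c'' 0 (Suc c) \<tau>')"
        using c(2) by (auto simp: less_Suc_eq)
    qed (use c ch in auto)
  next
    fix \<tau> assume "?I (store ''y'' (aval (Const 0) \<sigma>) (aval (Const 1) \<sigma>) \<sigma> ''h'' 0) \<tau>"
      "\<And>z. z \<notin> insert ''c'' (writes incr_digit) \<Longrightarrow>
        \<tau> z = store ''y'' (aval (Const 0) \<sigma>) (aval (Const 1) \<sigma>) \<sigma> z"
    then show "wp (Set_var ''N'' (Add (V ''N'') (Const 1))) \<tau> 1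
      (\<lambda>\<tau>. \<tau> ''N'' 0 = Suc N \<and> (\<forall>c<h. \<tau> ''a'' c = Suc N div q ^ c mod q))"
      using h N by (intro wp_Assign) auto
  qed (use h a in auto)
qed

text \<open>Candidates are enumerated as numbers whose base-\<open>q\<close> digits are the codes of
  the coefficients, so every vector of length \<open>h\<close> is reached whatever the
  encoding.\<close>

definition digit_coeffs :: "nat \<Rightarrow> nat \<Rightarrow> 'a" where
  "digit_coeffs N c = dec (N div q ^ c mod q)"

lemma code_digit_coeffs: "code (digit_coeffs N c) = N div q ^ c mod q"
  using q_gt_1 by (simp add: digit_coeffs_def)

definition search :: com where
  "search = Seq rows (While (Eq (V ''ok'') (Const 0)) (Seq incr rows))"

lemma writes_search [simp]:
  "writes search = {''z'', ''P'', ''g'', ''c'', ''b'', ''ok'', ''i'', ''a'', ''y'', ''N''}"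
  by (auto simp: search_def)

text \<open>Cells that are all \<open>0\<close> form the digit expansion of the candidate
  \<open>N = 0\<close>. The measure is the distance to the number \<open>M\<close> of some primitive
  vector: the invariant keeps \<open>N \<le> M\<close>, and a failed test excludes
  \<open>N = M\<close>, so there are fewer than \<open>q^h\<close> increments.\<close>

lemma wp_search:
  assumes h: "\<sigma> ''h'' 0 = h" "h \<ge> 1" and n: "\<sigma> ''cols'' 0 = CARD('a) ^ h - 1" "\<sigma> ''cols'' 0 \<le> Suc (\<sigma> ''E'' 0)"
    and a: "\<And>c. c < h \<Longrightarrow> \<sigma> ''a'' c = 0" and N: "\<sigma> ''N'' 0 = 0" and tab: "tables_ok \<sigma>"
  shows "wp search \<sigma> ((q ^ h + 1) * (\<sigma> ''E'' 0 * (14 * h + 24) + 16 * h + 40))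
    (\<lambda>\<tau>. \<exists>a. primitive_coeffs h a \<and> P_upto h a (Suc (\<sigma> ''E'' 0) * h) \<tau>)"
proof -
  let ?E = "\<sigma> ''E'' 0"
  define R where "R = ?E * (14 * h + 24) + 5 * h + 20"
  obtain a' :: "nat \<Rightarrow> 'a" where a': "primitive_coeffs h a'"
    using primitive_coeffs_exist[OF h(2)] by blast
  obtain M where M: "M < q ^ h" "\<forall>c<h. M div q ^ c mod q = code (a' c)"
    using digits_exist[of "\<lambda>c. code (a' c)" q h] by auto
  have "digit_coeffs M c = a' c" if "c < h" for c
    using M that by (simp add: digit_coeffs_def)
  then have prim_M: "primitive_coeffs h (digit_coeffs M)"
    using primitive_coeffs_cong[OF h(2)] a' by blast
  define J where "J = (\<lambda>\<tau>. (\<forall>z\<in>{''h'', ''cols'', ''E'', ''add'', ''mul''}. \<tau> z = \<sigma> z) \<and> \<tau> ''N'' 0 \<le> M \<and>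
    (\<forall>c<h. \<tau> ''a'' c = \<tau> ''N'' 0 div q ^ c mod q) \<and> P_upto h (digit_coeffs (\<tau> ''N'' 0)) (Suc ?E * h) \<tau> \<and>
    \<tau> ''ok'' 0 = (if primitive_coeffs h (digit_coeffs (\<tau> ''N'' 0)) then 1 else 0))"
  have rows: "wp rows \<tau> R J"
    if eq: "\<And>z. z \<in> {''h'', ''cols'', ''E'', ''add'', ''mul''} \<Longrightarrow> \<tau> z = \<sigma> z" and N': "\<tau> ''N'' 0 \<le> M"
      and a': "\<And>c. c < h \<Longrightarrow> \<tau> ''a'' c = \<tau> ''N'' 0 div q ^ c mod q" for \<tau>
  proof (rule wp_conseq[OF wp_rows[where a = "digit_coeffs (\<tau> ''N'' 0)" and h = h]])
    show "\<tau> ''E'' 0 * (14 * h + 24) + 5 * h + 20 \<le> R" using eq by (simp add: R_def)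
    have "tables_ok \<tau> = tables_ok \<sigma>" by (rule tables_ok_cong) (use eq in auto)
    then show "tables_ok \<tau>" using tab by simp
    fix \<rho> assume \<rho>: "P_upto h (digit_coeffs (\<tau> ''N'' 0)) (Suc (\<tau> ''E'' 0) * h) \<rho> \<and>
      \<rho> ''ok'' 0 = (if primitive_coeffs h (digit_coeffs (\<tau> ''N'' 0)) then 1 else 0)"
      "\<And>x. x \<notin> writes rows \<Longrightarrow> \<rho> x = \<tau> x"
    have "\<rho> ''N'' = \<tau> ''N''" "\<rho> ''a'' = \<tau> ''a''" using \<rho>(2) by auto
    moreover have "\<forall>z\<in>{''h'', ''cols'', ''E'', ''add'', ''mul''}. \<rho> z = \<sigma> z" using eq \<rho>(2) by simp
    moreover have "\<tau> ''E'' = \<sigma> ''E''" using eq by simp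
    ultimately show "J \<rho>" using N' a' \<rho>(1) by (simp add: J_def)
  qed (use eq h n a' in \<open>auto simp: code_digit_coeffs\<close>)
  have loop: "wp (While (Eq (V ''ok'') (Const 0)) (Seq incr rows)) \<tau> (q ^ h * (11 * h + 7 + R + 3) + 1)
      (\<lambda>\<tau>. \<exists>a. primitive_coeffs h a \<and> P_upto h a (Suc ?E * h) \<tau>)" if "J \<tau>" for \<tau>
  proof (rule wp_While[where I = J and f = "\<lambda>\<tau>. M - \<tau> ''N'' 0" and s = "11 * h + 7 + R + 1"])
    fix \<rho> assume \<rho>: "J \<rho>" "bval (Eq (V ''ok'') (Const 0)) \<rho>"
    then have "\<not> primitive_coeffs h (digit_coeffs (\<rho> ''N'' 0))" by (auto simp: J_def split: if_splits)
    then have lt: "\<rho> ''N'' 0 < M" using \<rho>(1) prim_M by (cases "\<rho> ''N'' 0 = M") (auto simp: J_def)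
    show "wp (Seq incr rows) \<rho> (11 * h + 7 + R + 1) (\<lambda>\<tau>'. J \<tau>' \<and> M - \<tau>' ''N'' 0 < M - \<rho> ''N'' 0)"
    proof (rule wp_Seq'[OF wp_conseq[OF wp_incr[where h = h and N = "\<rho> ''N'' 0"] _ order.refl]])
      fix \<tau>' assume \<tau>': "\<tau>' ''N'' 0 = Suc (\<rho> ''N'' 0) \<and> (\<forall>c<h. \<tau>' ''a'' c = Suc (\<rho> ''N'' 0) div q ^ c mod q)"
        "\<And>x. x \<notin> writes incr \<Longrightarrow> \<tau>' x = \<rho> x"
      have "wp rows \<tau>' R J"
      proof (rule rows)
        have J: "\<forall>z\<in>{''h'', ''cols'', ''E'', ''add'', ''mul''}. \<rho> z = \<sigma> z"
          using \<rho>(1) by (simp add: J_def)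
        fix z :: string assume z: "z \<in> {''h'', ''cols'', ''E'', ''add'', ''mul''}"
        then have "z \<notin> writes incr" by auto
        then have "\<tau>' z = \<rho> z" by (rule \<tau>'(2))
        also have "\<dots> = \<sigma> z" using J z by (rule bspec)
        finally show "\<tau>' z = \<sigma> z" .
      qed (use \<tau>'(1) lt in simp_all)
      then show "wp rows \<tau>' R (\<lambda>\<tau>'. J \<tau>' \<and> M - \<tau>' ''N'' 0 < M - \<rho> ''N'' 0)"
      proof (rule wp_conseq)
        fix \<tau>'' assume *: "J \<tau>''" "\<And>x. x \<notin> writes rows \<Longrightarrow> \<tau>'' x = \<tau>' x"
        have "\<tau>'' ''N'' = \<tau>' ''N''" by (rule *(2)) simp
        then show "J \<tau>'' \<and> M - \<tau>'' ''N'' 0 < M - \<rho> ''N'' 0" using *(1) \<tau>'(1) lt by simp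
      qed simp
    next
      have "\<rho> ''h'' = \<sigma> ''h''" using \<rho>(1) by (simp add: J_def)
      then show "\<rho> ''h'' 0 = h" using h by simp
      show "\<rho> ''a'' c = \<rho> ''N'' 0 div q ^ c mod q" if "c < h" for c
        using \<rho>(1) that by (simp add: J_def)
    qed simp
  next
    fix \<rho> assume "J \<rho>" "\<not> bval (Eq (V ''ok'') (Const 0)) \<rho>"
    then show "\<exists>a. primitive_coeffs h a \<and> P_upto h a (Suc ?E * h) \<rho>"
      by (auto simp: J_def split: if_splits)
  next
    have "M - \<tau> ''N'' 0 \<le> q ^ h" using M by simp
    then have "(M - \<tau> ''N'' 0) * (11 * h + 7 + R + 3) \<le> q ^ h * (11 * h + 7 + R + 3)"
      by (rule mult_le_mono1)
    moreover have "11 * h + 7 + R + 1 + 2 = 11 * h + 7 + R + 3" by simp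
    ultimately show "(M - \<tau> ''N'' 0) * (11 * h + 7 + R + 1 + 2) + 1 \<le> q ^ h * (11 * h + 7 + R + 3) + 1"
      by simp
  qed (rule that)
  show ?thesis
    unfolding search_def
  proof (rule wp_mono, rule wp_Seq'[OF wp_conseq[OF rows loop order.refl]])
    have "R + (q ^ h * (11 * h + 7 + R + 3) + 1) + 1 \<le> R + 2 + q ^ h * (R + 11 * h + 20)"
      by (simp add: algebra_simps)
    also have "\<dots> \<le> (q ^ h + 1) * (R + 11 * h + 20)"
      by (simp add: add_mult_distrib)
    also have "R + 11 * h + 20 = ?E * (14 * h + 24) + 16 * h + 40" by (simp add: R_def)
    finally show "R + (q ^ h * (11 * h + 7 + R + 3) + 1) + 1 \<le> (q ^ h + 1) * (?E * (14 * h + 24) + 16 * h + 40)" .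
  qed (use N a in auto)
qed

end

section \<open>Random supports and the sizes of the code\<close>

text \<open>The random support has one position in each of \<open>w\<close> blocks of length \<open>2\<^sup>t\<close>: fair coins sample
  it exactly uniformly. Block \<open>u\<close> reads the bits \<open>u * t, \<dots>, u * t + t - 1\<close>.\<close>
primrec pos :: "nat \<Rightarrow> bool list \<Rightarrow> nat \<Rightarrow> nat \<Rightarrow> nat" where
  "pos t bs u 0 = u"
| "pos t bs u (Suc v) = 2 * pos t bs u v + of_bool (bs ! (u * t + v))"

definition mark_step :: com where
  "mark_step = Seq (Set_var ''x'' (Add (Add (V ''x'') (V ''x'')) (Cell ''R'' (V ''f''))))
     (Set_var ''f'' (Add (V ''f'') (Const 1)))"

definition mark :: com where
  "mark = Seq (Set_var ''x'' (V ''u'')) (Seq (For ''v'' ''t'' mark_step) (Assign ''M'' (V ''x'') (Const 1)))"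

definition marks :: com where
  "marks = Seq (Set_var ''f'' (Const 0)) (For ''u'' ''w'' mark)"

lemma writes_mark_step [simp]: "writes mark_step = {''x'', ''f''}"
  by (auto simp: mark_step_def)

lemma writes_mark [simp]: "writes mark = {''x'', ''f'', ''v'', ''M''}"
  by (auto simp: mark_def)

lemma writes_marks [simp]: "writes marks = {''x'', ''f'', ''v'', ''M'', ''u''}"
  by (auto simp: marks_def)

lemma wp_mark:
  assumes u: "\<sigma> ''u'' 0 = u" and t: "\<sigma> ''t'' 0 = t" and f: "\<sigma> ''f'' 0 = u * t"
    and R: "\<And>v. v < t \<Longrightarrow> \<sigma> ''R'' (u * t + v) = of_bool (bs ! (u * t + v))"
  shows "wp mark \<sigma> (7 * t + 7) (\<lambda>\<tau>. \<tau> ''f'' 0 = Suc u * t \<and> \<tau> ''M'' = (\<sigma> ''M'')(pos t bs u t := 1))"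
  unfolding mark_def
proof (rule wp_mono, rule wp_Seq', rule wp_Assign', rule wp_Seq',
    rule wp_For[where I = "\<lambda>v \<tau>. \<tau> ''x'' 0 = pos t bs u v \<and> \<tau> ''f'' 0 = u * t + v" and s = 3 and t = "7 * t + 3"])
  let ?\<sigma> = "store ''x'' (aval (Const 0) \<sigma>) (aval (V ''u'') \<sigma>) \<sigma>"
  fix v \<tau> assume v: "v < ?\<sigma> ''t'' 0" "\<tau> ''x'' 0 = pos t bs u v \<and> \<tau> ''f'' 0 = u * t + v"
    and eq: "\<And>z. z \<notin> insert ''v'' (writes mark_step) \<Longrightarrow> \<tau> z = ?\<sigma> z"
  have "\<tau> ''R'' = \<sigma> ''R''" using eq by simp
  then have "\<tau> ''R'' (u * t + v) = of_bool (bs ! (u * t + v))" using R v t by simp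
  then show "wp mark_step \<tau> 3 (\<lambda>\<tau>'. store ''v'' 0 (Suc v) \<tau>' ''x'' 0 = pos t bs u (Suc v) \<and>
      store ''v'' 0 (Suc v) \<tau>' ''f'' 0 = u * t + Suc v)"
    unfolding mark_step_def by (intro wp_mono[OF wp_Seq'[OF wp_Assign'[OF wp_Assign']]]) (use v in auto)
next
  let ?\<sigma> = "store ''x'' (aval (Const 0) \<sigma>) (aval (V ''u'') \<sigma>) \<sigma>"
  fix \<tau> assume *: "\<tau> ''x'' 0 = pos t bs u (?\<sigma> ''t'' 0) \<and> \<tau> ''f'' 0 = u * t + ?\<sigma> ''t'' 0"
    and eq: "\<And>z. z \<notin> insert ''v'' (writes mark_step) \<Longrightarrow> \<tau> z = ?\<sigma> z"
  have "\<tau> ''M'' = \<sigma> ''M''" using eq by simp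
  then show "wp (Assign ''M'' (V ''x'') (Const 1)) \<tau> 1
    (\<lambda>\<tau>. \<tau> ''f'' 0 = Suc u * t \<and> \<tau> ''M'' = (\<sigma> ''M'')(pos t bs u t := 1))"
    using * t by (intro wp_Assign) auto
qed (use u t f in auto)

lemma wp_marks:
  assumes w: "\<sigma> ''w'' 0 = w" and t: "\<sigma> ''t'' 0 = t"
    and R: "\<And>i. i < w * t \<Longrightarrow> \<sigma> ''R'' i = of_bool (bs ! i)" and M: "\<And>j. \<sigma> ''M'' j = 0"
  shows "wp marks \<sigma> (w * (7 * t + 11) + 5) (\<lambda>\<tau>. \<forall>j. \<tau> ''M'' j = of_bool (\<exists>u<w. j = pos t bs u t))"
  unfolding marks_def
proof (rule wp_mono, rule wp_Seq', rule wp_Assign',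
    rule wp_For[where I = "\<lambda>u \<tau>. \<tau> ''f'' 0 = u * t \<and> (\<forall>j. \<tau> ''M'' j = of_bool (\<exists>u'<u. j = pos t bs u' t))"
      and s = "7 * t + 7" and t = "w * (7 * t + 11) + 3"])
  let ?\<sigma> = "store ''f'' (aval (Const 0) \<sigma>) (aval (Const 0) \<sigma>) \<sigma>"
  fix u \<tau> assume u: "u < ?\<sigma> ''w'' 0" "\<tau> ''u'' 0 = u"
    and I: "\<tau> ''f'' 0 = u * t \<and> (\<forall>j. \<tau> ''M'' j = of_bool (\<exists>u'<u. j = pos t bs u' t))"
    and eq: "\<And>z. z \<notin> insert ''u'' (writes mark) \<Longrightarrow> \<tau> z = ?\<sigma> z"
  have eqs: "\<tau> ''R'' = \<sigma> ''R''" "\<tau> ''t'' = \<sigma> ''t''" using eq by simp_all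
  have "u * t + v < w * t" if "v < t" for v
  proof -
    have "u * t + v < Suc u * t" using that by simp
    also have "\<dots> \<le> w * t" using u w by (intro mult_le_mono1) simp
    finally show ?thesis .
  qed
  then have "wp mark \<tau> (7 * t + 7) (\<lambda>\<tau>'. \<tau>' ''f'' 0 = Suc u * t \<and> \<tau>' ''M'' = (\<tau> ''M'')(pos t bs u t := 1))"
    by (intro wp_mark) (use u I eqs t R in auto)
  then show "wp mark \<tau> (7 * t + 7) (\<lambda>\<tau>'. store ''u'' 0 (Suc u) \<tau>' ''f'' 0 = Suc u * t \<and>
      (\<forall>j. store ''u'' 0 (Suc u) \<tau>' ''M'' j = of_bool (\<exists>u'<Suc u. j = pos t bs u' t)))"
    by (rule wp_conseq) (use I in \<open>auto simp: less_Suc_eq\<close>)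
qed (use w M in auto)

text \<open>The extension degree is \<open>h = 30 q l\<close>, where \<open>l\<close> is the bit length of \<open>m\<close>: then \<open>q\<^sup>h\<close> is polynomial
  in \<open>m\<close>, but at least \<open>(8 q m)\<^bsup>6q\<^esup>\<close>, which is what the counting of syndromes needs.\<close>
definition sizes :: "nat \<Rightarrow> com" where
  "sizes q = Seq (Set_var ''p'' (Const 1)) (Seq (Set_var ''n'' (Const 1)) (Seq (Set_var ''h'' (Const 0))
     (While (BNot (Less (V ''m'') (V ''p''))) (Seq (Set_var ''p'' (Add (V ''p'') (V ''p'')))
       (Seq (Set_var ''n'' (times_const (q ^ (30 * q)) (V ''n''))) (Set_var ''h'' (Add (V ''h'') (Const (30 * q)))))))))"

lemma writes_sizes [simp]: "writes (sizes q) = {''p'', ''n'', ''h''}"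
  by (auto simp: sizes_def)

text \<open>Doubling \<open>p\<close> while multiplying \<open>n\<close> by a constant computes
  \<open>q^h\<close> with additions alone. Of the bounds on \<open>l\<close>, \<open>m < 2^l\<close>
  makes \<open>q^h\<close> large and \<open>2^(l-1) \<le> m\<close> keeps it polynomial in
  \<open>m\<close>.\<close>

lemma wp_sizes:
  assumes m: "\<sigma> ''m'' 0 = m" "m \<ge> 1"
  shows "wp (sizes q) \<sigma> (7 * m + 10) (\<lambda>\<tau>. \<exists>l\<ge>1. m < 2 ^ l \<and> 2 ^ (l - 1) \<le> m \<and>
    \<tau> ''h'' 0 = 30 * q * l \<and> \<tau> ''n'' 0 = q ^ (30 * q * l))"
proof -
  define J where "J = (\<lambda>\<tau> :: memory. \<tau> ''m'' 0 = m \<and> (\<exists>l. \<tau> ''p'' 0 = 2 ^ l \<and> \<tau> ''h'' 0 = 30 * q * l \<and>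
    \<tau> ''n'' 0 = q ^ (30 * q * l) \<and> (l = 0 \<or> 2 ^ (l - 1) \<le> m)))"
  show ?thesis
    unfolding sizes_def
  proof (rule wp_mono, rule wp_Seq', rule wp_Assign', rule wp_Seq', rule wp_Assign', rule wp_Seq', rule wp_Assign',
      rule wp_While[where I = J and f = "\<lambda>\<tau>. m + 1 - \<tau> ''p'' 0" and s = 5 and t = "7 * m + 1"])
    fix \<tau> :: memory assume \<tau>: "J \<tau>" "bval (BNot (Less (V ''m'') (V ''p''))) \<tau>"
    then obtain l where l: "\<tau> ''m'' 0 = m" "\<tau> ''p'' 0 = 2 ^ l" "\<tau> ''h'' 0 = 30 * q * l" "\<tau> ''n'' 0 = q ^ (30 * q * l)"
      by (auto simp: J_def)
    have le: "2 ^ l \<le> m" using \<tau>(2) l by simp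
    have "(1::nat) \<le> 2 ^ l" by simp
    then have dec: "m + 1 - (2 ^ l + 2 ^ l) < m + 1 - 2 ^ l" using le by linarith
    show "wp (Seq (Set_var ''p'' (Add (V ''p'') (V ''p'')))
       (Seq (Set_var ''n'' (times_const (q ^ (30 * q)) (V ''n''))) (Set_var ''h'' (Add (V ''h'') (Const (30 * q))))))
       \<tau> 5 (\<lambda>\<tau>'. J \<tau>' \<and> m + 1 - \<tau>' ''p'' 0 < m + 1 - \<tau> ''p'' 0)"
      by (rule wp_mono[OF wp_Seq'[OF wp_Assign'[OF wp_Seq'[OF wp_Assign'[OF wp_Assign']]]]], rule conjI,
          unfold J_def, intro conjI exI[of _ "Suc l"]) (use dec l le in \<open>auto simp: power_add\<close>)
  next
    fix \<tau> :: memory assume \<tau>: "J \<tau>" "\<not> bval (BNot (Less (V ''m'') (V ''p''))) \<tau>"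
    then obtain l where l: "\<tau> ''m'' 0 = m" "\<tau> ''p'' 0 = 2 ^ l" "\<tau> ''h'' 0 = 30 * q * l" "\<tau> ''n'' 0 = q ^ (30 * q * l)"
      "l = 0 \<or> 2 ^ (l - 1) \<le> m"
      by (auto simp: J_def)
    then have "m < 2 ^ l" using \<tau>(2) by simp
    moreover from this have "l \<ge> 1" using m(2) by (cases l) auto
    ultimately show "\<exists>l\<ge>1. m < 2 ^ l \<and> 2 ^ (l - 1) \<le> m \<and> \<tau> ''h'' 0 = 30 * q * l \<and> \<tau> ''n'' 0 = q ^ (30 * q * l)"
      using l by (intro exI[of _ l]) auto
  qed (use m in \<open>auto simp: J_def intro!: exI[of _ "0::nat"]\<close>)
qed

text \<open>Here \<open>n\<close> is \<open>q^h\<close>, and the length of the BCH code goes to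
  \<open>cols\<close>. Doubling \<open>B = w 2^t\<close> while it stays below \<open>q^h\<close>
  makes the blocks fit and still cover at least half of \<open>q^h\<close>. If the loop is never
  entered, fitting has to come from \<open>w \<le> d < q^h\<close>.\<close>

definition blocks :: "nat \<Rightarrow> com" where
  "blocks q = Seq (Set_var ''d'' (times_const (4 * q) (V ''k''))) (Seq (Set_var ''w'' (times_const (4 * q - 2) (V ''k'')))
     (Seq (Set_var ''B'' (V ''w'')) (Seq (Set_var ''t'' (Const 0))
     (Seq (While (Less (Add (V ''B'') (V ''B'')) (V ''n''))
       (Seq (Set_var ''B'' (Add (V ''B'') (V ''B''))) (Set_var ''t'' (Add (V ''t'') (Const 1)))))
     (Set_var ''cols'' (Sub (V ''n'') (Const 1)))))))"

lemma writes_blocks [simp]: "writes (blocks q) = {''d'', ''w'', ''B'', ''t'', ''cols''}"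
  by (auto simp: blocks_def)

lemma wp_blocks:
  assumes k: "\<sigma> ''k'' 0 = k" "k \<ge> 1" and n: "\<sigma> ''n'' 0 = n" and q: "q \<ge> 1"
  shows "wp (blocks q) \<sigma> (5 * n + 12) (\<lambda>\<tau>. \<tau> ''d'' 0 = 4 * q * k \<and> \<tau> ''w'' 0 = (4 * q - 2) * k \<and>
    \<tau> ''cols'' 0 = n - 1 \<and> (let t = \<tau> ''t'' 0; b = (4 * q - 2) * k * 2 ^ t in n \<le> 2 * b \<and> (t = 0 \<or> b < n)))"
proof -
  let ?w = "(4 * q - 2) * k"
  have w: "?w \<ge> 1" using k q by simp
  define J where "J = (\<lambda>\<tau> :: memory. \<tau> ''n'' 0 = n \<and> \<tau> ''d'' 0 = 4 * q * k \<and> \<tau> ''w'' 0 = ?w \<and>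
    \<tau> ''B'' 0 = ?w * 2 ^ \<tau> ''t'' 0 \<and> (\<tau> ''t'' 0 = 0 \<or> \<tau> ''B'' 0 < n))"
  show ?thesis
    unfolding blocks_def
  proof (rule wp_mono, rule wp_Seq', rule wp_Assign', rule wp_Seq', rule wp_Assign', rule wp_Seq', rule wp_Assign',
      rule wp_Seq', rule wp_Assign', rule wp_Seq',
      rule wp_While[where I = J and f = "\<lambda>\<tau>. n - \<tau> ''B'' 0" and s = 3 and t = "5 * n + 1"])
    fix \<tau> :: memory assume \<tau>: "J \<tau>" "bval (Less (Add (V ''B'') (V ''B'')) (V ''n'')) \<tau>"
    have "\<tau> ''B'' 0 \<ge> 1" using \<tau>(1) w by (simp add: J_def)
    moreover have "\<tau> ''n'' 0 = n" using \<tau>(1) by (simp add: J_def)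
    then have "\<tau> ''B'' 0 + \<tau> ''B'' 0 < n" using \<tau>(2) by simp
    ultimately have "n - (\<tau> ''B'' 0 + \<tau> ''B'' 0) < n - \<tau> ''B'' 0" by linarith
    then show "wp (Seq (Set_var ''B'' (Add (V ''B'') (V ''B''))) (Set_var ''t'' (Add (V ''t'') (Const 1)))) \<tau> 3
        (\<lambda>\<tau>'. J \<tau>' \<and> n - \<tau>' ''B'' 0 < n - \<tau> ''B'' 0)"
      by (intro wp_mono[OF wp_Seq'[OF wp_Assign'[OF wp_Assign']]]) (use \<tau> in \<open>simp_all add: J_def\<close>)
  next
    fix \<tau> :: memory assume "J \<tau>" "\<not> bval (Less (Add (V ''B'') (V ''B'')) (V ''n'')) \<tau>"
    then show "wp (Set_var ''cols'' (Sub (V ''n'') (Const 1))) \<tau> 1 (\<lambda>\<tau>. \<tau> ''d'' 0 = 4 * q * k \<and> \<tau> ''w'' 0 = (4 * q - 2) * k \<and>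
      \<tau> ''cols'' 0 = n - 1 \<and> (let t = \<tau> ''t'' 0; b = (4 * q - 2) * k * 2 ^ t in n \<le> 2 * b \<and> (t = 0 \<or> b < n)))"
      by (intro wp_Assign) (auto simp: J_def Let_def)
  qed (use k n in \<open>auto simp: J_def\<close>)
qed

text \<open>\<open>F\<close> is the number of coins, \<open>E\<close> bounds the exponents
  \<open>i * j\<close> with \<open>i < cols\<close> and \<open>j \<le> d\<close>, and
  \<open>G\<close> is the number of rows in all copies of the parity check matrix.\<close>

definition products :: com where
  "products = Seq (mult ''F'' ''w'' ''t'') (Seq (mult ''D'' ''d'' ''h'') (Seq (mult ''E'' ''cols'' ''d'')
     (Seq (Set_var ''e'' (Add (V ''d'') (Const 1))) (Seq (mult ''G'' ''D'' ''e'')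
     (Set_var ''rows'' (Add (V ''G'') (V ''cols'')))))))"

lemma writes_products [simp]: "writes products = {''F'', ''D'', ''E'', ''e'', ''G'', ''rows'', ''i''}"
  by (auto simp: products_def)

lemma wp_products:
  "wp products \<sigma> (5 * \<sigma> ''t'' 0 + 5 * \<sigma> ''h'' 0 + 10 * \<sigma> ''d'' 0 + 40)
    (\<lambda>\<tau>. \<tau> ''F'' 0 = \<sigma> ''w'' 0 * \<sigma> ''t'' 0 \<and> \<tau> ''D'' 0 = \<sigma> ''d'' 0 * \<sigma> ''h'' 0 \<and>
      \<tau> ''E'' 0 = \<sigma> ''cols'' 0 * \<sigma> ''d'' 0 \<and> \<tau> ''G'' 0 = \<sigma> ''d'' 0 * \<sigma> ''h'' 0 * (\<sigma> ''d'' 0 + 1) \<and>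
      \<tau> ''rows'' 0 = \<tau> ''G'' 0 + \<sigma> ''cols'' 0)"
  (is "wp _ _ _ ?Q")
proof -
  have 3: "wp (Seq (Set_var ''e'' (Add (V ''d'') (Const 1))) (Seq (mult ''G'' ''D'' ''e'')
     (Set_var ''rows'' (Add (V ''G'') (V ''cols''))))) \<tau> (5 * \<sigma> ''d'' 0 + 14) ?Q"
    if "\<tau> ''F'' 0 = \<sigma> ''w'' 0 * \<sigma> ''t'' 0" "\<tau> ''D'' 0 = \<sigma> ''d'' 0 * \<sigma> ''h'' 0" "\<tau> ''E'' 0 = \<sigma> ''cols'' 0 * \<sigma> ''d'' 0"
      "\<tau> ''d'' = \<sigma> ''d''" "\<tau> ''cols'' = \<sigma> ''cols''" for \<tau>
  proof (rule wp_mono, rule wp_Seq', rule wp_Assign', rule wp_Seq'[where s = "5 * \<sigma> ''d'' 0 + 10" and u = 1])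
    show "wp (mult ''G'' ''D'' ''e'') (store ''e'' (aval (Const 0) \<tau>) (aval (Add (V ''d'') (Const 1)) \<tau>) \<tau>)
      (5 * \<sigma> ''d'' 0 + 10) (\<lambda>\<tau>. wp (Set_var ''rows'' (Add (V ''G'') (V ''cols''))) \<tau> 1 ?Q)"
    proof (rule wp_conseq[OF wp_mult])
      fix \<rho> assume \<rho>: "\<rho> ''G'' 0 = store ''e'' (aval (Const 0) \<tau>) (aval (Add (V ''d'') (Const 1)) \<tau>) \<tau> ''D'' 0 *
          store ''e'' (aval (Const 0) \<tau>) (aval (Add (V ''d'') (Const 1)) \<tau>) \<tau> ''e'' 0"
        "\<And>x. x \<notin> writes (mult ''G'' ''D'' ''e'') \<Longrightarrow>
          \<rho> x = store ''e'' (aval (Const 0) \<tau>) (aval (Add (V ''d'') (Const 1)) \<tau>) \<tau> x"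
      then show "wp (Set_var ''rows'' (Add (V ''G'') (V ''cols''))) \<rho> 1 ?Q"
        by (intro wp_Assign) (use that in auto)
    qed (use that in auto)
  qed simp
  have 2: "wp (mult ''E'' ''cols'' ''d'') \<tau> (5 * \<sigma> ''d'' 0 + 5)
      (\<lambda>\<tau>. wp (Seq (Set_var ''e'' (Add (V ''d'') (Const 1))) (Seq (mult ''G'' ''D'' ''e'')
     (Set_var ''rows'' (Add (V ''G'') (V ''cols''))))) \<tau> (5 * \<sigma> ''d'' 0 + 14) ?Q)"
    if "\<tau> ''F'' 0 = \<sigma> ''w'' 0 * \<sigma> ''t'' 0" "\<tau> ''D'' 0 = \<sigma> ''d'' 0 * \<sigma> ''h'' 0"
      "\<tau> ''d'' = \<sigma> ''d''" "\<tau> ''cols'' = \<sigma> ''cols''" for \<tau>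
    by (rule wp_conseq[OF wp_mult]; (rule 3)?) (use that in auto)
  have 1: "wp (mult ''D'' ''d'' ''h'') \<tau> (5 * \<sigma> ''h'' 0 + 5)
      (\<lambda>\<tau>. wp (Seq (mult ''E'' ''cols'' ''d'') (Seq (Set_var ''e'' (Add (V ''d'') (Const 1))) (Seq (mult ''G'' ''D'' ''e'')
     (Set_var ''rows'' (Add (V ''G'') (V ''cols'')))))) \<tau> (10 * \<sigma> ''d'' 0 + 20) ?Q)"
    if "\<tau> ''F'' 0 = \<sigma> ''w'' 0 * \<sigma> ''t'' 0" "\<tau> ''h'' = \<sigma> ''h''"
      "\<tau> ''d'' = \<sigma> ''d''" "\<tau> ''cols'' = \<sigma> ''cols''" for \<tau>
  proof (rule wp_conseq[OF wp_mult])
    fix \<rho> assume "\<rho> ''D'' 0 = \<tau> ''d'' 0 * \<tau> ''h'' 0" "\<And>x. x \<notin> writes (mult ''D'' ''d'' ''h'') \<Longrightarrow> \<rho> x = \<tau> x"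
    then show "wp (Seq (mult ''E'' ''cols'' ''d'') (Seq (Set_var ''e'' (Add (V ''d'') (Const 1))) (Seq (mult ''G'' ''D'' ''e'')
     (Set_var ''rows'' (Add (V ''G'') (V ''cols'')))))) \<rho> (10 * \<sigma> ''d'' 0 + 20) ?Q"
      by (intro wp_mono[OF wp_Seq'[OF 2]]) (use that in auto)
  qed (use that in auto)
  show ?thesis
    unfolding products_def
  proof (rule wp_mono, rule wp_Seq'[OF wp_conseq[OF wp_mult _ order.refl]])
    fix \<rho> assume "\<rho> ''F'' 0 = \<sigma> ''w'' 0 * \<sigma> ''t'' 0" "\<And>x. x \<notin> writes (mult ''F'' ''w'' ''t'') \<Longrightarrow> \<rho> x = \<sigma> x"
    then show "wp (Seq (mult ''D'' ''d'' ''h'') (Seq (mult ''E'' ''cols'' ''d'')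
     (Seq (Set_var ''e'' (Add (V ''d'') (Const 1))) (Seq (mult ''G'' ''D'' ''e'')
     (Set_var ''rows'' (Add (V ''G'') (V ''cols''))))))) \<rho> (5 * \<sigma> ''h'' 0 + 10 * \<sigma> ''d'' 0 + 30) ?Q"
      by (intro wp_mono[OF wp_Seq'[OF 1]]) auto
  qed auto
qed

section \<open>Writing the matrix and the target\<close>

text \<open>The first \<open>g = d h (d + 1)\<close> rows are \<open>d + 1\<close> copies of the parity check matrix of the BCH code,
  with rows indexed by \<open>(j, c)\<close> for \<open>1 \<le> j \<le> d\<close> and \<open>c < h\<close>; the identity matrix follows.\<close>
definition gen_entry :: "nat \<Rightarrow> (nat \<Rightarrow> 'a::field) \<Rightarrow> nat \<Rightarrow> nat \<Rightarrow> nat \<Rightarrow> nat \<Rightarrow> 'a" where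
  "gen_entry h a d g r i = (if r < g then X_power h a (i * (r div h mod d + 1)) (r mod h)
     else if i + g = r then 1 else 0)"

text \<open>Row \<open>r\<close> stands for the coordinate \<open>r mod h\<close> at the exponent
  \<open>r div h mod d + 1\<close>; the remaining quotient is the number of the copy.\<close>

definition target_entry :: "nat \<Rightarrow> (nat \<Rightarrow> 'a::field) \<Rightarrow> nat \<Rightarrow> nat \<Rightarrow> nat \<Rightarrow> (nat \<Rightarrow> 'a) \<Rightarrow> nat \<Rightarrow> 'a" where
  "target_entry h a d g n e r = (if r < g then syndrome h a n e (r div h mod d + 1) (r mod h) else 0)"

context field_code
begin

definition out_write :: com where
  "out_write = Seq (Assign ''A'' (V ''l'') (V ''v'')) (Seq (Set_var ''l'' (Add (V ''l'') (Const 1)))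
     (Set_var ''y'' (Add (V ''y'') (V ''j''))))"

text \<open>The variable \<open>j\<close> stores the exponent multiplied by \<open>h\<close>, so one
  column further to the right the required entry of \<open>P\<close> lies \<open>j\<close> cells
  after the address \<open>y\<close>. The sum over the marked columns is accumulated in
  \<open>z\<close> and becomes the entry of the target.\<close>

definition out_entry :: com where
  "out_entry = Seq (Cond (Less (V ''r'') (V ''G''))
       (Seq (Set_var ''v'' (Cell ''P'' (V ''y'')))
         (Cond (Eq (Cell ''M'' (V ''i'')) (Const 1)) (Set_var ''z'' (add_e (V ''z'') (V ''v''))) Skip))
       (Cond (Eq (Add (V ''i'') (V ''G'')) (V ''r'')) (Set_var ''v'' (Const (code 1))) (Set_var ''v'' (Const (code 0)))))
     out_write"

text \<open>Advances \<open>(j, c)\<close> cyclically through the rows of one copy. As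
  \<open>j\<close> is scaled by \<open>h\<close>, the last exponent has been passed when
  \<open>j\<close> exceeds \<open>D = d h\<close>.\<close>

definition out_next :: com where
  "out_next = Seq (Assign ''s'' (V ''r'') (V ''z'')) (Seq (Set_var ''c'' (Add (V ''c'') (Const 1)))
     (Cond (Less (V ''c'') (V ''h'')) Skip (Seq (Set_var ''c'' (Const 0)) (Seq (Set_var ''j'' (Add (V ''j'') (V ''h'')))
       (Cond (Less (V ''D'') (V ''j'')) (Set_var ''j'' (V ''h'')) Skip)))))"

definition out_row :: com where
  "out_row = Seq (Set_var ''z'' (Const (code 0))) (Seq (Set_var ''y'' (V ''c''))
     (Seq (For ''i'' ''cols'' out_entry) out_next))"

definition write_code :: com where
  "write_code = Seq (Set_var ''l'' (Const 0)) (Seq (Set_var ''c'' (Const 0)) (Seq (Set_var ''j'' (V ''h''))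
     (For ''r'' ''rows'' out_row)))"

lemma writes_out_write [simp]: "writes out_write = {''A'', ''l'', ''y''}"
  by (auto simp: out_write_def)

lemma writes_out_entry [simp]: "writes out_entry = {''v'', ''z'', ''A'', ''l'', ''y''}"
  by (auto simp: out_entry_def)

lemma writes_out_next [simp]: "writes out_next = {''s'', ''c'', ''j''}"
  by (auto simp: out_next_def)

lemma writes_out_row [simp]: "writes out_row = {''v'', ''z'', ''A'', ''l'', ''y'', ''i'', ''s'', ''c'', ''j''}"
  by (auto simp: out_row_def)

lemma writes_write_code [simp]: "writes write_code = {''v'', ''z'', ''A'', ''l'', ''y'', ''i'', ''s'', ''c'', ''j'', ''r''}"
  by (auto simp: write_code_def)

lemma wp_out_entry:
  assumes r: "\<sigma> ''r'' 0 = r" and g: "\<sigma> ''G'' 0 = g" and i: "\<sigma> ''i'' 0 = i"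
    and P: "r < g \<Longrightarrow> \<sigma> ''P'' (\<sigma> ''y'' 0) = code p" and z: "\<sigma> ''z'' 0 = code z" and tab: "tables_ok \<sigma>"
    and x: "x = (if r < g then p else if i + g = r then 1 else 0)"
  shows "wp out_entry \<sigma> 20 (\<lambda>\<tau>. \<tau> ''A'' = (\<sigma> ''A'')(\<sigma> ''l'' 0 := code x) \<and> \<tau> ''l'' 0 = Suc (\<sigma> ''l'' 0) \<and>
    \<tau> ''y'' 0 = \<sigma> ''y'' 0 + \<sigma> ''j'' 0 \<and> \<tau> ''z'' 0 = code (if r < g \<and> \<sigma> ''M'' i = 1 then z + x else z))"
proof -
  have wr: "wp out_write \<tau> 5 (\<lambda>\<tau>. \<tau> ''A'' = (\<sigma> ''A'')(\<sigma> ''l'' 0 := code x) \<and> \<tau> ''l'' 0 = Suc (\<sigma> ''l'' 0) \<and>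
    \<tau> ''y'' 0 = \<sigma> ''y'' 0 + \<sigma> ''j'' 0 \<and> \<tau> ''z'' 0 = code (if r < g \<and> \<sigma> ''M'' i = 1 then z + x else z))"
    if v: "\<tau> ''v'' 0 = code x" and z: "\<tau> ''z'' 0 = code (if r < g \<and> \<sigma> ''M'' i = 1 then z + x else z)"
      and eq: "\<tau> ''A'' = \<sigma> ''A''" "\<tau> ''l'' = \<sigma> ''l''" "\<tau> ''y'' = \<sigma> ''y''" "\<tau> ''j'' = \<sigma> ''j''" for \<tau>
    unfolding out_write_def
    by (rule wp_mono[OF wp_Seq'[OF wp_Assign'[OF wp_Seq'[OF wp_Assign'[OF wp_Assign']]]]])
      (use v z eq in simp_all)
  show ?thesis
  proof (cases "r < g")
    case True
    have ae: "aval (add_e (V ''z'') (V ''v'')) (store ''v'' 0 (code p) \<sigma>) = code (z + p)"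
      by (rule aval_add_e) (use z tab in simp_all)
    show ?thesis
      unfolding out_entry_def
    proof (rule wp_mono, rule wp_Seq'[where s = 11 and u = 5], rule wp_Cond[where s = 10])
      show "wp (Seq (Set_var ''v'' (Cell ''P'' (V ''y'')))
         (Cond (Eq (Cell ''M'' (V ''i'')) (Const 1)) (Set_var ''z'' (add_e (V ''z'') (V ''v''))) Skip)) \<sigma> 10
        (\<lambda>\<tau>. wp out_write \<tau> 5 (\<lambda>\<tau>. \<tau> ''A'' = (\<sigma> ''A'')(\<sigma> ''l'' 0 := code x) \<and> \<tau> ''l'' 0 = Suc (\<sigma> ''l'' 0) \<and>
          \<tau> ''y'' 0 = \<sigma> ''y'' 0 + \<sigma> ''j'' 0 \<and> \<tau> ''z'' 0 = code (if r < g \<and> \<sigma> ''M'' i = 1 then z + x else z)))"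
        by (rule wp_mono, rule wp_Seq', rule wp_Assign', rule wp_Cond';
            (rule wp_Assign' wp_Skip', rule wr)?)
          (use True P i z x ae in simp_all)
    qed (use True r g in simp_all)
  next
    case False
    show ?thesis
      unfolding out_entry_def
    proof (rule wp_mono, rule wp_Seq'[where s = 11 and u = 5], rule wp_Cond[where s = 10])
      show "wp (Cond (Eq (Add (V ''i'') (V ''G'')) (V ''r'')) (Set_var ''v'' (Const (code 1))) (Set_var ''v'' (Const (code 0)))) \<sigma> 10
        (\<lambda>\<tau>. wp out_write \<tau> 5 (\<lambda>\<tau>. \<tau> ''A'' = (\<sigma> ''A'')(\<sigma> ''l'' 0 := code x) \<and> \<tau> ''l'' 0 = Suc (\<sigma> ''l'' 0) \<and>
          \<tau> ''y'' 0 = \<sigma> ''y'' 0 + \<sigma> ''j'' 0 \<and> \<tau> ''z'' 0 = code (if r < g \<and> \<sigma> ''M'' i = 1 then z + x else z)))"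
        by (rule wp_mono, rule wp_Cond'; (rule wp_Assign' wp_Skip', rule wr)?)
          (use False i g r z x in simp_all)
    qed (use False r g in simp_all)
  qed
qed

lemma wp_out_next:
  assumes r: "\<sigma> ''r'' 0 = r" and h: "\<sigma> ''h'' 0 = h" "h \<ge> 1" and d: "\<sigma> ''D'' 0 = d * h" "d \<ge> 1"
    and c: "\<sigma> ''c'' 0 = r mod h" and j: "\<sigma> ''j'' 0 = (r div h mod d + 1) * h"
  shows "wp out_next \<sigma> 20 (\<lambda>\<tau>. \<tau> ''s'' = (\<sigma> ''s'')(r := \<sigma> ''z'' 0) \<and> \<tau> ''c'' 0 = Suc r mod h \<and>
    \<tau> ''j'' 0 = (Suc r div h mod d + 1) * h)"
proof -
  define b where "b = r div h mod d"
  have bd: "b < d" using d by (simp add: b_def)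
  have wrap: "d * h < (b + 1) * h + h \<longleftrightarrow> Suc b = d"
  proof -
    have "d * h < (b + 2) * h \<longleftrightarrow> d < b + 2"
      unfolding mult_less_cancel2 using h by simp
    also have "\<dots> \<longleftrightarrow> Suc b = d" using bd by auto
    finally show ?thesis by (simp add: algebra_simps)
  qed
  have 1: "Suc r mod h = Suc (r mod h)" "Suc r div h mod d = b" if "Suc (r mod h) < h"
    using that by (simp_all add: mod_Suc div_Suc b_def)
  have 2: "Suc r mod h = 0" "Suc r div h mod d = (if Suc b = d then 0 else Suc b)" if "\<not> Suc (r mod h) < h"
  proof -
    have "r mod h < h" using h by simp
    then have "Suc (r mod h) = h" using that by linarith
    then show "Suc r mod h = 0" "Suc r div h mod d = (if Suc b = d then 0 else Suc b)"
      by (simp_all add: mod_Suc div_Suc b_def)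
  qed
  show ?thesis
    unfolding out_next_def
    by (rule wp_mono, rule wp_Seq', rule wp_Assign', rule wp_Seq', rule wp_Assign', rule wp_Cond', rule wp_Skip',
        rule_tac[2] wp_Seq', rule_tac[2] wp_Assign', rule_tac[2] wp_Seq', rule_tac[2] wp_Assign', rule_tac[2] wp_Cond',
        rule_tac[2] wp_Assign', rule_tac[3] wp_Skip')
      (use r h c j d 1 2 wrap in \<open>simp_all add: b_def[symmetric]\<close>)
qed

lemma wp_out_row:
  fixes a e :: "nat \<Rightarrow> 'a"
  assumes r: "\<sigma> ''r'' 0 = r" and h: "\<sigma> ''h'' 0 = h" "h \<ge> 1" and d: "\<sigma> ''D'' 0 = d * h" "d \<ge> 1"
    and c: "\<sigma> ''c'' 0 = r mod h" and j: "\<sigma> ''j'' 0 = (r div h mod d + 1) * h"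
    and g: "\<sigma> ''G'' 0 = g" and n: "\<sigma> ''cols'' 0 = n" and l: "\<sigma> ''l'' 0 = r * n"
    and P: "P_upto h a (Suc (n * d) * h) \<sigma>" and tab: "tables_ok \<sigma>"
    and M: "\<And>i. i < n \<Longrightarrow> e i = of_bool (\<sigma> ''M'' i = 1)"
  shows "wp out_row \<sigma> (24 * n + 30) (\<lambda>\<tau>. \<tau> ''l'' 0 = Suc r * n \<and> \<tau> ''c'' 0 = Suc r mod h \<and>
    \<tau> ''j'' 0 = (Suc r div h mod d + 1) * h \<and> \<tau> ''s'' = (\<sigma> ''s'')(r := code (target_entry h a d g n e r)) \<and>
    (\<forall>p. \<tau> ''A'' p = (if r * n \<le> p \<and> p < Suc r * n then code (gen_entry h a d g r (p - r * n)) else \<sigma> ''A'' p)))"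
proof -
  define b where "b = r div h mod d + 1"
  have b: "b \<le> d" "b \<ge> 1" using d by (auto simp: b_def Suc_leI)
  define z where "z i = (if r < g then (\<Sum>i'<i. X_power h a (i' * b) (r mod h) * e i') else 0)" for i
  define I where "I i \<tau> \<longleftrightarrow> \<tau> ''y'' 0 = i * b * h + r mod h \<and> \<tau> ''z'' 0 = code (z i) \<and> \<tau> ''l'' 0 = r * n + i \<and>
    (\<forall>p. \<tau> ''A'' p = (if r * n \<le> p \<and> p < r * n + i then code (gen_entry h a d g r (p - r * n)) else \<sigma> ''A'' p))"
    for i and \<tau> :: memory
  define Q where "Q = (\<lambda>\<tau>. \<tau> ''l'' 0 = Suc r * n \<and> \<tau> ''c'' 0 = Suc r mod h \<and>
    \<tau> ''j'' 0 = (Suc r div h mod d + 1) * h \<and> \<tau> ''s'' = (\<sigma> ''s'')(r := code (target_entry h a d g n e r)) \<and>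
    (\<forall>p. \<tau> ''A'' p = (if r * n \<le> p \<and> p < Suc r * n then code (gen_entry h a d g r (p - r * n)) else \<sigma> ''A'' p)))"
  have "wp out_row \<sigma> (24 * n + 30) Q"
    unfolding out_row_def
  proof (rule wp_mono, rule wp_Seq', rule wp_Assign', rule wp_Seq', rule wp_Assign', rule wp_Seq',
      rule wp_For[where I = I and s = 20 and t = "24 * n + 3"])
    let ?\<sigma> = "store ''z'' (aval (Const 0) \<sigma>) (aval (Const (code 0)) \<sigma>) \<sigma>"
    let ?\<rho> = "store ''y'' (aval (Const 0) ?\<sigma>) (aval (V ''c'') ?\<sigma>) ?\<sigma>"
    have n': "?\<rho> ''cols'' 0 = n" using n by simp
    show "I 0 (store ''i'' 0 0 ?\<rho>)" using c l by (auto simp: I_def z_def)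
    {
      fix i \<tau> assume i: "i < ?\<rho> ''cols'' 0" "\<tau> ''i'' 0 = i" and I: "I i \<tau>"
        and eq: "\<And>z. z \<notin> insert ''i'' (writes out_entry) \<Longrightarrow> \<tau> z = ?\<rho> z"
      have "i < n" using i(1) n' by simp
      have eqs: "\<tau> ''r'' = \<sigma> ''r''" "\<tau> ''G'' = \<sigma> ''G''" "\<tau> ''P'' = \<sigma> ''P''" "\<tau> ''M'' = \<sigma> ''M''" "\<tau> ''j'' = \<sigma> ''j''"
        "\<tau> ''add'' = \<sigma> ''add''" "\<tau> ''mul'' = \<sigma> ''mul''" using eq by simp_all
      \<comment> \<open>The address lies inside the table of powers because
        \<open>i * b \<le> n * d\<close>.\<close>
      have "\<sigma> ''P'' (i * b * h + r mod h) = code (X_power h a (i * b) (r mod h))"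
      proof (rule P_uptoD[OF P])
        have "i * b \<le> n * d" using \<open>i < n\<close> b by (intro mult_le_mono) auto
        then have "i * b * h \<le> n * d * h" by (rule mult_le_mono1)
        moreover show "r mod h < h" using h by simp
        ultimately show "i * b * h + r mod h < Suc (n * d) * h" unfolding mult_Suc by linarith
      qed
      then have "wp out_entry \<tau> 20 (\<lambda>\<tau>'. \<tau>' ''A'' = (\<tau> ''A'')(\<tau> ''l'' 0 := code (gen_entry h a d g r i)) \<and>
          \<tau>' ''l'' 0 = Suc (\<tau> ''l'' 0) \<and> \<tau>' ''y'' 0 = \<tau> ''y'' 0 + \<tau> ''j'' 0 \<and>
          \<tau>' ''z'' 0 = code (if r < g \<and> \<tau> ''M'' i = 1 then z i + gen_entry h a d g r i else z i))"
        by (intro wp_out_entry[where p = "X_power h a (i * b) (r mod h)"])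
          (use eqs r g i I tab tables_ok_cong[of \<tau> \<sigma>] in \<open>simp_all add: I_def gen_entry_def b_def\<close>)
      then show "wp out_entry \<tau> 20 (\<lambda>\<tau>'. I (Suc i) (store ''i'' 0 (Suc i) \<tau>'))"
      proof (rule wp_conseq)
        fix \<tau>'
        assume *: "\<tau>' ''A'' = (\<tau> ''A'')(\<tau> ''l'' 0 := code (gen_entry h a d g r i)) \<and>
          \<tau>' ''l'' 0 = Suc (\<tau> ''l'' 0) \<and> \<tau>' ''y'' 0 = \<tau> ''y'' 0 + \<tau> ''j'' 0 \<and>
          \<tau>' ''z'' 0 = code (if r < g \<and> \<tau> ''M'' i = 1 then z i + gen_entry h a d g r i else z i)"
        have "(if r < g \<and> \<tau> ''M'' i = 1 then z i + gen_entry h a d g r i else z i) = z (Suc i)"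
          using M[OF \<open>i < n\<close>] by (simp add: z_def gen_entry_def b_def eqs)
        moreover have "\<tau>' ''y'' 0 = Suc i * b * h + r mod h"
          using * I j by (simp add: I_def eqs b_def algebra_simps)
        ultimately show "I (Suc i) (store ''i'' 0 (Suc i) \<tau>')"
          using * I by (auto simp: I_def less_Suc_eq)
      qed simp
    }
    fix \<tau> assume I: "I (?\<rho> ''cols'' 0) \<tau>"
      and eq: "\<And>z. z \<notin> insert ''i'' (writes out_entry) \<Longrightarrow> \<tau> z = ?\<rho> z"
    have eqs: "\<tau> ''r'' = \<sigma> ''r''" "\<tau> ''h'' = \<sigma> ''h''" "\<tau> ''D'' = \<sigma> ''D''" "\<tau> ''c'' = \<sigma> ''c''" "\<tau> ''j'' = \<sigma> ''j''"
      "\<tau> ''s'' = \<sigma> ''s''" using eq by simp_all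
    have tz: "z n = target_entry h a d g n e r"
      by (simp add: z_def target_entry_def syndrome_def b_def)
    have "wp out_next \<tau> 20 (\<lambda>\<tau>'. \<tau>' ''s'' = (\<tau> ''s'')(r := \<tau> ''z'' 0) \<and> \<tau>' ''c'' 0 = Suc r mod h \<and>
        \<tau>' ''j'' 0 = (Suc r div h mod d + 1) * h)"
      by (rule wp_out_next) (use eqs r h d c j in simp_all)
    then show "wp out_next \<tau> 20 Q"
      by (rule wp_conseq) (use I n' eqs tz in \<open>auto simp: Q_def I_def add.commute\<close>)
  qed (use n in auto)
  then show ?thesis unfolding Q_def .
qed

lemma wp_write_code:
  fixes a e :: "nat \<Rightarrow> 'a"
  assumes h: "\<sigma> ''h'' 0 = h" "h \<ge> 1" and d: "\<sigma> ''D'' 0 = d * h" "d \<ge> 1"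
    and g: "\<sigma> ''G'' 0 = g" and n: "\<sigma> ''cols'' 0 = n" and m: "\<sigma> ''rows'' 0 = m"
    and P: "P_upto h a (Suc (n * d) * h) \<sigma>" and tab: "tables_ok \<sigma>"
    and M: "\<And>i. i < n \<Longrightarrow> e i = of_bool (\<sigma> ''M'' i = 1)"
  shows "wp write_code \<sigma> (m * (24 * n + 34) + 10) (\<lambda>\<tau>. \<forall>r<m. \<tau> ''s'' r = code (target_entry h a d g n e r) \<and>
    (\<forall>i<n. \<tau> ''A'' (r * n + i) = code (gen_entry h a d g r i)))"
  unfolding write_code_def
proof (rule wp_mono, rule wp_Seq', rule wp_Assign', rule wp_Seq', rule wp_Assign', rule wp_Seq', rule wp_Assign')
  let ?\<sigma>1 = "store ''l'' (aval (Const 0) \<sigma>) (aval (Const 0) \<sigma>) \<sigma>"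
  let ?\<sigma>2 = "store ''c'' (aval (Const 0) ?\<sigma>1) (aval (Const 0) ?\<sigma>1) ?\<sigma>1"
  let ?\<sigma> = "store ''j'' (aval (Const 0) ?\<sigma>2) (aval (V ''h'') ?\<sigma>2) ?\<sigma>2"
  define I where "I r \<tau> \<longleftrightarrow> \<tau> ''l'' 0 = r * n \<and> \<tau> ''c'' 0 = r mod h \<and> \<tau> ''j'' 0 = (r div h mod d + 1) * h \<and>
    (\<forall>r'<r. \<tau> ''s'' r' = code (target_entry h a d g n e r') \<and>
      (\<forall>i<n. \<tau> ''A'' (r' * n + i) = code (gen_entry h a d g r' i)))" for r and \<tau> :: memory
  show "wp (For ''r'' ''rows'' out_row) ?\<sigma> (m * (24 * n + 34) + 3)
    (\<lambda>\<tau>. \<forall>r<m. \<tau> ''s'' r = code (target_entry h a d g n e r) \<and>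
    (\<forall>i<n. \<tau> ''A'' (r * n + i) = code (gen_entry h a d g r i)))"
  proof (rule wp_For[where I = I and s = "24 * n + 30"])
    fix r \<tau> assume r: "\<tau> ''r'' 0 = r" and I: "I r \<tau>"
      and eq: "\<And>z. z \<notin> insert ''r'' (writes out_row) \<Longrightarrow> \<tau> z = ?\<sigma> z"
    have eqs: "\<tau> ''h'' = \<sigma> ''h''" "\<tau> ''D'' = \<sigma> ''D''" "\<tau> ''G'' = \<sigma> ''G''" "\<tau> ''cols'' = \<sigma> ''cols''" "\<tau> ''P'' = \<sigma> ''P''"
      "\<tau> ''M'' = \<sigma> ''M''" "\<tau> ''add'' = \<sigma> ''add''" "\<tau> ''mul'' = \<sigma> ''mul''" using eq by simp_all
    have PP: "P_upto h a (Suc (n * d) * h) \<tau>" using P eqs by (simp add: P_upto_def)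
    have "wp out_row \<tau> (24 * n + 30) (\<lambda>\<tau>'. \<tau>' ''l'' 0 = Suc r * n \<and> \<tau>' ''c'' 0 = Suc r mod h \<and>
      \<tau>' ''j'' 0 = (Suc r div h mod d + 1) * h \<and> \<tau>' ''s'' = (\<tau> ''s'')(r := code (target_entry h a d g n e r)) \<and>
      (\<forall>p. \<tau>' ''A'' p = (if r * n \<le> p \<and> p < Suc r * n then code (gen_entry h a d g r (p - r * n)) else \<tau> ''A'' p)))"
      by (rule wp_out_row[OF r _ h(2) _ d(2) _ _ _ _ _ PP])
        (use eqs h d g n I tab tables_ok_cong[of \<tau> \<sigma>] M in \<open>simp_all add: I_def\<close>)
    then show "wp out_row \<tau> (24 * n + 30) (\<lambda>\<tau>'. I (Suc r) (store ''r'' 0 (Suc r) \<tau>'))"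
    proof (rule wp_conseq)
      fix \<tau>'
      assume *: "\<tau>' ''l'' 0 = Suc r * n \<and> \<tau>' ''c'' 0 = Suc r mod h \<and>
        \<tau>' ''j'' 0 = (Suc r div h mod d + 1) * h \<and> \<tau>' ''s'' = (\<tau> ''s'')(r := code (target_entry h a d g n e r)) \<and>
        (\<forall>p. \<tau>' ''A'' p = (if r * n \<le> p \<and> p < Suc r * n then code (gen_entry h a d g r (p - r * n)) else \<tau> ''A'' p))"
      have "\<tau>' ''A'' (r' * n + i) = \<tau> ''A'' (r' * n + i)" if "r' < r" "i < n" for r' i
      proof -
        have "r' * n + i < Suc r' * n" using that by simp
        also have "\<dots> \<le> r * n" using that by (intro mult_le_mono1) simp
        finally show ?thesis using * by simp
      qed
      then show "I (Suc r) (store ''r'' 0 (Suc r) \<tau>')"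
        using * I unfolding I_def by (auto simp: less_Suc_eq)
    qed simp
  next
    show "I 0 (store ''r'' 0 0 ?\<sigma>)" using h by (simp add: I_def)
  next
    fix \<tau> assume "I (?\<sigma> ''rows'' 0) \<tau>"
    then show "\<forall>r<m. \<tau> ''s'' r = code (target_entry h a d g n e r) \<and>
      (\<forall>i<n. \<tau> ''A'' (r * n + i) = code (gen_entry h a d g r i))"
      using m by (simp add: I_def)
  qed (use m in simp_all)
qed simp

end

section \<open>The generated code\<close>

text \<open>An infinite set has \<open>card\<close> equal to \<open>0\<close>, so a lower bound on
  the number of close codewords rests on finiteness.\<close>

lemma finite_vec_set: "finite {v :: 'a::finite Matrix.vec. dim_vec v = n}"
proof -
  have "{v :: 'a Matrix.vec. dim_vec v = n} \<subseteq> vec_of_list ` {xs. length xs = n}"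
    by (auto intro!: image_eqI[of _ _ "list_of_vec _"] simp: vec_list)
  moreover have "finite {xs :: 'a list. length xs = n}"
    using finite_lists_length_eq[of "UNIV :: 'a set" n] by simp
  ultimately show ?thesis by (meson finite_imageI finite_subset)
qed

definition gen_mat :: "nat \<Rightarrow> (nat \<Rightarrow> 'a::field) \<Rightarrow> nat \<Rightarrow> nat \<Rightarrow> 'a Matrix.mat" where
  "gen_mat h a d n = (let g = d * h * (d + 1) in Matrix.mat (g + n) n (\<lambda>(r, i). gen_entry h a d g r i))"

definition target :: "nat \<Rightarrow> (nat \<Rightarrow> 'a::field) \<Rightarrow> nat \<Rightarrow> nat \<Rightarrow> (nat \<Rightarrow> 'a) \<Rightarrow> 'a Matrix.vec" where
  "target h a d n e = (let g = d * h * (d + 1) in Matrix.vec (g + n) (target_entry h a d g n e))"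

lemma dim_gen_mat [simp]:
  "dim_row (gen_mat h a d n) = d * h * (d + 1) + n" "dim_col (gen_mat h a d n) = n"
  by (simp_all add: gen_mat_def Let_def)

lemma dim_target [simp]: "dim_vec (target h a d n e) = d * h * (d + 1) + n"
  by (simp add: target_def Let_def)

lemma syndrome_cong: "(\<And>i. i < n \<Longrightarrow> e i = e' i) \<Longrightarrow> syndrome h a n e = syndrome h a n e'"
  by (simp add: syndrome_def fun_eq_iff)

lemma gen_mat_mult:
  assumes x: "dim_vec x = n" and r: "r < d * h * (d + 1) + n"
  shows "vec_index (gen_mat h a d n *\<^sub>v x) r =
    (if r < d * h * (d + 1) then syndrome h a n (vec_index x) (r div h mod d + 1) (r mod h)
     else vec_index x (r - d * h * (d + 1)))"
proof -
  let ?g = "d * h * (d + 1)"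
  have "vec_index (gen_mat h a d n *\<^sub>v x) r = (\<Sum>i<n. gen_entry h a d ?g r i * vec_index x i)"
    using x r by (simp add: gen_mat_def Let_def scalar_prod_def atLeast0LessThan)
  also have "\<dots> = (if r < ?g then syndrome h a n (vec_index x) (r div h mod d + 1) (r mod h)
     else vec_index x (r - ?g))"
  proof (cases "r < ?g")
    case False
    have "(\<Sum>i<n. gen_entry h a d ?g r i * vec_index x i) = (\<Sum>i\<in>{r - ?g}. gen_entry h a d ?g r i * vec_index x i)"
      by (rule sum.mono_neutral_right) (use False r in \<open>auto simp: gen_entry_def\<close>)
    then show ?thesis using False by (simp add: gen_entry_def)
  qed (simp add: gen_entry_def syndrome_def)
  finally show ?thesis .
qed

text \<open>A nonzero syndrome is repeated \<open>d + 1\<close> times in the codeword, and a vanishing one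
  leaves the message itself, which is then a word of the BCH code.\<close>
lemma hamming_weight_gen_mat:
  fixes a :: "nat \<Rightarrow> 'a::{field,finite}"
  assumes h: "h \<ge> 1" and d: "d \<ge> 1" and prim: "primitive_coeffs h a" and n: "n \<le> CARD('a) ^ h - 1"
    and x: "dim_vec x = n" and nz: "gen_mat h a d n *\<^sub>v x \<noteq> 0\<^sub>v (d * h * (d + 1) + n)"
  shows "d < hamming_weight (gen_mat h a d n *\<^sub>v x)"
proof -
  let ?g = "d * h * (d + 1)"
  let ?c = "gen_mat h a d n *\<^sub>v x"
  let ?S = "{r. r < dim_vec ?c \<and> vec_index ?c r \<noteq> 0}"
  have dim: "dim_vec ?c = ?g + n" by simp
  have fin: "finite ?S" by simp
  show ?thesis
  proof (cases "\<forall>j\<in>{1..d}. syndrome h a n (vec_index x) j = (\<lambda>_. 0)")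
    case True
    have "d < card {i. i < n \<and> vec_index x i \<noteq> 0}"
    proof (rule ccontr)
      assume "\<not> d < card {i. i < n \<and> vec_index x i \<noteq> 0}"
      then have x0: "\<forall>i<n. vec_index x i = 0"
        using bch_bound[OF h prim n, of d "vec_index x"] True by auto
      then have "syndrome h a n (vec_index x) = (\<lambda>_ _. 0)" by (auto simp: syndrome_def)
      then have "?c = 0\<^sub>v (?g + n)"
        using x0 by (intro eq_vecI) (auto simp: gen_mat_mult[OF x] simp del: index_mult_mat_vec)
      then show False using nz by simp
    qed
    also have "\<dots> \<le> card ?S"
      by (rule card_inj_on_le[where f = "\<lambda>i. ?g + i"])
        (use fin in \<open>auto simp: gen_mat_mult[OF x] simp del: index_mult_mat_vec\<close>)
    finally show ?thesis by (simp add: hamming_weight_def)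
  next
    case False
    then obtain j c where j: "j \<in> {1..d}" and c: "syndrome h a n (vec_index x) j c \<noteq> 0"
      by (auto simp: fun_eq_iff)
    have ch: "c < h"
      using syndrome_in_vecs[OF h, of a n "vec_index x" j] c by (auto simp: vecs_def not_le[symmetric])
    \<comment> \<open>The row for \<open>(j, c)\<close> in copy number \<open>i\<close>; these
      \<open>d + 1\<close> rows carry the same nonzero value.\<close>
    define f where "f i = (i * d + (j - 1)) * h + c" for i
    have f: "f i div h mod d + 1 = j" "f i mod h = c" for i
    proof -
      obtain k where k: "j = Suc k" "k < d" using j by (cases j) auto
      have "f i div h = i * d + k" using ch k by (simp add: f_def)
      then show "f i div h mod d + 1 = j" "f i mod h = c" using ch k by (simp_all add: f_def)
    qed
    have fg: "f i < ?g" if "i \<le> d" for i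
    proof -
      have "i * d + (j - 1) < (d + 1) * d"
      proof -
        have "i * d + (j - 1) < i * d + d" using j by auto
        also have "\<dots> \<le> (d + 1) * d" using that by simp
        finally show ?thesis .
      qed
      then have "Suc (i * d + (j - 1)) * h \<le> (d + 1) * d * h" by (intro mult_le_mono1) simp
      then show ?thesis using ch by (simp add: f_def algebra_simps)
    qed
    have "inj_on f {..d}"
      using h d by (auto simp: inj_on_def f_def)
    then have "card {..d} \<le> card ?S"
    proof (rule card_inj_on_le)
      show "f ` {..d} \<subseteq> ?S"
        using fg f c by (auto simp: gen_mat_mult[OF x] trans_less_add1 simp del: index_mult_mat_vec)
    qed (rule fin)
    then show ?thesis by (simp add: hamming_weight_def)
  qed
qed

lemma min_distance_gen_mat:
  fixes a :: "nat \<Rightarrow> 'a::{field,finite}"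
  assumes "h \<ge> 1" "d \<ge> 1" "primitive_coeffs h a" "n \<le> CARD('a) ^ h - 1"
  shows "enat d < min_distance (code_of (gen_mat h a d n))"
proof -
  \<comment> \<open>An infimum preserves only weak bounds, so strictness is passed through
    \<open>Suc d\<close>; a code without nonzero words is covered as well.\<close>
  have "enat (Suc d) \<le> min_distance (code_of (gen_mat h a d n))"
    unfolding min_distance_def
  proof (rule INF_greatest)
    fix c assume "c \<in> {c \<in> code_of (gen_mat h a d n). c \<noteq> 0\<^sub>v (dim_vec c)}"
    then obtain x where "dim_vec x = n" "c = gen_mat h a d n *\<^sub>v x" "c \<noteq> 0\<^sub>v (dim_vec c)"
      unfolding code_of_def by (auto dest: carrier_vecD simp del: dim_mult_mat_vec)
    then have "d < hamming_weight c"
      using hamming_weight_gen_mat[OF assms, of x] by simp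
    then show "enat (Suc d) \<le> enat (hamming_weight c)" by simp
  qed
  moreover have "enat d < enat (Suc d)" by simp
  ultimately show ?thesis by (rule less_le_trans[rotated])
qed

text \<open>Subtracting the target from the codeword of \<open>f x\<close> cancels all copies of the
  syndrome and leaves \<open>f x\<close> in the identity part, so weight and distinctness are
  inherited from the words \<open>f x\<close>.\<close>

lemma card_close_codewords:
  fixes a :: "nat \<Rightarrow> 'a::{field,finite}" and f :: "'b \<Rightarrow> nat \<Rightarrow> 'a"
  assumes d: "d \<ge> 1"
    and inj: "\<And>x y. x \<in> W \<Longrightarrow> y \<in> W \<Longrightarrow> (\<And>i. i < n \<Longrightarrow> f x i = f y i) \<Longrightarrow> x = y"
    and syn: "\<And>x j. x \<in> W \<Longrightarrow> j \<in> {1..d} \<Longrightarrow> syndrome h a n (f x) j = syndrome h a n e j"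
    and weight: "\<And>x. x \<in> W \<Longrightarrow> real (card {i. i < n \<and> f x i \<noteq> 0}) \<le> \<rho>"
  shows "card W \<le> card ((\<lambda>c. c - target h a d n e) ` code_of (gen_mat h a d n) \<inter>
    hamming_ball (d * h * (d + 1) + n) \<rho>)"
proof -
  let ?g = "d * h * (d + 1)"
  let ?c = "\<lambda>x. gen_mat h a d n *\<^sub>v Matrix.vec n (f x) - target h a d n e"
  have entry: "vec_index (?c x) r = (if r < ?g then 0 else f x (r - ?g))" if "x \<in> W" "r < ?g + n" for x r
  proof -
    have "r div h mod d + 1 \<in> {1..d}" using d by (auto simp: Suc_le_eq)
    then have "syndrome h a n (vec_index (Matrix.vec n (f x))) (r div h mod d + 1) =
        syndrome h a n e (r div h mod d + 1)"
      using syn[OF that(1)] syndrome_cong[of n "vec_index (Matrix.vec n (f x))" "f x" h a] by simp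
    then show ?thesis
      using that(2) gen_mat_mult[of "Matrix.vec n (f x)" n r d h a]
      by (auto simp: target_def Let_def target_entry_def simp del: index_mult_mat_vec)
  qed
  have dim: "dim_vec (?c x) = ?g + n" for x by simp
  show ?thesis
  proof (rule card_inj_on_le[where f = ?c])
    show "inj_on ?c W"
    proof (rule inj_onI, rule inj)
      fix x y i assume "x \<in> W" "y \<in> W" "?c x = ?c y" "i < n"
      then show "f x i = f y i" using entry[of x "?g + i"] entry[of y "?g + i"] by simp
    qed
    show "?c ` W \<subseteq> (\<lambda>c. c - target h a d n e) ` code_of (gen_mat h a d n) \<inter> hamming_ball (?g + n) \<rho>"
    proof (intro image_subsetI IntI)
      fix x assume x: "x \<in> W"
      show "?c x \<in> (\<lambda>c. c - target h a d n e) ` code_of (gen_mat h a d n)"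
        by (auto simp: code_of_def intro!: imageI exI[of _ "Matrix.vec n (f x)"])
      have "{r. r < ?g + n \<and> vec_index (?c x) r \<noteq> 0} \<subseteq> (\<lambda>i. ?g + i) ` {i. i < n \<and> f x i \<noteq> 0}"
      proof
        fix r assume "r \<in> {r. r < ?g + n \<and> vec_index (?c x) r \<noteq> 0}"
        then have "r < ?g + n" "\<not> r < ?g" "f x (r - ?g) \<noteq> 0"
          using entry[OF x, of r] by (auto split: if_splits)
        then show "r \<in> (\<lambda>i. ?g + i) ` {i. i < n \<and> f x i \<noteq> 0}"
          by (intro image_eqI[of _ _ "r - ?g"]) auto
      qed
      then have "hamming_weight (?c x) \<le> card {i. i < n \<and> f x i \<noteq> 0}"
        unfolding hamming_weight_def dim by (rule surj_card_le[rotated]) simp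
      then show "?c x \<in> hamming_ball (?g + n) \<rho>"
        using weight[OF x] dim by (auto simp: hamming_ball_def intro!: carrier_vecI)
    qed
    show "finite ((\<lambda>c. c - target h a d n e) ` code_of (gen_mat h a d n) \<inter> hamming_ball (?g + n) \<rho>)"
      by (rule finite_subset[OF _ finite_vec_set[of "?g + n"]]) (auto simp: hamming_ball_def)
  qed
qed

section \<open>Counting syndromes and supports\<close>

text \<open>A fibre with fewer than \<open>N\<close> elements contributes less than
  \<open>N\<close>, and there are at most as many fibres as values of \<open>f\<close>.\<close>

lemma card_sparse_fibres:
  assumes fin: "finite W" and N: "N > (0::real)"
  shows "real (card {x \<in> W. real (card {y \<in> W. f y = f x}) < N}) \<le> real (card (f ` W)) * N"
proof -
  let ?B = "{x \<in> W. real (card {y \<in> W. f y = f x}) < N}"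
  have "?B \<subseteq> (\<Union>z\<in>f ` ?B. {y \<in> W. f y = z})" by auto
  then have "card ?B \<le> card (\<Union>z\<in>f ` ?B. {y \<in> W. f y = z})"
    by (rule card_mono[rotated]) (use fin in auto)
  also have "\<dots> \<le> (\<Sum>z\<in>f ` ?B. card {y \<in> W. f y = z})"
    by (rule card_UN_le) (use fin in auto)
  finally have "real (card ?B) \<le> real (\<Sum>z\<in>f ` ?B. card {y \<in> W. f y = z})"
    by (simp only: of_nat_le_iff)
  also have "\<dots> = (\<Sum>z\<in>f ` ?B. real (card {y \<in> W. f y = z}))"
    by (rule of_nat_sum)
  also have "\<dots> \<le> (\<Sum>z\<in>f ` ?B. N)"
    by (rule sum_mono) auto
  also have "\<dots> = real (card (f ` ?B)) * N" by simp
  also have "\<dots> \<le> real (card (f ` W)) * N"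
    using N fin by (intro mult_right_mono) (auto intro!: card_mono)
  finally show ?thesis .
qed

text \<open>Among the exponents up to \<open>q l\<close> there are \<open>l\<close> multiples of
  \<open>q\<close>, which leaves \<open>(q - 1) l\<close> vectors of length \<open>h\<close>.
  Restricting the family to these exponents places it in a finite product.\<close>

lemma card_syndromes:
  fixes a :: "nat \<Rightarrow> 'a::{field,finite}" and f :: "'b \<Rightarrow> nat \<Rightarrow> 'a"
  assumes h: "h \<ge> 1"
  shows "card ((\<lambda>x. \<lambda>j\<in>{j\<in>{1..CARD('a) * l}. \<not> CARD('a) dvd j}. syndrome h a n (f x) j) ` W)
    \<le> CARD('a) ^ (h * ((CARD('a) - 1) * l))"
proof -
  let ?q = "CARD('a)"
  let ?J = "{j\<in>{1..?q * l}. \<not> ?q dvd j}"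
  have q: "?q > 0" using card_field_gt_1[where 'a = 'a] by simp
  have "{j\<in>{1..?q * l}. ?q dvd j} = (\<lambda>i. ?q * i) ` {1..l}"
  proof (intro equalityI subsetI)
    fix j assume "j \<in> {j\<in>{1..?q * l}. ?q dvd j}"
    then obtain i where i: "j = ?q * i" "1 \<le> j" "j \<le> ?q * l" by auto
    then have "1 \<le> i" by (cases i) auto
    moreover have "i \<le> l" using i q by simp
    ultimately show "j \<in> (\<lambda>i. ?q * i) ` {1..l}" using i(1) by simp
  next
    fix j assume "j \<in> (\<lambda>i. ?q * i) ` {1..l}"
    then show "j \<in> {j\<in>{1..?q * l}. ?q dvd j}" using q by auto
  qed
  then have multiples: "card {j\<in>{1..?q * l}. ?q dvd j} = l"
    using q by (simp add: card_image inj_on_def)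
  have "?J = {1..?q * l} - {j\<in>{1..?q * l}. ?q dvd j}" by auto
  then have "card ?J = card ({1..?q * l} - {j\<in>{1..?q * l}. ?q dvd j})" by (rule arg_cong)
  also have "\<dots> = card {1..?q * l} - card {j\<in>{1..?q * l}. ?q dvd j}"
    by (rule card_Diff_subset) auto
  also have "\<dots> = (?q - 1) * l"
    unfolding multiples by (simp add: diff_mult_distrib)
  finally have J: "card ?J = (?q - 1) * l" .
  have "card ((\<lambda>x. \<lambda>j\<in>?J. syndrome h a n (f x) j) ` W) \<le> card (?J \<rightarrow>\<^sub>E (vecs h :: (nat \<Rightarrow> 'a) set))"
  proof (rule card_mono)
    show "finite (?J \<rightarrow>\<^sub>E (vecs h :: (nat \<Rightarrow> 'a) set))" by (rule finite_PiE) simp_all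
    show "(\<lambda>x. \<lambda>j\<in>?J. syndrome h a n (f x) j) ` W \<subseteq> ?J \<rightarrow>\<^sub>E vecs h"
      by (intro image_subsetI) (simp add: PiE_iff syndrome_in_vecs[OF h, of a])
  qed
  also have "\<dots> = card (vecs h :: (nat \<Rightarrow> 'a) set) ^ card ?J"
    by (subst card_PiE) simp_all
  also have "\<dots> = ?q ^ (h * ((?q - 1) * l))"
    by (simp only: card_vecs J power_mult)
  finally show ?thesis .
qed

text \<open>By linearity it suffices that the syndromes of the difference vanish.\<close>

lemma syndromes_eq:
  fixes a :: "nat \<Rightarrow> 'a::{field,finite}"
  assumes h: "h \<ge> 1" and prim: "primitive_coeffs h a"
    and eq: "\<And>j. j \<in> {1..d} \<Longrightarrow> \<not> CARD('a) dvd j \<Longrightarrow> syndrome h a n e j = syndrome h a n e' j"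
    and j: "j \<in> {1..d}"
  shows "syndrome h a n e j = syndrome h a n e' j"
proof -
  have diff: "syndrome h a n (\<lambda>i. e i - e' i) j = (\<lambda>c. syndrome h a n e j c - syndrome h a n e' j c)" for j
    by (simp add: syndrome_def algebra_simps sum_subtractf)
  have "syndrome h a n (\<lambda>i. e i - e' i) j = (\<lambda>_. 0)"
    by (rule syndrome_eq_0_by_Frobenius[OF h prim _ j]) (simp add: diff eq)
  then show ?thesis by (simp add: diff fun_eq_iff)
qed

lemma pos_bounds: "u * 2 ^ v \<le> pos t bs u v \<and> pos t bs u v < Suc u * 2 ^ v"
  by (induction v) auto

lemma pos_div: "pos t bs u t div 2 ^ t = u"
proof -
  obtain r where "pos t bs u t = u * 2 ^ t + r" "r < 2 ^ t"
    using pos_bounds[of u t t bs] by (auto simp: le_iff_add)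
  then show ?thesis by simp
qed

lemma pos_less:
  assumes "u < w"
  shows "pos t bs u t < w * 2 ^ t"
proof -
  have "pos t bs u t < Suc u * 2 ^ t" using pos_bounds by blast
  also have "\<dots> \<le> w * 2 ^ t" using assms by (intro mult_le_mono1) simp
  finally show ?thesis .
qed

text \<open>The coins are the binary digits of the position within its block, recovered from the
  last one by parity.\<close>

lemma pos_eqD:
  assumes "pos t bs u v = pos t bs' u v" "i < v"
  shows "bs ! (u * t + i) = bs' ! (u * t + i)"
  using assms
proof (induction v)
  case (Suc v)
  from Suc.prems(1) have *: "2 * pos t bs u v + of_bool (bs ! (u * t + v)) = 2 * pos t bs' u v + of_bool (bs' ! (u * t + v))"
    by simp
  then have "pos t bs u v = pos t bs' u v" "bs ! (u * t + v) = bs' ! (u * t + v)"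
    by (cases "bs ! (u * t + v)"; cases "bs' ! (u * t + v)"; simp; presburger)+
  then show ?case using Suc by (auto simp: less_Suc_eq)
qed simp

definition sparse :: "nat \<Rightarrow> nat \<Rightarrow> bool list \<Rightarrow> nat \<Rightarrow> 'a::field" where
  "sparse w t bs i = of_bool (\<exists>u<w. i = pos t bs u t)"

text \<open>A position determines its block by \<open>pos_div\<close>, so the one that
  \<open>bs\<close> places in block \<open>u\<close> must also be the one of \<open>bs'\<close> in
  block \<open>u\<close>, and their bits agree. Counting words thus amounts to counting bit
  lists.\<close>

lemma sparse_inj:
  assumes len: "length bs = w * t" "length bs' = w * t" and n: "w * 2 ^ t \<le> n"
    and eq: "\<And>i. i < n \<Longrightarrow> sparse w t bs i = (sparse w t bs' i :: 'a::field)"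
  shows "bs = bs'"
proof (rule nth_equalityI)
  fix j assume "j < length bs"
  then have j: "j < w * t" using len by simp
  then have t: "t > 0" by (cases t) auto
  define u where "u = j div t"
  have u: "u < w" using j t by (simp add: u_def less_mult_imp_div_less)
  have "(sparse w t bs (pos t bs u t) :: 'a) = 1" using u by (auto simp: sparse_def)
  moreover have "pos t bs u t < n" using pos_less[OF u, of t bs] n by simp
  ultimately have "(sparse w t bs' (pos t bs u t) :: 'a) = 1" using eq by metis
  then obtain u' where u': "pos t bs u t = pos t bs' u' t" by (auto simp: sparse_def split: if_splits)
  then have "u' = u" by (metis pos_div)
  then have "bs ! (u * t + j mod t) = bs' ! (u * t + j mod t)"
    using u' t by (intro pos_eqD[of t bs u t bs']) auto
  then show "bs ! j = bs' ! j" by (simp add: u_def)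
qed (use len in simp)

lemma sparse_weight: "card {i. i < n \<and> sparse w t bs i \<noteq> (0 :: 'a::field)} \<le> w"
proof -
  have "{i. i < n \<and> sparse w t bs i \<noteq> (0 :: 'a)} \<subseteq> (\<lambda>u. pos t bs u t) ` {..<w}"
    by (auto simp: sparse_def)
  then have "card {i. i < n \<and> sparse w t bs i \<noteq> (0 :: 'a)} \<le> card {..<w}"
    by (rule surj_card_le[rotated]) simp
  then show ?thesis by simp
qed

text \<open>From \<open>8 \<le> q^3\<close> and \<open>m \<le> q^l\<close> one gets
  \<open>8 q m \<le> q^(4+l) \<le> q^(5l)\<close>; the constant \<open>30\<close> is
  \<open>5 * 6\<close>.\<close>

lemma field_size_ge:
  fixes q m l :: nat
  assumes q: "q \<ge> 2" and m: "m < 2 ^ l" "l \<ge> 1"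
  shows "(8 * q * m) ^ (6 * q) \<le> q ^ (30 * q * l)"
proof -
  have "(2::nat) ^ 3 \<le> q ^ 3" by (rule power_mono) (use q in auto)
  then have "8 * q * m \<le> q ^ 3 * q * 2 ^ l" using m by (intro mult_le_mono) auto
  also have "\<dots> \<le> q ^ 3 * q * q ^ l" using q by (intro mult_le_mono power_mono) auto
  also have "\<dots> = q ^ (4 + l)" by (simp add: power_add eval_nat_numeral)
  also have "\<dots> \<le> q ^ (5 * l)" using m q by (intro power_increasing) auto
  finally have "(8 * q * m) ^ (6 * q) \<le> (q ^ (5 * l)) ^ (6 * q)" by (intro power_mono) auto
  also have "\<dots> = q ^ (30 * q * l)" by (simp add: power_mult[symmetric] mult_ac)
  finally show ?thesis .
qed

text \<open>The expected number of random supports with a given syndrome, \<open>2\<^bsup>wt\<^esup>\<close> divided by the number of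
  syndromes, exceeds the required density by a factor of \<open>100\<close>.\<close>
lemma syndrome_count_bound:
  fixes q m k t h :: nat
  assumes q: "q \<ge> 2" and m: "k \<le> m" "m \<ge> 1" and size: "(8 * q * m) ^ (6 * q) \<le> q ^ h"
    and t: "q ^ h \<le> 2 * ((4 * q - 2) * k * 2 ^ t)"
  shows "(q * m) ^ (2 * (4 * q * k)) * q ^ (h * ((q - 1) * (4 * k))) \<le> 2 ^ ((4 * q - 2) * k * t)"
proof -
  define z where "z = 8 * q * m"
  define y where "y = (2::nat) ^ t"
  have z: "z > 0" using q m by (simp add: z_def)
  \<comment> \<open>Twice the weight is at most \<open>z\<close>, so a block has length at least
    \<open>q^h / z\<close>.\<close>
  have "2 * ((4 * q - 2) * k) \<le> 2 * (4 * q * m)" using m by (intro mult_le_mono) auto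
  then have "2 * ((4 * q - 2) * k) * y \<le> z * y" unfolding z_def by (intro mult_le_mono1) simp
  moreover have "q ^ h \<le> 2 * ((4 * q - 2) * k) * y" using t by (simp only: y_def mult.assoc)
  ultimately have hy: "q ^ h \<le> z * y" by (rule order.trans[rotated])
  \<comment> \<open>Per unit of \<open>k\<close>, at most \<open>12 q\<close> factors
    \<open>z\<close> cover the density and the loss in \<open>4q - 2\<close> block lengths. They are
    paid by \<open>(q^h)^2\<close>, where \<open>2\<close> is the surplus of \<open>4q - 2\<close>
    positions over \<open>4q - 4\<close> syndrome vectors.\<close>
  have e: "8 * q + (4 * q - 2) \<le> 2 * (6 * q)" "2 + (4 * q - 4) = 4 * q - 2" using q by auto
  have "(q * m) ^ (8 * q) * z ^ (4 * q - 2) \<le> z ^ (8 * q) * z ^ (4 * q - 2)"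
    by (intro mult_le_mono1 power_mono) (auto simp: z_def)
  also have "\<dots> = z ^ (8 * q + (4 * q - 2))" by (simp add: power_add)
  also have "\<dots> \<le> z ^ (2 * (6 * q))" using z e by (intro power_increasing) auto
  also have "\<dots> = (z ^ (6 * q)) ^ 2" by (simp add: power_mult[symmetric] mult.commute)
  also have "\<dots> \<le> (q ^ h) ^ 2" using size by (intro power_mono) (auto simp: z_def)
  finally have "(q * m) ^ (8 * q) * z ^ (4 * q - 2) * (q ^ h) ^ (4 * q - 4) \<le> (q ^ h) ^ 2 * (q ^ h) ^ (4 * q - 4)"
    by (rule mult_le_mono1)
  also have "\<dots> = (q ^ h) ^ (4 * q - 2)" by (simp only: power_add[symmetric] e)
  also have "\<dots> \<le> (z * y) ^ (4 * q - 2)" using hy by (rule power_mono) simp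
  finally have "z ^ (4 * q - 2) * ((q * m) ^ (8 * q) * (q ^ h) ^ (4 * q - 4)) \<le> z ^ (4 * q - 2) * y ^ (4 * q - 2)"
    by (simp add: power_mult_distrib mult_ac)
  then have "(q * m) ^ (8 * q) * (q ^ h) ^ (4 * q - 4) \<le> y ^ (4 * q - 2)"
    using z by simp
  then have "((q * m) ^ (8 * q) * (q ^ h) ^ (4 * q - 4)) ^ k \<le> (y ^ (4 * q - 2)) ^ k"
    by (rule power_mono) simp
  moreover have "((q * m) ^ (8 * q) * (q ^ h) ^ (4 * q - 4)) ^ k =
      (q * m) ^ (8 * q * k) * q ^ (h * ((4 * q - 4) * k))"
    by (simp only: power_mult_distrib power_mult[symmetric] mult_ac)
  moreover have "8 * q * k = 2 * (4 * q * k)" "(4 * q - 4) * k = (q - 1) * (4 * k)"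
    by (simp_all add: diff_mult_distrib)
  moreover have "(y ^ (4 * q - 2)) ^ k = 2 ^ ((4 * q - 2) * k * t)"
    by (simp only: y_def power_mult[symmetric] mult_ac)
  ultimately show ?thesis by simp
qed

definition bits :: "nat \<Rightarrow> bool list set" where
  "bits l = {bs. length bs = l}"

lemma card_bits: "card (bits l) = 2 ^ l"
  using card_lists_length_eq[of "UNIV :: bool set" l] by (simp add: bits_def)

lemma finite_bits: "finite (bits l)"
  using finite_lists_length_eq[of "UNIV :: bool set" l] by (simp add: bits_def)

section \<open>Local density and success probability\<close>

locale parameters =
  fixes q m k l t :: nat and a :: "nat \<Rightarrow> 'a::{field,finite}"
  assumes q: "CARD('a) = q" and k: "1 \<le> k" "k \<le> m" and l: "1 \<le> l" "m < 2 ^ l"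
    and t: "q ^ (30 * q * l) \<le> 2 * ((4 * q - 2) * k * 2 ^ t)" "t = 0 \<or> (4 * q - 2) * k * 2 ^ t < q ^ (30 * q * l)"
    and prim: "primitive_coeffs (30 * q * l) a"
begin

abbreviation "h \<equiv> 30 * q * l"
abbreviation "d \<equiv> 4 * q * k"
abbreviation "w \<equiv> (4 * q - 2) * k"
abbreviation "n \<equiv> q ^ h - 1"
abbreviation "N \<equiv> (real q * real m) ^ (2 * d) / 100"

lemma q2: "q \<ge> 2"
  using card_field_gt_1[where 'a = 'a] q by simp

lemma h1: "h \<ge> 1"
  using q2 l by simp

lemma size: "(8 * q * m) ^ (6 * q) \<le> q ^ h"
  using field_size_ge[OF q2 l(2,1)] .

lemma d_less: "d < q ^ h"
proof -
  have "4 * q * k < 8 * q * m" using k q2 by simp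
  also have "\<dots> = (8 * q * m) ^ 1" by simp
  also have "\<dots> \<le> (8 * q * m) ^ (6 * q)" using k q2 by (intro power_increasing) auto
  finally show ?thesis using size by simp
qed

lemma w_le_n: "w * 2 ^ t \<le> n"
proof -
  have "w * 2 ^ t < q ^ h"
  proof (cases "t = 0")
    case True
    have "w \<le> d" by (intro mult_le_mono1) simp
    then have "w < q ^ h" using d_less by (rule le_less_trans)
    then show ?thesis using True by simp
  qed (use t(2) in simp)
  then show ?thesis by simp
qed

lemma n_pos: "n \<ge> 1"
proof -
  have "d \<ge> 1" using k q2 by simp
  then show ?thesis using d_less by linarith
qed

definition synd :: "bool list \<Rightarrow> nat \<Rightarrow> nat \<Rightarrow> 'a" where
  "synd bs = (\<lambda>j\<in>{j \<in> {1..CARD('a) * (4 * k)}. \<not> CARD('a) dvd j}. syndrome h a n (sparse w t bs) j)"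

definition close :: "bool list \<Rightarrow> bool list set" where
  "close bs = {bs' \<in> bits (w * t). synd bs' = synd bs}"

lemma locally_dense:
  assumes "N \<le> real (card (close bs))"
  shows "locally_dense_code (1 - 1 / (2 * real q)) d N (d * h * (d + 1) + n) n (gen_mat h a d n)
    (target h a d n (sparse w t bs))"
proof -
  have d1: "d \<ge> 1" using q2 k by simp
  have dJ: "{1..d} = {1..CARD('a) * (4 * k)}" using q by (simp add: mult_ac)
  have radius: "(1 - 1 / (2 * real q)) * real d = real w"
    using q2 by (simp add: of_nat_diff field_simps)
  have "card (close bs) \<le> card ((\<lambda>c. c - target h a d n (sparse w t bs)) ` code_of (gen_mat h a d n) \<inter>
      hamming_ball (d * h * (d + 1) + n) (real w))"
  proof (rule card_close_codewords[OF d1])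
    show "x = y" if "x \<in> close bs" "y \<in> close bs" "\<And>i. i < n \<Longrightarrow> sparse w t x i = (sparse w t y i :: 'a)" for x y
      using sparse_inj[OF _ _ w_le_n that(3)] that(1,2) by (simp add: close_def bits_def)
    fix x j assume x: "x \<in> close bs"
    show "real (card {i. i < n \<and> sparse w t x i \<noteq> (0 :: 'a)}) \<le> real w"
      using sparse_weight by (intro of_nat_mono)
    assume "j \<in> {1..d}"
    then show "syndrome h a n (sparse w t x) j = syndrome h a n (sparse w t bs) j"
    proof (rule syndromes_eq[OF h1 prim, rotated])
      fix j assume "j \<in> {1..d}" "\<not> CARD('a) dvd j"
      then have "j \<in> {j \<in> {1..CARD('a) * (4 * k)}. \<not> CARD('a) dvd j}"
        unfolding dJ by (intro CollectI conjI)
      moreover have "synd x j = synd bs j" using x by (simp add: close_def)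
      ultimately show "syndrome h a n (sparse w t x) j = syndrome h a n (sparse w t bs) j"
        unfolding synd_def by simp
    qed
  qed
  then have "N \<le> real (card ((\<lambda>c. c - target h a d n (sparse w t bs)) ` code_of (gen_mat h a d n) \<inter>
      hamming_ball (d * h * (d + 1) + n) ((1 - 1 / (2 * real q)) * real d)))"
    unfolding radius using assms by (meson of_nat_mono order_trans)
  moreover have "enat d < min_distance (code_of (gen_mat h a d n))"
    by (rule min_distance_gen_mat[OF h1 d1 prim]) (simp add: q)
  moreover have "0 < N" using q2 k by simp
  moreover have "0 < 1 - 1 / (2 * real q)" "1 - 1 / (2 * real q) < 1" using q2 by simp_all
  moreover have "gen_mat h a d n \<in> carrier_mat (d * h * (d + 1) + n) n"
    "target h a d n (sparse w t bs) \<in> carrier_vec (d * h * (d + 1) + n)"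
    by (auto intro!: carrier_matI carrier_vecI)
  moreover have "0 < d" "0 < n" using d1 n_pos by linarith+
  moreover from this(2) have "0 < d * h * (d + 1) + n" by (rule trans_less_add2)
  ultimately show ?thesis
    unfolding locally_dense_code_def by (intro conjI)
qed

text \<open>A bit list is bad when its fibre under \<open>synd\<close> has fewer than
  \<open>N\<close> members. The number of syndromes times \<open>(qm)^(2d)\<close> is at most
  \<open>2^(wt)\<close>, so the denominator \<open>100\<close> of \<open>N\<close> limits the bad
  lists to a hundredth of all lists.\<close>

lemma prob_dense:
  "measure_pmf.prob (replicate_pmf (w * t) (bernoulli_pmf (1/2)))
    {bs \<in> bits (w * t). N \<le> real (card (close bs))} \<ge> 0.99"
proof -
  let ?B = "bits (w * t)"
  let ?G = "{bs \<in> ?B. N \<le> real (card (close bs))}"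
  let ?bad = "{bs \<in> ?B. real (card {bs' \<in> ?B. synd bs' = synd bs}) < N}"
  define M where "M = N"
  have Npos: "0 < M" using q2 k by (simp add: M_def)
  have "real (card ?bad) \<le> real (card (synd ` ?B)) * M"
    unfolding M_def[symmetric] by (rule card_sparse_fibres[OF finite_bits Npos])
  also have "\<dots> \<le> real (q ^ (h * ((q - 1) * (4 * k)))) * M"
  proof (rule mult_right_mono)
    have "card (synd ` ?B) \<le> q ^ (h * ((q - 1) * (4 * k)))"
      using card_syndromes[OF h1, where l = "4 * k" and n = n and a = a and f = "sparse w t" and W = ?B]
      unfolding synd_def q .
    then show "real (card (synd ` ?B)) \<le> real (q ^ (h * ((q - 1) * (4 * k))))" by (rule of_nat_mono)
  qed (use Npos in simp)
  also have "\<dots> = real ((q * m) ^ (2 * d) * q ^ (h * ((q - 1) * (4 * k)))) / 100"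
  proof -
    have "y * (x / 100) = x * y / 100" for x y :: real by simp
    then show ?thesis by (simp only: M_def of_nat_mult of_nat_power)
  qed
  also have "\<dots> \<le> real (2 ^ (w * t)) / 100"
    by (intro divide_right_mono of_nat_mono syndrome_count_bound[OF q2 k(2) _ size t(1)]) (use k in auto)
  finally have bad: "real (card ?bad) \<le> 2 ^ (w * t) / 100"
    by (simp only: of_nat_power of_nat_numeral)
  have "?G = ?B - ?bad" by (auto simp: close_def not_less)
  then have "card ?G = card (?B - ?bad)" by (rule arg_cong)
  also have "\<dots> = card ?B - card ?bad"
    by (rule card_Diff_subset) (use finite_bits in auto)
  finally have "card ?G = card ?B - card ?bad" .
  moreover have "card ?bad \<le> card ?B" by (rule card_mono[OF finite_bits]) auto
  ultimately have "real (card ?G) = 2 ^ (w * t) - real (card ?bad)"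
    by (simp add: of_nat_diff card_bits)
  moreover have "x / y \<ge> 0.99" if "x = y - z" "z \<le> y / 100" "y > 0" for x y z :: real
    using that by (simp add: field_simps)
  ultimately have "real (card ?G) / 2 ^ (w * t) \<ge> 0.99"
    using bad by (meson zero_less_numeral zero_less_power)
  moreover have "?G \<subseteq> {bs. length bs = w * t}" by (auto simp: bits_def)
  ultimately show ?thesis by (simp only: prob_replicate_coin)
qed

end

section \<open>Correctness of the program\<close>

text \<open>Combines \<open>q \<le> 2^q\<close> with \<open>2^l \<le> 2 m\<close>. The power of
  \<open>2 m\<close> on the right is the quantity \<open>y\<close> in which all times and sizes are
  expressed.\<close>

lemma field_size_le:
  fixes q m l :: nat
  assumes "1 \<le> l" "2 ^ (l - 1) \<le> m"
  shows "q ^ (30 * q * l) \<le> (2 * m) ^ (30 * q * q)"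
proof -
  have "q \<le> 2 ^ q" by (rule less_imp_le[OF less_exp])
  then have "q ^ (30 * q * l) \<le> (2 ^ q) ^ (30 * q * l)" by (rule power_mono) simp
  also have "\<dots> = (2 ^ l) ^ (30 * q * q)" by (simp only: power_mult[symmetric] mult_ac)
  also have "\<dots> \<le> (2 * m) ^ (30 * q * q)"
    using assms by (intro power_mono) (cases l, auto)
  finally show ?thesis .
qed

text \<open>A crude estimate, so that the same power of \<open>2 m\<close> dominates the distance
  too.\<close>

lemma distance_le:
  fixes q m k :: nat
  assumes "1 \<le> q" "1 \<le> k" "k \<le> m"
  shows "4 * q * k \<le> (2 * m) ^ (30 * q * q)"
proof -
  have "q \<le> 2 ^ q" by (rule less_imp_le[OF less_exp])
  then have "4 * q * k \<le> 2 ^ 2 * 2 ^ q * m ^ 1" using assms by (intro mult_le_mono) auto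
  also have "\<dots> \<le> 2 ^ 2 * 2 ^ q * m ^ (2 + q)" using assms by (intro mult_le_mono power_increasing) auto
  also have "\<dots> = (2 * m) ^ (2 + q)" by (simp add: power_add power_mult_distrib)
  also have "\<dots> \<le> (2 * m) ^ (30 * q * q)"
  proof (rule power_increasing)
    have "q * 1 \<le> q * q" using assms(1) by (intro mult_le_mono) auto
    then have "2 + q \<le> 30 * (q * q)" using assms(1) by linarith
    then show "2 + q \<le> 30 * q * q" by (simp only: mult.assoc)
  qed (use assms in simp)
  finally show ?thesis .
qed

context field_code
begin

definition prepare :: com where
  "prepare = Seq tables (Seq (sizes q) (Seq (blocks q) (Seq products search)))"

definition prepared :: "nat \<Rightarrow> nat \<Rightarrow> nat \<Rightarrow> nat \<Rightarrow> (nat \<Rightarrow> 'a) \<Rightarrow> memory \<Rightarrow> bool" where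
  "prepared m k l t a \<tau> \<longleftrightarrow> (let h = 30 * q * l; d = 4 * q * k; w = (4 * q - 2) * k; n = q ^ h - 1 in
     parameters q m k l t a \<and> 2 ^ (l - 1) \<le> m \<and> \<tau> ''h'' 0 = h \<and> \<tau> ''w'' 0 = w \<and> \<tau> ''t'' 0 = t \<and> \<tau> ''F'' 0 = w * t \<and>
     \<tau> ''D'' 0 = d * h \<and> \<tau> ''G'' 0 = d * h * (d + 1) \<and> \<tau> ''cols'' 0 = n \<and> \<tau> ''rows'' 0 = d * h * (d + 1) + n \<and>
     P_upto h a (Suc (n * d) * h) \<tau> \<and> tables_ok \<tau> \<and> (\<forall>j. \<tau> ''M'' j = 0))"

definition prepare_time :: "nat \<Rightarrow> nat" where
  "prepare_time y = 4 * (q * q) + 32 * y + (y + 1) * (y * y * (14 * y + 24) + 16 * y + 40) + 80"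

text \<open>The phases are composed backwards from the search, each with the facts about the memory
  that the remaining ones require; every loop bound is estimated by \<open>y\<close>.\<close>

lemma wp_prepare:
  assumes k: "1 \<le> k" "k \<le> m" and y: "y = (2 * m) ^ (30 * q * q)"
  shows "wp prepare (input_memory m k) (prepare_time y) (\<lambda>\<tau>. \<exists>l t a. prepared m k l t a \<tau>)"
proof -
  let ?\<sigma> = "input_memory m k"
  define d where "d = 4 * q * k"
  define w where "w = (4 * q - 2) * k"
  define H where "H l = 30 * q * l" for l
  let ?T4 = "(y + 1) * (y * y * (14 * y + 24) + 16 * y + 40)"
  have q: "q \<ge> 2" using q_gt_1 by simp
  have my: "m \<le> y"
  proof -
    have "m \<le> (2 * m) ^ 1" by simp
    also have "\<dots> \<le> y" unfolding y using k q by (intro power_increasing) auto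
    finally show ?thesis .
  qed
  have dy: "d \<le> y" unfolding d_def using distance_le[of q k m] k q y by simp
  have \<sigma>: "?\<sigma> ''m'' 0 = m" "?\<sigma> ''k'' 0 = k" "?\<sigma> ''N'' 0 = 0" "?\<sigma> ''a'' c = 0" "?\<sigma> ''M'' c = 0" for c
    by (simp_all add: input_memory_def)
  define Q where "Q = (\<lambda>\<tau>. \<exists>l t a. prepared m k l t a \<tau>)"
  have search: "wp search \<tau> ?T4 Q"
    if l: "1 \<le> l" "m < 2 ^ l" "2 ^ (l - 1) \<le> m"
      and t: "q ^ (H l) \<le> 2 * (w * 2 ^ t)" "t = 0 \<or> w * 2 ^ t < q ^ (H l)"
      and vars: "\<tau> ''h'' 0 = H l" "\<tau> ''w'' 0 = w" "\<tau> ''t'' 0 = t" "\<tau> ''F'' 0 = w * t"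
        "\<tau> ''D'' 0 = d * (H l)" "\<tau> ''G'' 0 = d * (H l) * (d + 1)" "\<tau> ''cols'' 0 = q ^ (H l) - 1"
        "\<tau> ''rows'' 0 = d * (H l) * (d + 1) + (q ^ (H l) - 1)"
        "\<tau> ''E'' 0 = (q ^ (H l) - 1) * d"
      and tab: "tables_ok \<tau>" and eq: "\<tau> ''N'' = ?\<sigma> ''N''" "\<tau> ''a'' = ?\<sigma> ''a''" "\<tau> ''M'' = ?\<sigma> ''M''" for \<tau> l t
  proof -
    let ?h = "H l"
    have h: "?h \<ge> 1" using l q by (simp add: H_def)
    have hy: "q ^ ?h \<le> y" unfolding y H_def by (rule field_size_le[OF l(1,3)])
    have "?h < q ^ ?h" using q less_exp[of ?h] power_mono[of 2 q ?h] by linarith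
    then have h': "?h \<le> y" using hy by linarith
    have "d \<ge> 1" using k q by (simp add: d_def)
    then have "(q ^ ?h - 1) * 1 \<le> (q ^ ?h - 1) * d" by (rule mult_le_mono2)
    then have nE: "\<tau> ''cols'' 0 \<le> Suc (\<tau> ''E'' 0)" unfolding vars by linarith
    have E: "\<tau> ''E'' 0 \<le> y * y" unfolding vars using hy dy by (intro mult_le_mono) auto
    have time: "(q ^ ?h + 1) * (\<tau> ''E'' 0 * (14 * ?h + 24) + 16 * ?h + 40) \<le> ?T4"
      using hy h' E by (intro mult_le_mono add_mono) auto
    show ?thesis
    proof (rule wp_conseq[OF wp_search[where \<sigma> = \<tau>, OF vars(1) h _ nE]])
      fix \<rho> assume *: "\<exists>a. primitive_coeffs ?h a \<and> P_upto ?h a (Suc (\<tau> ''E'' 0) * ?h) \<rho>"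
        and eq': "\<And>x. x \<notin> writes search \<Longrightarrow> \<rho> x = \<tau> x"
      obtain a where a: "primitive_coeffs ?h a" "P_upto ?h a (Suc (\<tau> ''E'' 0) * ?h) \<rho>"
        using * by blast
      have eqs: "\<rho> ''h'' = \<tau> ''h''" "\<rho> ''w'' = \<tau> ''w''" "\<rho> ''t'' = \<tau> ''t''" "\<rho> ''F'' = \<tau> ''F''" "\<rho> ''D'' = \<tau> ''D''"
        "\<rho> ''G'' = \<tau> ''G''" "\<rho> ''cols'' = \<tau> ''cols''" "\<rho> ''rows'' = \<tau> ''rows''" "\<rho> ''M'' = \<tau> ''M''"
        "\<rho> ''add'' = \<tau> ''add''" "\<rho> ''mul'' = \<tau> ''mul''"
        using eq' by simp_all
      have "parameters q m k l t a"
        by (unfold_locales) (use card_q k l t a in \<open>simp_all add: H_def w_def\<close>)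
      then have "prepared m k l t a \<rho>"
        using vars eqs a(2) tab tables_ok_cong[of \<rho> \<tau>] eq(3) \<sigma>(5) l(3) unfolding prepared_def Let_def H_def d_def w_def by simp
      then show "Q \<rho>" unfolding Q_def by blast
    qed (use vars card_q eq \<sigma> tab time in simp_all)
  qed
  have products: "wp (Seq products search) \<tau> (20 * y + 41 + ?T4) Q"
    if l: "1 \<le> l" "m < 2 ^ l" "2 ^ (l - 1) \<le> m"
      and t: "q ^ (H l) \<le> 2 * (w * 2 ^ \<tau> ''t'' 0)" "\<tau> ''t'' 0 = 0 \<or> w * 2 ^ \<tau> ''t'' 0 < q ^ (H l)"
      and vars: "\<tau> ''h'' 0 = H l" "\<tau> ''w'' 0 = w" "\<tau> ''d'' 0 = d" "\<tau> ''cols'' 0 = q ^ (H l) - 1"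
      and tab: "tables_ok \<tau>" and eq: "\<tau> ''N'' = ?\<sigma> ''N''" "\<tau> ''a'' = ?\<sigma> ''a''" "\<tau> ''M'' = ?\<sigma> ''M''" for \<tau> l
  proof -
    let ?h = "H l"
    have hy: "q ^ ?h \<le> y" unfolding y H_def by (rule field_size_le[OF l(1,3)])
    have "?h < q ^ ?h" using q less_exp[of ?h] power_mono[of 2 q ?h] by linarith
    moreover have "\<tau> ''t'' 0 \<le> y"
    proof (cases "\<tau> ''t'' 0 = 0")
      case False
      have "\<tau> ''t'' 0 < 1 * 2 ^ \<tau> ''t'' 0" by (simp add: less_exp)
      also have "\<dots> \<le> w * 2 ^ \<tau> ''t'' 0" using q k by (intro mult_le_mono1) (simp add: w_def)
      also have "\<dots> \<le> y" using False t(2) hy by linarith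
      finally show ?thesis by simp
    qed simp
    ultimately have time: "5 * \<tau> ''t'' 0 + 5 * \<tau> ''h'' 0 + 10 * \<tau> ''d'' 0 + 40 \<le> 20 * y + 40"
      using dy hy vars by linarith
    show ?thesis
    proof (rule wp_mono, rule wp_Seq'[OF wp_conseq[OF wp_products[of \<tau>] _ time]])
      fix \<rho> assume *: "\<rho> ''F'' 0 = \<tau> ''w'' 0 * \<tau> ''t'' 0 \<and> \<rho> ''D'' 0 = \<tau> ''d'' 0 * \<tau> ''h'' 0 \<and>
        \<rho> ''E'' 0 = \<tau> ''cols'' 0 * \<tau> ''d'' 0 \<and> \<rho> ''G'' 0 = \<tau> ''d'' 0 * \<tau> ''h'' 0 * (\<tau> ''d'' 0 + 1) \<and>
        \<rho> ''rows'' 0 = \<rho> ''G'' 0 + \<tau> ''cols'' 0"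
        and eq': "\<And>x. x \<notin> writes products \<Longrightarrow> \<rho> x = \<tau> x"
      have eqs: "\<rho> ''h'' = \<tau> ''h''" "\<rho> ''w'' = \<tau> ''w''" "\<rho> ''t'' = \<tau> ''t''" "\<rho> ''cols'' = \<tau> ''cols''" "\<rho> ''M'' = \<tau> ''M''"
        "\<rho> ''N'' = \<tau> ''N''" "\<rho> ''a'' = \<tau> ''a''" "\<rho> ''add'' = \<tau> ''add''" "\<rho> ''mul'' = \<tau> ''mul''"
        using eq' by simp_all
      show "wp search \<rho> ?T4 Q"
        by (rule search[OF l t]) (use * eqs vars eq tab tables_ok_cong[of \<rho> \<tau>] in simp_all)
    qed simp
  qed
  have blocks: "wp (Seq (blocks q) (Seq products search)) \<tau> (25 * y + 54 + ?T4) Q"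
    if l: "1 \<le> l" "m < 2 ^ l" "2 ^ (l - 1) \<le> m"
      and vars: "\<tau> ''h'' 0 = H l" "\<tau> ''n'' 0 = q ^ (H l)"
      and tab: "tables_ok \<tau>" and eq: "\<tau> ''k'' = ?\<sigma> ''k''" "\<tau> ''N'' = ?\<sigma> ''N''" "\<tau> ''a'' = ?\<sigma> ''a''" "\<tau> ''M'' = ?\<sigma> ''M''" for \<tau> l
  proof -
    have hy: "q ^ (H l) \<le> y" unfolding y H_def by (rule field_size_le[OF l(1,3)])
    have time: "5 * q ^ (H l) + 12 \<le> 5 * y + 12" using hy by simp
    have k\<tau>: "\<tau> ''k'' 0 = k" using eq \<sigma> by simp
    show ?thesis
    proof (rule wp_mono, rule wp_Seq'[OF wp_conseq[OF wp_blocks[where \<sigma> = \<tau> and q = q, OF k\<tau> k(1) vars(2)] _ time, folded d_def w_def]])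
      fix \<rho> assume *: "\<rho> ''d'' 0 = d \<and> \<rho> ''w'' 0 = w \<and> \<rho> ''cols'' 0 = q ^ (H l) - 1 \<and>
        (let t = \<rho> ''t'' 0; b = w * 2 ^ t in q ^ (H l) \<le> 2 * b \<and> (t = 0 \<or> b < q ^ (H l)))"
        and eq': "\<And>x. x \<notin> writes (blocks q) \<Longrightarrow> \<rho> x = \<tau> x"
      have eqs: "\<rho> ''h'' = \<tau> ''h''" "\<rho> ''M'' = \<tau> ''M''" "\<rho> ''N'' = \<tau> ''N''" "\<rho> ''a'' = \<tau> ''a''"
        "\<rho> ''add'' = \<tau> ''add''" "\<rho> ''mul'' = \<tau> ''mul''"
        using eq' by simp_all
      show "wp (Seq products search) \<rho> (20 * y + 41 + ?T4) Q"
        by (rule products[OF l]) (use * eqs vars eq tab tables_ok_cong[of \<rho> \<tau>] in \<open>simp_all add: Let_def\<close>)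
    qed (use q in simp_all)
  qed
  have sizes: "wp (Seq (sizes q) (Seq (blocks q) (Seq products search))) \<tau> (32 * y + 65 + ?T4) Q"
    if tab: "tables_ok \<tau>" and eq: "\<tau> ''m'' = ?\<sigma> ''m''" "\<tau> ''k'' = ?\<sigma> ''k''" "\<tau> ''N'' = ?\<sigma> ''N''" "\<tau> ''a'' = ?\<sigma> ''a''" "\<tau> ''M'' = ?\<sigma> ''M''" for \<tau>
  proof -
    have time: "7 * m + 10 \<le> 7 * y + 10" using my by simp
    have m\<tau>: "\<tau> ''m'' 0 = m" "1 \<le> m" using eq \<sigma> k by simp_all
    show ?thesis
    proof (rule wp_mono, rule wp_Seq'[OF wp_conseq[OF wp_sizes[where \<sigma> = \<tau> and q = q, OF m\<tau>] _ time, folded H_def]])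
      fix \<rho> assume "\<exists>l\<ge>1. m < 2 ^ l \<and> 2 ^ (l - 1) \<le> m \<and> \<rho> ''h'' 0 = H l \<and> \<rho> ''n'' 0 = q ^ (H l)"
        and eq': "\<And>x. x \<notin> writes (sizes q) \<Longrightarrow> \<rho> x = \<tau> x"
      then obtain l where l: "1 \<le> l" "m < 2 ^ l" "2 ^ (l - 1) \<le> m" and vars: "\<rho> ''h'' 0 = H l" "\<rho> ''n'' 0 = q ^ (H l)"
        by blast
      have eqs: "\<rho> ''k'' = \<tau> ''k''" "\<rho> ''M'' = \<tau> ''M''" "\<rho> ''N'' = \<tau> ''N''" "\<rho> ''a'' = \<tau> ''a''"
        "\<rho> ''add'' = \<tau> ''add''" "\<rho> ''mul'' = \<tau> ''mul''"
        using eq' by simp_all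
      show "wp (Seq (blocks q) (Seq products search)) \<rho> (25 * y + 54 + ?T4) Q"
        by (rule blocks[OF l]) (use vars eqs eq tab tables_ok_cong[of \<rho> \<tau>] in simp_all)
    qed simp
  qed
  have "wp prepare ?\<sigma> (prepare_time y) Q"
    unfolding prepare_def
  proof (rule wp_mono, rule wp_Seq'[OF wp_conseq[OF wp_tables _ order.refl]])
    fix \<tau> assume "tables_ok \<tau>" and eq: "\<And>x. x \<notin> writes tables \<Longrightarrow> \<tau> x = ?\<sigma> x"
    have "\<tau> x = ?\<sigma> x" if "x \<notin> {''add'', ''mul''}" for x
      using eq writes_tables that by blast
    then show "wp (Seq (sizes q) (Seq (blocks q) (Seq products search))) \<tau> (32 * y + 65 + ?T4) Q"
      using \<open>tables_ok \<tau>\<close> by (intro sizes) simp_all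
  qed (simp add: prepare_time_def)
  then show ?thesis unfolding Q_def .
qed

definition finish :: com where
  "finish = Seq marks write_code"

definition finish_time :: "nat \<Rightarrow> nat" where
  "finish_time y = y * (7 * y + 11) + (y * y * (y + 1) + y) * (24 * y + 34) + 16"

lemma prepared_le:
  assumes prep: "prepared m k l t a \<sigma>" and y: "y = (2 * m) ^ (30 * q * q)"
  shows "q ^ (30 * q * l) \<le> y" "30 * q * l \<le> y" "4 * q * k \<le> y" "(4 * q - 2) * k \<le> y" "t \<le> y"
proof -
  interpret parameters q m k l t a using prep by (simp add: prepared_def Let_def)
  have l': "2 ^ (l - 1) \<le> m" using prep by (simp add: prepared_def Let_def)
  show hy: "q ^ (30 * q * l) \<le> y" unfolding y by (rule field_size_le[OF l(1) l'])
  have "30 * q * l < q ^ (30 * q * l)"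
    using q2 less_exp[of "30 * q * l"] power_mono[of 2 q "30 * q * l"] by linarith
  then show "30 * q * l \<le> y" using hy by linarith
  show dy: "4 * q * k \<le> y" using distance_le[of q k m] k q2 y by simp
  have "(4 * q - 2) * k \<le> 4 * q * k" by (intro mult_le_mono1) simp
  then show "(4 * q - 2) * k \<le> y" using dy by linarith
  have "t < 1 * 2 ^ t" by (simp add: less_exp)
  also have "\<dots> \<le> (4 * q - 2) * k * 2 ^ t" using q2 k by (intro mult_le_mono1) simp
  also have "\<dots> \<le> q ^ (30 * q * l) - 1" by (rule w_le_n)
  finally show "t \<le> y" using hy by linarith
qed

text \<open>Here \<open>\<tau>\<close> is the memory after the coin tosses, which change only the
  counter \<open>i\<close> and the array \<open>R\<close>. For a fixed bit list the rest of the run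
  is deterministic.\<close>

lemma wp_finish:
  fixes a :: "nat \<Rightarrow> 'a"
  assumes prep: "prepared m k l t a \<sigma>" and y: "y = (2 * m) ^ (30 * q * q)"
    and len: "length bs = (4 * q - 2) * k * t"
    and \<tau>: "\<And>x. x \<noteq> ''i'' \<Longrightarrow> x \<noteq> ''R'' \<Longrightarrow> \<tau> x = \<sigma> x" "\<And>j. j < length bs \<Longrightarrow> \<tau> ''R'' j = of_bool (bs ! j)"
  shows "wp finish \<tau> (finish_time y) (\<lambda>\<rho>. outputs code \<rho>
    (gen_mat (30 * q * l) a (4 * q * k) (q ^ (30 * q * l) - 1))
    (target (30 * q * l) a (4 * q * k) (q ^ (30 * q * l) - 1) (sparse ((4 * q - 2) * k) t bs)))"
proof -
  interpret parameters q m k l t a using prep by (simp add: prepared_def Let_def)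
  note le = prepared_le[OF prep y]
  let ?g = "d * h * (d + 1)"
  have vars: "\<tau> ''h'' 0 = h" "\<tau> ''w'' 0 = w" "\<tau> ''t'' 0 = t" "\<tau> ''D'' 0 = d * h" "\<tau> ''G'' 0 = ?g" "\<tau> ''cols'' 0 = n"
    "\<tau> ''rows'' 0 = ?g + n"
    using prep \<tau>(1) by (simp_all add: prepared_def Let_def)
  have "P_upto h a (Suc (n * d) * h) \<sigma>"
    using prep by (simp only: prepared_def Let_def)
  then have P: "P_upto h a (Suc (n * d) * h) \<tau>"
    using \<tau>(1)[of "''P''"] by (simp only: P_upto_def) simp
  have tab: "tables_ok \<tau>"
    using prep \<tau>(1) tables_ok_cong[of \<tau> \<sigma>] by (simp add: prepared_def Let_def)
  have M: "\<tau> ''M'' j = 0" for j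
    using prep \<tau>(1) by (simp add: prepared_def Let_def)
  have d1: "d \<ge> 1" using q2 k by simp
  have time1: "w * (7 * t + 11) + 5 \<le> y * (7 * y + 11) + 5"
    using le by (intro add_right_mono mult_le_mono add_mono) auto
  have time2: "(?g + n) * (24 * n + 34) + 10 \<le> (y * y * (y + 1) + y) * (24 * y + 34) + 10"
  proof -
    have "n \<le> y" using le(1) by linarith
    then show ?thesis using le by (intro add_right_mono mult_le_mono add_mono) auto
  qed
  show ?thesis
    unfolding finish_def
  proof (rule wp_mono, rule wp_Seq'[OF wp_conseq[OF wp_marks[where \<sigma> = \<tau> and bs = bs, OF vars(2,3)] _ time1]])
    fix \<rho> assume marks: "\<forall>j. \<rho> ''M'' j = of_bool (\<exists>u<w. j = pos t bs u t)"
      and eq: "\<And>x. x \<notin> writes marks \<Longrightarrow> \<rho> x = \<tau> x"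
    have eqs: "\<rho> ''h'' = \<tau> ''h''" "\<rho> ''D'' = \<tau> ''D''" "\<rho> ''G'' = \<tau> ''G''" "\<rho> ''cols'' = \<tau> ''cols''" "\<rho> ''rows'' = \<tau> ''rows''"
      "\<rho> ''P'' = \<tau> ''P''" "\<rho> ''add'' = \<tau> ''add''" "\<rho> ''mul'' = \<tau> ''mul''"
      using eq by simp_all
    have P\<rho>: "P_upto h a (Suc (n * d) * h) \<rho>" using P unfolding P_upto_def eqs .
    have tab\<rho>: "tables_ok \<rho>" using tab eqs tables_ok_cong[of \<rho> \<tau>] by simp
    have vars\<rho>: "\<rho> ''h'' 0 = h" "\<rho> ''D'' 0 = d * h" "\<rho> ''G'' 0 = ?g" "\<rho> ''cols'' 0 = n" "\<rho> ''rows'' 0 = ?g + n"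
      unfolding eqs by (rule vars)+
    have e: "(sparse w t bs i :: 'a) = of_bool (\<rho> ''M'' i = 1)" for i
      using marks by (simp add: sparse_def)
    show "wp write_code \<rho> ((y * y * (y + 1) + y) * (24 * y + 34) + 10) (\<lambda>\<rho>. outputs code \<rho> (gen_mat h a d n)
        (target h a d n (sparse w t bs)))"
    proof (rule wp_conseq[OF wp_write_code[where \<sigma> = \<rho> and e = "sparse w t bs" and n = n and a = a and d = d, OF vars\<rho>(1) h1 vars\<rho>(2) d1 vars\<rho>(3-5) P\<rho> tab\<rho> e] _ time2])
      fix \<rho>' assume out: "\<forall>r<?g + n. \<rho>' ''s'' r = code (target_entry h a d ?g n (sparse w t bs) r) \<and>
          (\<forall>i<n. \<rho>' ''A'' (r * n + i) = code (gen_entry h a d ?g r i))"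
        and eq': "\<And>x. x \<notin> writes write_code \<Longrightarrow> \<rho>' x = \<rho> x"
      have "\<rho>' ''rows'' 0 = ?g + n" "\<rho>' ''cols'' 0 = n" using eq' vars\<rho> by simp_all
      moreover have "gen_mat h a d n $$ (r, i) = gen_entry h a d ?g r i" if "r < ?g + n" "i < n" for r i
        using that unfolding gen_mat_def Let_def by simp
      moreover have "vec_index (target h a d n (sparse w t bs)) r = target_entry h a d ?g n (sparse w t bs) r"
        if "r < ?g + n" for r
        using that unfolding target_def Let_def by simp
      ultimately show "outputs code \<rho>' (gen_mat h a d n) (target h a d n (sparse w t bs))"
        using out unfolding outputs_def dim_gen_mat dim_target by metis
    qed
  qed (use len \<tau>(2) M in \<open>simp_all add: finish_time_def\<close>)
qed

definition program :: com where
  "program = Seq prepare (Seq flips finish)"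

definition program_time :: "nat \<Rightarrow> nat" where
  "program_time y = prepare_time y + (5 * (y * y) + 3) + finish_time y + 2"

text \<open>The coins are tossed between two deterministic phases. The final memory is therefore a
  function \<open>out\<close> of the bit list, and events of the run become sets of equally likely
  lists.\<close>

lemma run_program:
  assumes k: "1 \<le> k" "k \<le> m" and y: "y = (2 * m) ^ (30 * q * q)"
  shows "\<exists>l t (a :: nat \<Rightarrow> 'a) out. parameters q m k l t a \<and> 2 ^ (l - 1) \<le> m \<and>
    q ^ (30 * q * l) \<le> y \<and> 30 * q * l \<le> y \<and> 4 * q * k \<le> y \<and>
    run (program_time y) program (input_memory m k) =
      map_pmf (\<lambda>bs. (Skip, out bs)) (replicate_pmf ((4 * q - 2) * k * t) (bernoulli_pmf (1/2))) \<and>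
    (\<forall>bs. length bs = (4 * q - 2) * k * t \<longrightarrow> outputs code (out bs)
      (gen_mat (30 * q * l) a (4 * q * k) (q ^ (30 * q * l) - 1))
      (target (30 * q * l) a (4 * q * k) (q ^ (30 * q * l) - 1) (sparse ((4 * q - 2) * k) t bs)))"
proof -
  obtain \<sigma> l t a where \<sigma>: "run (prepare_time y) prepare (input_memory m k) = return_pmf (Skip, \<sigma>)"
    and prep: "prepared m k l t a \<sigma>"
    using wp_prepare[OF k y] unfolding wp_def by blast
  interpret parameters q m k l t a using prep by (simp add: prepared_def Let_def)
  note le = prepared_le[OF prep y]
  let ?R = "replicate_pmf (w * t) (bernoulli_pmf (1/2))"
  let ?wb = "\<lambda>bs. write_bits bs (store ''i'' 0 0 \<sigma>)"
  have F: "\<sigma> ''F'' 0 = w * t" using prep by (simp add: prepared_def Let_def)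
  have "w * t \<le> y * y" using le by (intro mult_le_mono) auto
  then have flips: "run (5 * (y * y) + 3) flips \<sigma> = map_pmf (Pair Skip) (map_pmf ?wb ?R)"
    using run_flips[of \<sigma> "5 * (y * y) + 3"] F by simp
  have "\<exists>\<rho>. run (finish_time y) finish (?wb bs) = return_pmf (Skip, \<rho>) \<and> outputs code \<rho> (gen_mat h a d n)
      (target h a d n (sparse w t bs))" if "length bs = w * t" for bs
  proof -
    have "wp finish (?wb bs) (finish_time y) (\<lambda>\<rho>. outputs code \<rho> (gen_mat h a d n) (target h a d n (sparse w t bs)))"
    proof (rule wp_finish[OF prep y that])
      fix j assume "j < length bs"
      then show "?wb bs ''R'' j = of_bool (bs ! j)"
        using write_bits_R[of j bs "store ''i'' 0 0 \<sigma>"] by simp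
    qed (simp add: write_bits_other)
    then show ?thesis unfolding wp_def by blast
  qed
  note ex_out = this
  define out where "out bs = (SOME \<rho>. run (finish_time y) finish (?wb bs) = return_pmf (Skip, \<rho>) \<and>
      outputs code \<rho> (gen_mat h a d n) (target h a d n (sparse w t bs)))" for bs
  have out: "run (finish_time y) finish (?wb bs) = return_pmf (Skip, out bs)"
    "outputs code (out bs) (gen_mat h a d n) (target h a d n (sparse w t bs))" if "length bs = w * t" for bs
    using someI_ex[OF ex_out[OF that], folded out_def] by (rule conjunct1, rule conjunct2)
  \<comment> \<open>The composition rule expects a distribution for each memory; on the memories
    reached after the tosses it is a point mass.\<close>
  define E where "E \<tau> = map_pmf snd (run (finish_time y) finish \<tau>)" for \<tau>
  have len: "length bs = w * t" if "bs \<in> set_pmf ?R" for bs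
    using that by (simp add: set_replicate_pmf)
  have E: "run (finish_time y) finish \<tau> = map_pmf (Pair Skip) (E \<tau>)" if "\<tau> \<in> set_pmf (map_pmf ?wb ?R)" for \<tau>
  proof -
    obtain bs where "bs \<in> set_pmf ?R" "\<tau> = ?wb bs" using \<open>\<tau> \<in> _\<close> by auto
    then show ?thesis using out(1)[OF len] by (simp add: E_def)
  qed
  have "run (5 * (y * y) + 3 + finish_time y + 1) (Seq flips finish) \<sigma> = map_pmf (Pair Skip) (bind_pmf (map_pmf ?wb ?R) E)"
    by (rule run_Seq_map[OF flips E]) simp_all
  moreover have "bind_pmf (map_pmf ?wb ?R) E = map_pmf out ?R"
    unfolding bind_map_pmf unfolding map_pmf_def[of out]
    by (rule bind_pmf_cong) (use out(1) len in \<open>simp_all add: E_def\<close>)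
  ultimately have rest: "run (5 * (y * y) + 3 + finish_time y + 1) (Seq flips finish) \<sigma> = map_pmf (Pair Skip) (map_pmf out ?R)"
    by simp
  have "run (program_time y) program (input_memory m k) =
      map_pmf (Pair Skip) (bind_pmf (return_pmf \<sigma>) (\<lambda>_. map_pmf out ?R))"
    unfolding program_def
    by (rule run_Seq_map[where s = "prepare_time y" and u = "5 * (y * y) + 3 + finish_time y + 1"])
      (use \<sigma> rest in \<open>simp_all add: program_time_def\<close>)
  then have "run (program_time y) program (input_memory m k) = map_pmf (\<lambda>bs. (Skip, out bs)) ?R"
    by (simp add: bind_return_pmf pmf.map_comp comp_def)
  moreover have "2 ^ (l - 1) \<le> m" using prep by (simp add: prepared_def Let_def)
  ultimately show ?thesis
    using out(2) le(1-3) parameters_axioms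
    by (intro exI[of _ l] exI[of _ t] exI[of _ a] exI[of _ out] conjI allI impI)
qed

end

text \<open>After division by \<open>(qm)^d\<close> the claim is
  \<open>10^4 q^10 \<le> (qm)^d\<close>. Here \<open>m \<ge> 100 q\<close> gives
  \<open>10^4 q^2 \<le> m^2\<close>, and \<open>d \<ge> 8\<close> supplies the factor
  \<open>q^8 m^8\<close>.\<close>

lemma density_ge:
  fixes q m d :: nat
  assumes "2 \<le> q" "100 * q \<le> m" "8 \<le> d"
  shows "100 * real q ^ 10 * (real q * real m) ^ d \<le> (real q * real m) ^ (2 * d) / 100"
proof -
  have "(100 * q) ^ 2 * 1 \<le> m ^ 2 * m ^ 6"
    using assms by (intro mult_le_mono power_mono) auto
  then have "q ^ 8 * (10000 * q ^ 2) \<le> q ^ 8 * m ^ 8"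
    by (simp add: power_mult_distrib flip: power_add)
  moreover have "q ^ 10 = q ^ 8 * q ^ 2" by (simp flip: power_add)
  ultimately have "10000 * q ^ 10 \<le> (q * m) ^ 8"
    by (simp only: power_mult_distrib mult.left_commute)
  also have "\<dots> \<le> (q * m) ^ d" using assms by (intro power_increasing) auto
  finally have "real (10000 * q ^ 10) \<le> real ((q * m) ^ d)" by (rule of_nat_mono)
  then have "10000 * real q ^ 10 * (real q * real m) ^ d \<le> (real q * real m) ^ d * (real q * real m) ^ d"
    by (intro mult_right_mono) simp_all
  also have "\<dots> = (real q * real m) ^ (2 * d)" by (simp add: mult_2 power_add)
  finally show ?thesis by simp
qed

theorem theorem3p3:
  fixes q :: nat and \<gamma> :: nat and code :: "'a::{field,finite} \<Rightarrow> nat"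
  assumes "CARD('a) = q"
    and "\<gamma> = 4 * q"
    and "bij_betw code UNIV {..<q}"
  shows "\<exists>(prog :: com) (time :: nat poly) (size :: nat poly) (m0 :: nat).
    \<forall>m k. 1 \<le> k \<and> k \<le> m \<longrightarrow>
      (let d = \<gamma> * k;
           \<alpha> = 1 - 1 / (2 * real q);
           N = (real q * real m) ^ (2 * d) / 100
       in halts_within (poly time m) prog (input_memory m k) \<and>
          (m0 \<le> m \<longrightarrow>
             N \<ge> 100 * real q ^ 10 * (real q * real m) ^ d \<and>
             measure_pmf.prob (run (poly time m) prog (input_memory m k))
               {(c, \<sigma>). c = Skip \<and>
                  (\<exists>(A :: 'a mat) s m' n'.
                     outputs code \<sigma> A s \<and>
                     locally_dense_code \<alpha> d N m' n' A s \<and>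
                     m' \<le> poly size m \<and> n' \<le> poly size m)} \<ge> 0.99))"
proof -
  interpret field_code code q by unfold_locales (use assms in auto)
  \<comment> \<open>For fixed \<open>q\<close> this is a polynomial in \<open>m\<close> alone; the
    dependence of times and sizes on \<open>k\<close> has been absorbed by
    \<open>k \<le> m\<close>.\<close>
  define y :: "nat poly" where "y = [:0, 2:] ^ (30 * q * q)"
  have y: "poly y m = (2 * m) ^ (30 * q * q)" for m
    by (simp add: y_def mult.commute)
  define time where "time = [:4 * (q * q):] + 32 * y + (y + 1) * (y * y * (14 * y + 24) + 16 * y + 40) + 80
    + (5 * (y * y) + 3) + (y * (7 * y + 11) + (y * y * (y + 1) + y) * (24 * y + 34) + 16) + 2"
  have time: "poly time m = program_time (poly y m)" for m
    by (simp add: time_def program_time_def prepare_time_def finish_time_def)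
  define size where "size = y * y * (y + 1) + y"
  show ?thesis
  proof (rule exI[of _ program], rule exI[of _ time], rule exI[of _ size], rule exI[of _ "100 * q"],
      intro allI impI, unfold Let_def, intro conjI impI)
    fix m k :: nat assume mk: "1 \<le> k \<and> k \<le> m"
    obtain l t and a :: "nat \<Rightarrow> 'a" and out where par: "parameters q m k l t a"
      and le: "q ^ (30 * q * l) \<le> poly y m" "30 * q * l \<le> poly y m" "4 * q * k \<le> poly y m"
      and run: "run (poly time m) program (input_memory m k) =
        map_pmf (\<lambda>bs. (Skip, out bs)) (replicate_pmf ((4 * q - 2) * k * t) (bernoulli_pmf (1/2)))"
      and out: "\<And>bs. length bs = (4 * q - 2) * k * t \<Longrightarrow> outputs code (out bs)
        (gen_mat (30 * q * l) a (4 * q * k) (q ^ (30 * q * l) - 1))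
        (target (30 * q * l) a (4 * q * k) (q ^ (30 * q * l) - 1) (sparse ((4 * q - 2) * k) t bs))"
      using run_program[of k m "poly y m"] mk y time by metis
    interpret parameters q m k l t a by (rule par)
    show "halts_within (poly time m) program (input_memory m k)"
      by (rule halts_withinI[where D = "map_pmf out (replicate_pmf (w * t) (bernoulli_pmf (1/2)))"])
        (simp add: run pmf.map_comp comp_def)
    assume m0: "100 * q \<le> m"
    show "100 * real q ^ 10 * (real q * real m) ^ (\<gamma> * k) \<le> (real q * real m) ^ (2 * (\<gamma> * k)) / 100"
    proof (rule density_ge[OF q2 m0])
      have "4 * 2 * 1 \<le> 4 * q * k" using q2 k by (intro mult_le_mono) auto
      then show "8 \<le> \<gamma> * k" by (simp add: assms(2))
    qed
    let ?S = "{(c, \<sigma>). c = Skip \<and> (\<exists>(A :: 'a mat) s m' n'. outputs code \<sigma> A s \<and>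
      locally_dense_code (1 - 1 / (2 * real q)) (\<gamma> * k) ((real q * real m) ^ (2 * (\<gamma> * k)) / 100) m' n' A s \<and>
      m' \<le> poly size m \<and> n' \<le> poly size m)}"
    let ?G = "{bs \<in> bits (w * t). N \<le> real (card (close bs))}"
    have n: "n \<le> poly y m" using le(1) by linarith
    have rows: "d * h * (d + 1) + n \<le> poly size m"
      unfolding size_def poly_add poly_mult poly_1
      by (intro add_mono mult_le_mono le n order.refl)
    have "(Skip, out bs) \<in> ?S" if "bs \<in> ?G" for bs
    proof -
      have "outputs code (out bs) (gen_mat h a d n) (target h a d n (sparse w t bs))"
        using that by (intro out) (simp add: bits_def)
      moreover have "locally_dense_code (1 - 1 / (2 * real q)) (\<gamma> * k) ((real q * real m) ^ (2 * (\<gamma> * k)) / 100)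
          (d * h * (d + 1) + n) n (gen_mat h a d n) (target h a d n (sparse w t bs))"
        unfolding assms(2) using that by (intro locally_dense) simp
      moreover have "n \<le> poly size m" using rows by linarith
      ultimately show ?thesis using rows by blast
    qed
    then have "measure_pmf.prob (replicate_pmf (w * t) (bernoulli_pmf (1/2))) ?G \<le>
        measure_pmf.prob (replicate_pmf (w * t) (bernoulli_pmf (1/2))) ((\<lambda>bs. (Skip, out bs)) -` ?S)"
      by (intro measure_pmf.finite_measure_mono) auto
    also have "\<dots> = measure_pmf.prob (run (poly time m) program (input_memory m k)) ?S"
      by (simp add: run)
    finally show "measure_pmf.prob (run (poly time m) program (input_memory m k)) ?S \<ge> 0.99"
      using prob_dense by linarith
  qed
qed

end
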